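(* Let $1\le r\le\infty$, put $X^{(r)}=\bigl(\sum_{n\in\mathbb{N}_0}SL^\infty_n\bigr)_r$ and let $T: X^{(r)}\to X^{(r)}$ be an operator. Then for any $\eta>0$ there exist operators $R,S: X^{(r)}\to X^{(r)}$ such that for either $H=T$ or $H=\mathrm{Id}_{X^{(r)}}-T$ we have $$S\,H\,R=\mathrm{Id}_{X^{(r)}}.$$ The operators $R$ and $S$ can be chosen such that $\|R\|\,\|S\|\le 2+\eta$. Consequently, the spaces $\bigl(\sum_{n\in\mathbb{N}_0}SL^\infty_n\bigr)_r$, $1\le r\le\infty$, as well as $SL^\infty$, are all primary.
   Context: All spaces are over the real scalars. $\mathcal{D}=\{[(k-1)2^{-m},k2^{-m}) : m\in\mathbb{N}_0,\ 1\le k\le 2^m\}$ is the collection of dyadic intervals in $[0,1)$; $|\cdot|$ is Lebesgue measure; $\mathcal{D}_m=\{I\in\mathcal{D}:|I|=2^{-m}\}$ and $\mathcal{D}^m=\bigcup_{k=0}^m\mathcal{D}_k$. For $I\in\mathcal{D}$ with left half $I_0$ and right half $I_1$, the $L^\infty$-normalized Haar function is $h_I=\chi_{I_0}-\chi_{I_1}$. $SL^\infty$ is the (non-separable) Banach space of all $f=\sum_{I\in\mathcal{D}}a_Ih_I\in L^2$ ($a_I\in\mathbb{R}$) with finite norm $$\|f\|_{SL^\infty}=\Big\|\Big(\sum_{I\in\mathcal{D}}a_I^2h_I^2\Big)^{1/2}\Big\|_{L^\infty}.$$ For $m\in\mathbb{N}_0$, $SL^\infty_m=\mathrm{span}\{h_I:I\in\mathcal{D}^m\}\subset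 SL^\infty$, with the norm of $SL^\infty$. For $1\le r\le\infty$, $\bigl(\sum_{n\in\mathbb{N}_0}SL^\infty_n\bigr)_r$ is the $\ell^r$ direct sum: the space of sequences $(f_n)_{n\in\mathbb{N}_0}$ with $f_n\in SL^\infty_n$ such that $(\|f_n\|_{SL^\infty})_n\in\ell^r$, normed by the $\ell^r$-norm of $(\|f_n\|_{SL^\infty})_n$ (the supremum if $r=\infty$). "Operator" means bounded linear map between Banach spaces. A Banach space $X$ is primary if for every bounded projection $Q:X\to X$, either $Q(X)$ or $(\mathrm{Id}-Q)(X)$ is isomorphic (linearly homeomorphic) to $X$. *)

theory Defs
  imports "HOL-Analysis.Analysis" "HOL-Probability.Essential_Supremum" "HOL-Library.Function_Algebras"
begin

section \<open>The Hilbert space of square-integrable functions on the unit interval\<close>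

abbreviation unit_leb :: "real measure"
  where "unit_leb \<equiv> lebesgue_on {0..<1}"

definition sq_integrable :: "(real \<Rightarrow> real) \<Rightarrow> bool"
  where "sq_integrable f \<longleftrightarrow> f \<in> borel_measurable unit_leb \<and> integrable unit_leb (\<lambda>x. (f x)\<^sup>2)"

definition lsq_eq :: "(real \<Rightarrow> real) \<Rightarrow> (real \<Rightarrow> real) \<Rightarrow> bool"
  where "lsq_eq f g \<longleftrightarrow> sq_integrable f \<and> sq_integrable g \<and> (AE x in unit_leb. f x = g x)"

lemma sq_integrable_mult:
  assumes "sq_integrable f" "sq_integrable g"
  shows "integrable unit_leb (\<lambda>x. f x * g x)"
proof (rule Bochner_Integration.integrable_bound)
  show "integrable unit_leb (\<lambda>x. (f x)\<^sup>2 + (g x)\<^sup>2)"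
    using assms by (simp add: sq_integrable_def)
  show "(\<lambda>x. f x * g x) \<in> borel_measurable unit_leb"
    using assms by (simp add: sq_integrable_def borel_measurable_times)
  have "norm (a * b) \<le> norm (a\<^sup>2 + b\<^sup>2)" for a b :: real
  proof -
    have "2 * \<bar>a * b\<bar> \<le> a\<^sup>2 + b\<^sup>2"
      using sum_squares_bound[of "\<bar>a\<bar>" "\<bar>b\<bar>"] by (simp add: abs_mult)
    then show ?thesis by simp
  qed
  then show "AE x in unit_leb. norm (f x * g x) \<le> norm ((f x)\<^sup>2 + (g x)\<^sup>2)"
    by simp
qed

lemma sq_integrable_add:
  assumes "sq_integrable f" "sq_integrable g"
  shows "sq_integrable (\<lambda>x. f x + g x)"
proof -
  have "integrable unit_leb (\<lambda>x. (f x)\<^sup>2 + (g x)\<^sup>2 + 2 * (f x * g x))"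
    using assms sq_integrable_mult[OF assms]
    by (intro Bochner_Integration.integrable_add integrable_mult_right)
       (auto simp: sq_integrable_def)
  then have "integrable unit_leb (\<lambda>x. (f x + g x)\<^sup>2)"
    by (simp add: power2_sum mult.assoc)
  then show ?thesis
    using assms by (auto simp: sq_integrable_def)
qed

lemma sq_integrable_scale:
  assumes "sq_integrable f"
  shows "sq_integrable (\<lambda>x. c * f x)"
  using assms by (auto simp: sq_integrable_def power_mult_distrib)

lemma sq_integrable_zero: "sq_integrable (\<lambda>x. 0)"
  by (simp add: sq_integrable_def)

quotient_type lsq = "real \<Rightarrow> real" / partial: lsq_eq
proof (rule part_equivpI)
  show "\<exists>f. lsq_eq f f"
    using sq_integrable_zero by (auto simp: lsq_eq_def)
  show "symp lsq_eq"
    by (auto simp: symp_def lsq_eq_def elim: eventually_mono)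
  show "transp lsq_eq"
    unfolding transp_def lsq_eq_def by (auto elim: eventually_elim2)
qed

instantiation lsq :: real_inner
begin

lift_definition zero_lsq :: lsq is "\<lambda>x. 0"
  by (simp add: lsq_eq_def sq_integrable_zero)

lift_definition plus_lsq :: "lsq \<Rightarrow> lsq \<Rightarrow> lsq" is "\<lambda>f g x. f x + g x"
  by (auto simp: lsq_eq_def sq_integrable_add elim: eventually_elim2)

lift_definition scaleR_lsq :: "real \<Rightarrow> lsq \<Rightarrow> lsq" is "\<lambda>c f x. c * f x"
  by (auto simp: lsq_eq_def sq_integrable_scale elim: eventually_mono)

lift_definition inner_lsq :: "lsq \<Rightarrow> lsq \<Rightarrow> real" is "\<lambda>f g. LINT x|unit_leb. f x * g x"
  unfolding lsq_eq_def sq_integrable_def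
  by (intro integral_cong_AE) (auto elim: eventually_elim2)

definition uminus_lsq :: "lsq \<Rightarrow> lsq" where "uminus_lsq f = (- 1) *\<^sub>R f"

definition minus_lsq :: "lsq \<Rightarrow> lsq \<Rightarrow> lsq" where "minus_lsq f g = f + (- 1) *\<^sub>R g"

definition norm_lsq :: "lsq \<Rightarrow> real" where "norm_lsq f = sqrt (f \<bullet> f)"

definition sgn_lsq :: "lsq \<Rightarrow> lsq" where "sgn_lsq f = inverse (norm f) *\<^sub>R f"

definition dist_lsq :: "lsq \<Rightarrow> lsq \<Rightarrow> real" where "dist_lsq f g = norm (f - g)"

definition uniformity_lsq :: "(lsq \<times> lsq) filter"
  where "uniformity_lsq = (INF e\<in>{0<..}. principal {(f, g). dist f g < e})"

definition open_lsq :: "lsq set \<Rightarrow> bool"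
  where "open_lsq U \<longleftrightarrow> (\<forall>f\<in>U. eventually (\<lambda>(f', g). f' = f \<longrightarrow> g \<in> U) uniformity)"

instance
proof
  fix f g h :: lsq and c d :: real
  show "f + g + h = f + (g + h)"
    by transfer (auto simp: lsq_eq_def sq_integrable_add add.assoc)
  show "f + g = g + f"
    by transfer (auto simp: lsq_eq_def sq_integrable_add add.commute)
  show "0 + f = f"
    by transfer (auto simp: lsq_eq_def)
  show "- f + f = 0"
    unfolding uminus_lsq_def
    by transfer (use sq_integrable_zero in \<open>auto simp: lsq_eq_def\<close>)
  show "f - g = f + - g"
    by (simp add: minus_lsq_def uminus_lsq_def)
  show "c *\<^sub>R (f + g) = c *\<^sub>R f + c *\<^sub>R g"
    by transfer
       (auto simp: lsq_eq_def sq_integrable_add sq_integrable_scale distrib_left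
             intro!: sq_integrable_add[OF sq_integrable_scale sq_integrable_scale, unfolded distrib_left])
  show "(c + d) *\<^sub>R f = c *\<^sub>R f + d *\<^sub>R f"
  proof transfer
    fix c d :: real and f :: "real \<Rightarrow> real"
    assume "lsq_eq f f"
    then have *: "sq_integrable f" by (simp add: lsq_eq_def)
    show "lsq_eq (\<lambda>x. (c + d) * f x) (\<lambda>x. c * f x + d * f x)"
      using sq_integrable_scale[OF *] sq_integrable_add[OF sq_integrable_scale[OF *] sq_integrable_scale[OF *]]
      by (simp add: lsq_eq_def distrib_right)
  qed
  show "c *\<^sub>R d *\<^sub>R f = (c * d) *\<^sub>R f"
    by transfer (auto simp: lsq_eq_def sq_integrable_scale mult.assoc)
  show "1 *\<^sub>R f = f"
    by transfer (auto simp: lsq_eq_def)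
  show "dist f g = norm (f - g)"
    by (simp add: dist_lsq_def)
  show "sgn f = inverse (norm f) *\<^sub>R f"
    by (simp add: sgn_lsq_def)
  show "uniformity = (INF e\<in>{0<..}. principal {(f, g :: lsq). dist f g < e})"
    by (simp add: uniformity_lsq_def)
  show "open U \<longleftrightarrow> (\<forall>f\<in>U. eventually (\<lambda>(f', g). f' = f \<longrightarrow> g \<in> U) uniformity)" for U :: "lsq set"
    by (simp add: open_lsq_def)
  show "f \<bullet> g = g \<bullet> f"
    by transfer (simp add: mult.commute)
  show "(f + g) \<bullet> h = f \<bullet> h + g \<bullet> h"
    by transfer (auto simp: lsq_eq_def distrib_right sq_integrable_mult)
  show "c *\<^sub>R f \<bullet> g = c * (f \<bullet> g)"
    by transfer (simp add: mult.assoc)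
  show "0 \<le> f \<bullet> f"
    by transfer simp
  show "f \<bullet> f = 0 \<longleftrightarrow> f = 0"
    by transfer
       (auto simp: lsq_eq_def sq_integrable_zero sq_integrable_def integral_nonneg_eq_0_iff_AE
             simp flip: power2_eq_square)
  show "norm f = sqrt (f \<bullet> f)"
    by (simp add: norm_lsq_def)
qed

end

section \<open>Functions into a vector space, with pointwise operations\<close>

instantiation "fun" :: (type, real_vector) real_vector
begin

definition scaleR_fun :: "real \<Rightarrow> ('a \<Rightarrow> 'b) \<Rightarrow> 'a \<Rightarrow> 'b"
  where "scaleR_fun c f = (\<lambda>x. c *\<^sub>R f x)"

instance
  by standard (simp_all add: scaleR_fun_def plus_fun_def scaleR_add_right scaleR_add_left)

end

section \<open>Normed spaces, operators and primariness\<close>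

text \<open>
  A normed space is given by its underlying subspace of an ambient real vector space together with
  its norm. Only values on that subspace are meaningful, both for the norm and for maps.
\<close>

record 'a nspace =
  vecs :: "'a set"
  vnorm :: "'a \<Rightarrow> real"

definition operator :: "'a::real_vector nspace \<Rightarrow> 'b::real_vector nspace \<Rightarrow> ('a \<Rightarrow> 'b) \<Rightarrow> bool"
  where "operator X Y T \<longleftrightarrow>
    (\<forall>x\<in>vecs X. T x \<in> vecs Y) \<and>
    (\<forall>x\<in>vecs X. \<forall>y\<in>vecs X. T (x + y) = T x + T y) \<and>
    (\<forall>c. \<forall>x\<in>vecs X. T (c *\<^sub>R x) = c *\<^sub>R T x) \<and>
    (\<exists>K. \<forall>x\<in>vecs X. vnorm Y (T x) \<le> K * vnorm X x)"

definition op_norm :: "'a nspace \<Rightarrow> 'b nspace \<Rightarrow> ('a \<Rightarrow> 'b) \<Rightarrow> real"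
  where "op_norm X Y T = (SUP x\<in>{x \<in> vecs X. vnorm X x \<le> 1}. vnorm Y (T x))"

definition isomorphic :: "'a::real_vector nspace \<Rightarrow> 'b::real_vector nspace \<Rightarrow> bool"
  where "isomorphic X Y \<longleftrightarrow>
    (\<exists>U V. operator X Y U \<and> operator Y X V \<and>
       (\<forall>x\<in>vecs X. V (U x) = x) \<and> (\<forall>y\<in>vecs Y. U (V y) = y))"

text \<open>The range of a map, normed as a subspace of the codomain.\<close>

definition op_range :: "'a nspace \<Rightarrow> 'b nspace \<Rightarrow> ('a \<Rightarrow> 'b) \<Rightarrow> 'b nspace"
  where "op_range X Y T = \<lparr>vecs = T ` vecs X, vnorm = vnorm Y\<rparr>"

definition projection :: "'a::real_vector nspace \<Rightarrow> ('a \<Rightarrow> 'a) \<Rightarrow> bool"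
  where "projection X Q \<longleftrightarrow> operator X X Q \<and> (\<forall>x\<in>vecs X. Q (Q x) = Q x)"

definition primary :: "'a::real_vector nspace \<Rightarrow> bool"
  where "primary X \<longleftrightarrow>
    (\<forall>Q. projection X Q \<longrightarrow>
       isomorphic (op_range X X Q) X \<or> isomorphic (op_range X X (\<lambda>x. x - Q x)) X)"

section \<open>The Haar system and the spaces built from it\<close>

definition dyadic_level :: "nat \<Rightarrow> real set set"
  where "dyadic_level m = {{(real k - 1) / 2 ^ m ..< real k / 2 ^ m} | k. 1 \<le> k \<and> k \<le> 2 ^ m}"

definition dyadic :: "real set set"
  where "dyadic = (\<Union>m. dyadic_level m)"

definition dyadic_upto :: "nat \<Rightarrow> real set set"
  where "dyadic_upto m = (\<Union>k\<in>{0..m}. dyadic_level k)"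

definition left_half :: "real set \<Rightarrow> real set"
  where "left_half I = {Inf I ..< (Inf I + Sup I) / 2}"

definition right_half :: "real set \<Rightarrow> real set"
  where "right_half I = {(Inf I + Sup I) / 2 ..< Sup I}"

definition haar :: "real set \<Rightarrow> real \<Rightarrow> real"
  where "haar I x = indicator (left_half I) x - indicator (right_half I) x"

lemma sq_integrable_haar: "sq_integrable (haar I)"
proof -
  interpret finite_measure unit_leb
    by (rule finite_measure_lebesgue_on) (simp add: bounded_set_imp_lmeasurable)
  have m: "haar I \<in> borel_measurable unit_leb"
    unfolding haar_def[abs_def] left_half_def right_half_def
    by (intro measurable_restrict_space1 borel_measurable_diff borel_measurable_indicator) simp_all
  have "integrable unit_leb (\<lambda>x. (haar I x)\<^sup>2)"
  proof (rule integrable_const_bound[where B = 1])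
    show "AE x in unit_leb. norm ((haar I x)\<^sup>2) \<le> 1"
      by (simp add: haar_def indicator_def)
    show "(\<lambda>x. (haar I x)\<^sup>2) \<in> borel_measurable unit_leb"
      using m by (rule borel_measurable_power)
  qed
  with m show ?thesis
    by (simp add: sq_integrable_def)
qed

lift_definition haar_lsq :: "real set \<Rightarrow> lsq" is haar
  by (simp add: lsq_eq_def sq_integrable_haar)

definition haar_expansion :: "(real set \<Rightarrow> real) \<Rightarrow> lsq \<Rightarrow> bool"
  where "haar_expansion a f \<longleftrightarrow> ((\<lambda>I. a I *\<^sub>R haar_lsq I) has_sum f) dyadic"

definition ennsqrt :: "ennreal \<Rightarrow> ennreal"
  where "ennsqrt t = (if t = \<infinity> then \<infinity> else ennreal (sqrt (enn2real t)))"

definition square_fun :: "(real set \<Rightarrow> real) \<Rightarrow> real \<Rightarrow> ennreal"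
  where "square_fun a x = ennsqrt (\<Sum>\<^sub>\<infinity>I\<in>dyadic. ennreal ((a I)\<^sup>2 * (haar I x)\<^sup>2))"

definition square_norm :: "(real set \<Rightarrow> real) \<Rightarrow> ennreal"
  where "square_norm a = esssup unit_leb (square_fun a)"

text \<open>
  The Haar functions are nonzero and pairwise orthogonal, so the coefficients of an expansion are
  determined on \<open>dyadic\<close>, and only these enter \<open>square_norm\<close>; the choice below is immaterial.
\<close>

definition haar_coeffs :: "lsq \<Rightarrow> real set \<Rightarrow> real"
  where "haar_coeffs f = (SOME a. haar_expansion a f)"

definition SL_norm :: "lsq \<Rightarrow> real"
  where "SL_norm f = enn2real (square_norm (haar_coeffs f))"

definition SL_inf :: "lsq nspace"
  where "SL_inf = \<lparr>vecs = {f. \<exists>a. haar_expansion a f \<and> square_norm a < \<infinity>}, vnorm = SL_norm\<rparr>"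

definition SL_fin :: "nat \<Rightarrow> lsq nspace"
  where "SL_fin m = \<lparr>vecs = span (haar_lsq ` dyadic_upto m), vnorm = SL_norm\<rparr>"

definition ell_mem :: "ennreal \<Rightarrow> (nat \<Rightarrow> real) \<Rightarrow> bool"
  where "ell_mem r u \<longleftrightarrow>
    (if r = \<infinity> then bounded (range u) else summable (\<lambda>n. \<bar>u n\<bar> powr enn2real r))"

definition ell_norm :: "ennreal \<Rightarrow> (nat \<Rightarrow> real) \<Rightarrow> real"
  where "ell_norm r u =
    (if r = \<infinity> then (SUP n. \<bar>u n\<bar>)
     else (\<Sum>n. \<bar>u n\<bar> powr enn2real r) powr (1 / enn2real r))"

definition direct_sum :: "ennreal \<Rightarrow> (nat \<Rightarrow> 'a nspace) \<Rightarrow> (nat \<Rightarrow> 'a) nspace"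
  where "direct_sum r X =
    \<lparr>vecs = {f. (\<forall>n. f n \<in> vecs (X n)) \<and> ell_mem r (\<lambda>n. vnorm (X n) (f n))},
     vnorm = (\<lambda>f. ell_norm r (\<lambda>n. vnorm (X n) (f n)))\<rparr>"

abbreviation SL_sum :: "ennreal \<Rightarrow> (nat \<Rightarrow> lsq) nspace"
  where "SL_sum r \<equiv> direct_sum r SL_fin"

end

theory Submission
  imports Defs "HOL-Library.Sublist"
begin

text \<open>
  Code dyadic intervals by finite bit lists. In Haar coefficients, the norm of \<open>SL\<^sup>\<infinity>\<close> is the
  supremum over the branches of the dyadic tree of the \<open>\<ell>\<^sup>2\<close> norm along the branch.

  Replace every node of a tree by a chain of \<open>L\<close> nodes of a much taller tree. A combination of the
  nodes of a chain with \<open>\<ell>\<^sup>2\<close>-normalised coefficients behaves like the single node it replaces, and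
  the coefficients can be chosen to satisfy fewer than \<open>L\<close> homogeneous linear conditions. Doing this
  successively for the nodes of one tree in infinitely many summands makes all off-diagonal
  entries of \<open>T\<close> with respect to the resulting block vectors vanish. Colour a node according to
  whether its diagonal entry is at least \<open>1 / 2\<close>. Every colouring of a tree of depth \<open>2 k\<close> contains
  a monochromatic tree of depth \<open>k\<close>, and one colour occurs for infinitely many \<open>k\<close>, so that
  \<open>T\<close> or \<open>Id - T\<close> is diagonal with entries at least \<open>1 / 2\<close> on a copy of the whole space.
  Inverting the diagonal costs a factor 2. For \<open>r = \<infinity>\<close> the summands are thinned out along a member
  of an almost disjoint family, so that functionals are determined by their values on single
  summands.

  Primariness follows by Pelczynski's decomposition method. \<open>SL\<^sup>\<infinity>\<close> is isomorphic to the
  \<open>\<ell>\<^sup>\<infinity>\<close> sum: it embeds by truncations, with limits of coefficients as a left inverse, and it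
  contains the sum on disjoint dyadic intervals.
\<close>

section \<open>The sequence spaces\<close>

text \<open>The factor 2 comes from biorthogonality: on a block vector the diagonal entries of
  \<open>T\<close> and of \<open>Id - T\<close> add up to 1, so one of them is at least 1 / 2.
  Off-diagonal entries are made exactly 0 by linear algebra instead of merely small, so the diagonal
  can be inverted entry by entry and the two factors have bounds 1 and 2. This requires finitely
  many conditions per block, hence a numbering of all nodes of all trees in order type \<omega>,
  with chain lengths governed by that numbering. The obstacle is the passage to infinite
  combinations of blocks: matrix entries determine an operator on finitely supported sequences only,
  and for r = \<infinity> a functional may vanish on all of these without being 0. The remedy comes
  after blocks and colour are fixed. It concerns only the countably many functionals that read off
  block coefficients, and dropping summands is harmless, because any infinite family of copies of
  growing depth still carries the whole space. For the decomposition method the sum of copies of the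
  space must be complemented in the space; this holds because each finite tree occurs inside all
  deeper ones.\<close>

lemma powr_convex_nonneg:
  fixes p s t x y :: real
  assumes p: "1 \<le> p" and st: "0 \<le> s" "0 \<le> t" "s + t = 1" and xy: "0 \<le> x" "0 \<le> y"
  shows "(s * x + t * y) powr p \<le> s * x powr p + t * y powr p"
proof -
  \<comment> \<open>For a zero argument the claim reduces to this scaling bound, that is, to
    \<open>t powr p \<le> t\<close> on [0, 1]; convexity of the power is applied to positive
    arguments only.\<close>
  have *: "(t * y) powr p \<le> t * y powr p" if "0 \<le> t" "t \<le> 1" "0 \<le> y" for t y :: real
  proof (cases "t = 0")
    case False
    then have "t powr p \<le> t"
      using that p by (intro powr_le_one_le) auto
    then show ?thesis
      using that by (simp add: powr_mult mult_right_mono)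
  qed simp
  show ?thesis
  proof (cases "x = 0 \<or> y = 0")
    case True
    then show ?thesis
      using *[of t y] *[of s x] st xy p by auto
  next
    case False
    have s: "s = 1 - t"
      using st by simp
    show ?thesis
      using convex_onD[OF powr_convex[OF p], of t x y] st xy False unfolding s by simp
  qed
qed

text \<open>Without membership the value of \<open>ell_norm\<close> is meaningless, so the two are
  bundled. For finite r the bundle is equivalent to a plain inequality between extended reals, in
  which no convergence has to be proved.\<close>

definition ell_le :: "ennreal \<Rightarrow> (nat \<Rightarrow> real) \<Rightarrow> real \<Rightarrow> bool"
  where "ell_le r u c \<longleftrightarrow> ell_mem r u \<and> ell_norm r u \<le> c"

lemma ell_le_top: "ell_le top u c \<longleftrightarrow> (\<forall>n. \<bar>u n\<bar> \<le> c)"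
proof
  assume *: "ell_le top u c"
  then have "bounded (range u)"
    by (simp add: ell_le_def ell_mem_def)
  then have "bdd_above (range (\<lambda>n. \<bar>u n\<bar>))"
    by (auto simp: bounded_iff bdd_above_def)
  then have "\<bar>u n\<bar> \<le> (SUP n. \<bar>u n\<bar>)" for n
    by (rule cSUP_upper2) auto
  with * show "\<forall>n. \<bar>u n\<bar> \<le> c"
    unfolding ell_le_def ell_norm_def by (auto intro: order_trans)
next
  assume "\<forall>n. \<bar>u n\<bar> \<le> c"
  then show "ell_le top u c"
    by (auto simp: ell_le_def ell_mem_def ell_norm_def bounded_iff intro!: cSUP_least exI[of _ c])
qed

lemma enn2real_ge_1:
  assumes "1 \<le> r" "r \<noteq> top"
  shows "1 \<le> enn2real r"
  using assms enn2real_mono[of 1 r] by (simp add: less_top)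

lemma ell_le_finite:
  assumes r: "1 \<le> r" "r \<noteq> top" and c: "0 \<le> c"
  shows "ell_le r u c \<longleftrightarrow> (\<Sum>n. ennreal (\<bar>u n\<bar> powr enn2real r)) \<le> ennreal (c powr enn2real r)"
    (is "_ \<longleftrightarrow> ?E \<le> _")
proof -
  define p where "p = enn2real r"
  have p: "1 \<le> p"
    using enn2real_ge_1[OF r] by (simp add: p_def)
  have summ: "summable (\<lambda>n. \<bar>u n\<bar> powr p)" if "?E \<le> ennreal (c powr p)"
    using that by (intro summable_suminf_not_top) (auto simp: p_def top_unique)
  have key: "(\<Sum>n. \<bar>u n\<bar> powr p) powr (1 / p) \<le> c \<longleftrightarrow> (\<Sum>n. \<bar>u n\<bar> powr p) \<le> c powr p"
    if s: "summable (\<lambda>n. \<bar>u n\<bar> powr p)"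
  proof -
    have nn: "0 \<le> (\<Sum>n. \<bar>u n\<bar> powr p)"
      using s by (intro suminf_nonneg) auto
    have eq: "((\<Sum>n. \<bar>u n\<bar> powr p) powr (1 / p)) powr p = (\<Sum>n. \<bar>u n\<bar> powr p)"
      using p nn by (simp add: powr_powr)
    have "((\<Sum>n. \<bar>u n\<bar> powr p) powr (1 / p)) powr p \<le> c powr p \<longleftrightarrow> (\<Sum>n. \<bar>u n\<bar> powr p) powr (1 / p) \<le> c"
      using p c powr_mono2[of p "(\<Sum>n. \<bar>u n\<bar> powr p) powr (1 / p)" c]
        powr_less_mono2[of p c "(\<Sum>n. \<bar>u n\<bar> powr p) powr (1 / p)"] by fastforce
    then show ?thesis
      unfolding eq by simp
  qed
  have E: "?E = ennreal (\<Sum>n. \<bar>u n\<bar> powr p)" if "summable (\<lambda>n. \<bar>u n\<bar> powr p)"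
    unfolding p_def[symmetric] using that by (intro suminf_ennreal2) auto
  have mem: "ell_mem r u \<longleftrightarrow> summable (\<lambda>n. \<bar>u n\<bar> powr p)"
      "ell_norm r u = (\<Sum>n. \<bar>u n\<bar> powr p) powr (1 / p)"
    using r by (auto simp: ell_mem_def ell_norm_def p_def)
  have "?E \<le> ennreal (c powr p) \<longleftrightarrow> (\<Sum>n. \<bar>u n\<bar> powr p) \<le> c powr p"
    if s: "summable (\<lambda>n. \<bar>u n\<bar> powr p)"
    unfolding E[OF s] by (rule ennreal_le_iff) simp
  then have "ell_le r u c \<longleftrightarrow> ?E \<le> ennreal (c powr p)"
    unfolding ell_le_def mem using key summ by blast
  then show ?thesis
    by (simp only: p_def)
qed

lemma ell_norm_nonneg: 
  assumes "ell_mem r u"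
  shows "0 \<le> ell_norm r u"
proof (cases "r = top")
  case True
  have "ell_le top u (ell_norm r u)"
    using assms True by (simp add: ell_le_def)
  then have "\<bar>u 0\<bar> \<le> ell_norm r u"
    unfolding ell_le_top by auto
  then show ?thesis by linarith
qed (simp add: ell_norm_def)

lemma ell_le_nonneg: "ell_le r u c \<Longrightarrow> 0 \<le> c"
  using ell_norm_nonneg by (fastforce simp: ell_le_def)

lemma ennreal_le_suminf: "f n \<le> suminf f" for f :: "nat \<Rightarrow> ennreal"
  using sum_le_suminf[of f "{n}"] by simp

lemma suminf_reindex_le:
  fixes f g :: "nat \<Rightarrow> ennreal"
  assumes "inj_on \<sigma> M" "\<And>n. n \<in> M \<Longrightarrow> g n \<le> f (\<sigma> n)" "\<And>n. n \<notin> M \<Longrightarrow> g n = 0"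
  shows "suminf g \<le> suminf f"
proof (rule suminf_le_const)
  fix n
  have "(\<Sum>i<n. g i) = (\<Sum>i\<in>{..<n} \<inter> M. g i)"
    using assms(3) by (intro sum.mono_neutral_right) auto
  also have "\<dots> \<le> (\<Sum>i\<in>{..<n} \<inter> M. f (\<sigma> i))"
    using assms(2) by (intro sum_mono) auto
  also have "\<dots> = sum f (\<sigma> ` ({..<n} \<inter> M))"
    using assms(1) by (subst sum.reindex) (auto intro: inj_on_subset)
  also have "\<dots> \<le> suminf f"
    by (intro sum_le_suminf) auto
  finally show "(\<Sum>i<n. g i) \<le> suminf f" .
qed simp

text \<open>One principle for domination, restriction, shifts and scalar factors:
  \<open>\<sigma>\<close> is injective, so no entry of \<open>u\<close> is charged twice. The bounds
  in \<open>direct_sum_map\<close> rest on it.\<close>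

lemma ell_le_reindex:
  assumes r: "1 \<le> r" and u: "ell_le r u c" and K: "0 \<le> K" and \<sigma>: "inj_on \<sigma> M"
    and v: "\<And>n. n \<in> M \<Longrightarrow> \<bar>v n\<bar> \<le> K * \<bar>u (\<sigma> n)\<bar>" "\<And>n. n \<notin> M \<Longrightarrow> v n = 0"
  shows "ell_le r v (K * c)"
proof -
  have c: "0 \<le> c"
    using u by (rule ell_le_nonneg)
  show ?thesis
  proof (cases "r = top")
    case True
    have "\<bar>v n\<bar> \<le> K * c" for n
      using u v[of n] K c mult_left_mono[of "\<bar>u (\<sigma> n)\<bar>" c K]
      by (cases "n \<in> M") (auto simp: True ell_le_top intro: order_trans)
    then show ?thesis
      by (simp add: True ell_le_top)
  next
    case False
    define p where "p = enn2real r"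
    have p: "1 \<le> p"
      using enn2real_ge_1[OF r False] by (simp add: p_def)
    have "(\<Sum>n. ennreal (\<bar>v n\<bar> powr p)) \<le> (\<Sum>n. ennreal (K powr p) * ennreal (\<bar>u n\<bar> powr p))"
    proof (rule suminf_reindex_le[OF \<sigma>])
      fix n assume "n \<in> M"
      then have "\<bar>v n\<bar> powr p \<le> (K * \<bar>u (\<sigma> n)\<bar>) powr p"
        using v(1) p by (intro powr_mono2) auto
      then show "ennreal (\<bar>v n\<bar> powr p) \<le> ennreal (K powr p) * ennreal (\<bar>u (\<sigma> n)\<bar> powr p)"
        using K by (simp add: powr_mult ennreal_leI flip: ennreal_mult)
    qed (use v(2) p in auto)
    also have "\<dots> = ennreal (K powr p) * (\<Sum>n. ennreal (\<bar>u n\<bar> powr p))"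
      by (rule ennreal_suminf_cmult)
    also have "\<dots> \<le> ennreal (K powr p) * ennreal (c powr p)"
      using u c by (intro mult_left_mono) (auto simp: ell_le_finite[OF r False] p_def)
    also have "\<dots> = ennreal ((K * c) powr p)"
      using K c by (simp add: powr_mult flip: ennreal_mult)
    finally show ?thesis
      using K c by (simp add: ell_le_finite[OF r False] p_def)
  qed
qed

lemma ell_le_mono:
  assumes "1 \<le> r" "ell_le r u c" "\<And>n. \<bar>v n\<bar> \<le> \<bar>u n\<bar>"
  shows "ell_le r v c"
  using ell_le_reindex[where M = UNIV and \<sigma> = id and K = 1] assms by simp

lemma ell_le_component:
  assumes "1 \<le> r" "ell_le r u c"
  shows "\<bar>u n\<bar> \<le> c"
proof (cases "r = top")
  case True
  with assms show ?thesis by (simp add: ell_le_top)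
next
  case False
  define p where "p = enn2real r"
  have p: "1 \<le> p"
    using enn2real_ge_1[OF assms(1) False] by (simp add: p_def)
  have c: "0 \<le> c"
    using assms(2) by (rule ell_le_nonneg)
  have "ennreal (\<bar>u n\<bar> powr p) \<le> (\<Sum>n. ennreal (\<bar>u n\<bar> powr p))"
    by (rule ennreal_le_suminf)
  also have "\<dots> \<le> ennreal (c powr p)"
    using assms c False by (simp add: ell_le_finite p_def)
  finally have "\<bar>u n\<bar> powr p \<le> c powr p"
    by (simp add: ennreal_le_iff)
  then show ?thesis
    using p c powr_less_mono2[of p c "\<bar>u n\<bar>"] by fastforce
qed

text \<open>Minkowski's inequality from convexity of the power function: with
  \<open>e = c + d\<close>, the entry of the sum is \<open>e\<close> times the average, with weights
  \<open>c / e\<close> and \<open>d / e\<close>, of the entries normalised by \<open>c\<close> and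
  \<open>d\<close>. Because of this normalisation a vanishing bound is treated apart.\<close>

lemma ell_le_add:
  assumes r: "1 \<le> r" and u: "ell_le r u c" and v: "ell_le r v d"
  shows "ell_le r (\<lambda>n. u n + v n) (c + d)"
proof -
  have cd: "0 \<le> c" "0 \<le> d"
    using u v ell_le_nonneg by auto
  consider "c = 0" | "d = 0" | "0 < c" "0 < d"
    using cd by linarith
  then show ?thesis
  proof cases
    case 1
    then have "u n = 0" for n
      using ell_le_component[OF r u, of n] by simp
    then show ?thesis
      using v 1 by simp
  next
    case 2
    then have "v n = 0" for n
      using ell_le_component[OF r v, of n] by simp
    then show ?thesis
      using u 2 by simp
  next
    case 3
    show ?thesis
    proof (cases "r = top")
      case True
      have "\<bar>u n + v n\<bar> \<le> c + d" for n
        using u v abs_triangle_ineq[of "u n" "v n"]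
        by (fastforce simp: True ell_le_top intro: order_trans add_mono)
      then show ?thesis
        by (simp add: True ell_le_top)
    next
      case False
      define p where "p = enn2real r"
      have p: "1 \<le> p"
        using enn2real_ge_1[OF r False] by (simp add: p_def)
      define e where "e = c + d"
      have e: "0 < e" "c / e + d / e = 1"
        using 3 by (auto simp: e_def add_divide_distrib[symmetric])
      have pw: "ennreal (\<bar>u n + v n\<bar> powr p) \<le>
        ennreal (e powr p * (c / e) / c powr p) * ennreal (\<bar>u n\<bar> powr p)
        + ennreal (e powr p * (d / e) / d powr p) * ennreal (\<bar>v n\<bar> powr p)" for n
      proof -
        have "\<bar>u n + v n\<bar> powr p \<le> (e * (c / e * (\<bar>u n\<bar> / c) + d / e * (\<bar>v n\<bar> / d))) powr p"
          using 3 e p by (intro powr_mono2) (auto simp: distrib_left)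
        also have "\<dots> = e powr p * (c / e * (\<bar>u n\<bar> / c) + d / e * (\<bar>v n\<bar> / d)) powr p"
          using 3 e by (subst powr_mult) auto
        also have "\<dots> \<le> e powr p * (c / e * (\<bar>u n\<bar> / c) powr p + d / e * (\<bar>v n\<bar> / d) powr p)"
          using 3 e p by (intro mult_left_mono powr_convex_nonneg) auto
        also have "\<dots> = (e powr p * (c / e) / c powr p) * \<bar>u n\<bar> powr p
            + (e powr p * (d / e) / d powr p) * \<bar>v n\<bar> powr p"
          using 3 by (simp add: powr_divide algebra_simps)
        finally show ?thesis
          using 3 e by (simp add: ennreal_leI flip: ennreal_mult ennreal_plus)
      qed
      have "(\<Sum>n. ennreal (\<bar>u n + v n\<bar> powr p)) \<le>
        (\<Sum>n. ennreal (e powr p * (c / e) / c powr p) * ennreal (\<bar>u n\<bar> powr p)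
        + ennreal (e powr p * (d / e) / d powr p) * ennreal (\<bar>v n\<bar> powr p))"
        by (intro suminf_le pw) auto
      also have "\<dots> = ennreal (e powr p * (c / e) / c powr p) * (\<Sum>n. ennreal (\<bar>u n\<bar> powr p))
        + ennreal (e powr p * (d / e) / d powr p) * (\<Sum>n. ennreal (\<bar>v n\<bar> powr p))"
        by (subst suminf_add[symmetric]) (auto simp: ennreal_suminf_cmult)
      also have "\<dots> \<le> ennreal (e powr p * (c / e) / c powr p) * ennreal (c powr p)
        + ennreal (e powr p * (d / e) / d powr p) * ennreal (d powr p)"
        using u v cd False r by (intro add_mono mult_left_mono) (auto simp: ell_le_finite p_def)
      also have "\<dots> = ennreal (e powr p * (c / e) + e powr p * (d / e))"
        using 3 e by (simp flip: ennreal_mult ennreal_plus)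
      also have "\<dots> = ennreal (e powr p * (c / e + d / e))"
        by (simp only: distrib_left)
      finally show ?thesis
        using e cd by (simp add: ell_le_finite[OF r False] p_def e_def)
    qed
  qed
qed

text \<open>Density of the finitely supported sequences. Its failure for r = \<infinity> is the
  reason for the almost disjoint families.\<close>

lemma ell_le_tail:
  assumes r: "1 \<le> r" "r \<noteq> top" and u: "ell_mem r u" and e: "0 < e"
  shows "\<exists>m. ell_le r (\<lambda>n. if n < m then 0 else u n) e"
proof -
  define p where "p = enn2real r"
  have p: "1 \<le> p"
    using enn2real_ge_1[OF r] by (simp add: p_def)
  have s: "summable (\<lambda>n. \<bar>u n\<bar> powr p)"
    using u r by (simp add: ell_mem_def p_def)
  have "(\<lambda>m. \<Sum>n. \<bar>u (n + m)\<bar> powr p) \<longlonglongrightarrow> 0"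
    using suminf_exist_split2[OF s] by simp
  moreover have "0 < e powr p"
    using e by simp
  ultimately have "eventually (\<lambda>m. (\<Sum>n. \<bar>u (n + m)\<bar> powr p) < e powr p) sequentially"
    by (rule order_tendstoD(2))
  then obtain m where m: "(\<Sum>n. \<bar>u (n + m)\<bar> powr p) < e powr p"
    by (auto simp: eventually_sequentially)
  have "(\<Sum>n. ennreal (\<bar>if n < m then 0 else u n\<bar> powr p)) \<le> (\<Sum>n. ennreal (\<bar>u (n + m)\<bar> powr p))"
    by (rule suminf_reindex_le[where M = "{m..}" and \<sigma> = "\<lambda>n. n - m"]) (auto simp: inj_on_def)
  also have "\<dots> = ennreal (\<Sum>n. \<bar>u (n + m)\<bar> powr p)"
    using s by (intro suminf_ennreal2) (auto intro: summable_ignore_initial_segment)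
  also have "\<dots> \<le> ennreal (e powr p)"
    using m by (intro ennreal_leI) simp
  finally show ?thesis
    using e by (intro exI[of _ m]) (simp add: ell_le_finite[OF r] p_def)
qed

text \<open>Tonelli for nonnegative double series. Membership of the rows is stated separately
  because \<open>ell_norm\<close> of a row says nothing about a row outside the space.\<close>

lemma ell_le_double:
  fixes u :: "nat \<Rightarrow> nat \<Rightarrow> real"
  assumes r: "1 \<le> r"
  shows "ell_le r (\<lambda>m. u (fst (prod_decode m)) (snd (prod_decode m))) c \<longleftrightarrow>
    (\<forall>i. ell_mem r (u i)) \<and> ell_le r (\<lambda>i. ell_norm r (u i)) c" (is "?L \<longleftrightarrow> ?R")
proof -
  have cn: "0 \<le> c" if "?L \<or> ?R"
    using that ell_le_nonneg by blast
  show ?thesis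
  proof (cases "r = top")
    case True
    have "?L \<longleftrightarrow> (\<forall>i j. \<bar>u i j\<bar> \<le> c)"
      unfolding True ell_le_top by (metis fst_conv prod_encode_inverse snd_conv)
    also have "\<dots> \<longleftrightarrow> (\<forall>i. ell_le r (u i) c)"
      by (simp add: True ell_le_top)
    also have "\<dots> \<longleftrightarrow> (\<forall>i. ell_mem r (u i)) \<and> (\<forall>i. \<bar>ell_norm r (u i)\<bar> \<le> c)"
      by (auto simp: ell_le_def ell_norm_nonneg)
    also have "\<dots> \<longleftrightarrow> ?R"
      by (simp add: True ell_le_top)
    finally show ?thesis .
  next
    case False
    define p where "p = enn2real r"
    have p: "1 \<le> p"
      using enn2real_ge_1[OF r False] by (simp add: p_def)
    define E where "E i = (\<Sum>j. ennreal (\<bar>u i j\<bar> powr p))" for i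
    have "(\<Sum>m. (\<lambda>(i, j). ennreal (\<bar>u i j\<bar> powr p)) (prod_decode m)) = (\<Sum>i. E i)"
      by (rule suminf_ennreal_2dimen) (simp only: E_def prod.case)
    then have fub: "(\<Sum>m. ennreal (\<bar>u (fst (prod_decode m)) (snd (prod_decode m))\<bar> powr p)) = (\<Sum>i. E i)"
      by (simp only: split_beta)
    have mem: "ell_mem r (u i) \<longleftrightarrow> E i < top" for i
    proof -
      have "ell_mem r (u i) \<longleftrightarrow> summable (\<lambda>j. \<bar>u i j\<bar> powr p)"
        using False by (simp add: ell_mem_def p_def)
      also have "\<dots> \<longleftrightarrow> E i < top"
        unfolding E_def
        using summable_suminf_not_top[of "\<lambda>j. \<bar>u i j\<bar> powr p"] suminf_ennreal2[of "\<lambda>j. \<bar>u i j\<bar> powr p"]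
        by (metis ennreal_less_top less_top powr_ge_zero)
      finally show ?thesis .
    qed
    have nrm: "ennreal (\<bar>ell_norm r (u i)\<bar> powr p) = E i" if "ell_mem r (u i)" for i
    proof -
      have s: "summable (\<lambda>j. \<bar>u i j\<bar> powr p)"
        using that False by (simp add: ell_mem_def p_def)
      have nn: "0 \<le> (\<Sum>j. \<bar>u i j\<bar> powr p)"
        using s by (intro suminf_nonneg) auto
      have "\<bar>ell_norm r (u i)\<bar> powr p = (\<Sum>j. \<bar>u i j\<bar> powr p)"
        using False p nn by (simp add: ell_norm_def powr_powr flip: p_def)
      then show ?thesis
        using s by (simp add: E_def suminf_ennreal2)
    qed
    show ?thesis
    proof
      assume L: ?L
      then have c: "0 \<le> c"
        using cn by blast
      have *: "(\<Sum>i. E i) \<le> ennreal (c powr p)"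
        using L unfolding ell_le_finite[OF r False c] p_def[symmetric] fub .
      have m: "ell_mem r (u i)" for i
      proof -
        have "E i \<le> (\<Sum>i. E i)"
          by (rule ennreal_le_suminf)
        with * show ?thesis
          unfolding mem by (metis ennreal_less_top le_less_trans)
      qed
      have "ell_le r (\<lambda>i. ell_norm r (u i)) c"
        using * unfolding ell_le_finite[OF r False c] p_def[symmetric] nrm[OF m] .
      with m show ?R by blast
    next
      assume R: ?R
      then have c: "0 \<le> c" and m: "\<And>i. ell_mem r (u i)"
        using cn by blast+
      have "ell_le r (\<lambda>i. ell_norm r (u i)) c"
        using R by blast
      then show ?L
        unfolding ell_le_finite[OF r False c] p_def[symmetric] nrm[OF m] fub .
    qed
  qed
qed

section \<open>Normed spaces and their operators\<close>

locale normed_nspace =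
  fixes X :: "'a::real_vector nspace"
  assumes subspace: "subspace (vecs X)"
    and nonneg: "x \<in> vecs X \<Longrightarrow> 0 \<le> vnorm X x"
    and scale: "x \<in> vecs X \<Longrightarrow> vnorm X (c *\<^sub>R x) = \<bar>c\<bar> * vnorm X x"
    and triangle: "x \<in> vecs X \<Longrightarrow> y \<in> vecs X \<Longrightarrow> vnorm X (x + y) \<le> vnorm X x + vnorm X y"
begin

lemma zero [simp]: "0 \<in> vecs X"
  by (simp add: subspace subspace_0)

lemma add [simp]: "x \<in> vecs X \<Longrightarrow> y \<in> vecs X \<Longrightarrow> x + y \<in> vecs X"
  by (simp add: subspace subspace_add)

lemma diff [simp]: "x \<in> vecs X \<Longrightarrow> y \<in> vecs X \<Longrightarrow> x - y \<in> vecs X"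
  by (simp add: subspace subspace_diff)

lemma scaled [simp]: "x \<in> vecs X \<Longrightarrow> c *\<^sub>R x \<in> vecs X"
  by (simp add: subspace subspace_scale)

lemma norm_zero [simp]: "vnorm X 0 = 0"
  using scale[of 0 0] by simp

end

lemma normed_nspaceI:
  assumes zero: "0 \<in> vecs X" and nonneg: "\<And>x. x \<in> vecs X \<Longrightarrow> 0 \<le> vnorm X x"
    and add: "\<And>x y. x \<in> vecs X \<Longrightarrow> y \<in> vecs X \<Longrightarrow> x + y \<in> vecs X \<and> vnorm X (x + y) \<le> vnorm X x + vnorm X y"
    and scale: "\<And>c x. x \<in> vecs X \<Longrightarrow> c *\<^sub>R x \<in> vecs X \<and> vnorm X (c *\<^sub>R x) \<le> \<bar>c\<bar> * vnorm X x"
  shows "normed_nspace X"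
proof
  show "subspace (vecs X)"
    unfolding subspace_def using zero add scale by blast
  fix x c assume x: "x \<in> vecs X"
  show "vnorm X (c *\<^sub>R x) = \<bar>c\<bar> * vnorm X x"
  proof (cases "c = 0")
    case True
    then show ?thesis
      using scale[OF x, of 0] nonneg[OF zero] by simp
  next
    case False
    have "vnorm X x \<le> \<bar>inverse c\<bar> * vnorm X (c *\<^sub>R x)"
      using scale[of "c *\<^sub>R x" "inverse c"] scale[OF x, of c] False by simp
    then have "\<bar>c\<bar> * vnorm X x \<le> vnorm X (c *\<^sub>R x)"
      using False by (simp add: field_simps)
    with scale[OF x, of c] show ?thesis by simp
  qed
qed (use nonneg add in auto)

text \<open>A bound is carried explicitly, so that the constants 1 and 2 can be followed through
  compositions; \<open>op_norm\<close> is a supremum that yields information only once such a bound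
  is known.\<close>

definition bop :: "real \<Rightarrow> 'a::real_vector nspace \<Rightarrow> 'b::real_vector nspace \<Rightarrow> ('a \<Rightarrow> 'b) \<Rightarrow> bool"
  where "bop K X Y T \<longleftrightarrow>
    (\<forall>x\<in>vecs X. T x \<in> vecs Y) \<and>
    (\<forall>x\<in>vecs X. \<forall>y\<in>vecs X. T (x + y) = T x + T y) \<and>
    (\<forall>c. \<forall>x\<in>vecs X. T (c *\<^sub>R x) = c *\<^sub>R T x) \<and>
    (\<forall>x\<in>vecs X. vnorm Y (T x) \<le> K * vnorm X x)"

lemma bopI:
  assumes "\<And>x. x \<in> vecs X \<Longrightarrow> T x \<in> vecs Y"
    "\<And>x y. x \<in> vecs X \<Longrightarrow> y \<in> vecs X \<Longrightarrow> T (x + y) = T x + T y"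
    "\<And>c x. x \<in> vecs X \<Longrightarrow> T (c *\<^sub>R x) = c *\<^sub>R T x"
    "\<And>x. x \<in> vecs X \<Longrightarrow> vnorm Y (T x) \<le> K * vnorm X x"
  shows "bop K X Y T"
  using assms by (auto simp: bop_def)

lemma bopD:
  assumes "bop K X Y T"
  shows "x \<in> vecs X \<Longrightarrow> T x \<in> vecs Y"
    "x \<in> vecs X \<Longrightarrow> y \<in> vecs X \<Longrightarrow> T (x + y) = T x + T y"
    "x \<in> vecs X \<Longrightarrow> T (c *\<^sub>R x) = c *\<^sub>R T x"
    "x \<in> vecs X \<Longrightarrow> vnorm Y (T x) \<le> K * vnorm X x"
  using assms by (auto simp: bop_def)

lemma operator_iff_bop: "operator X Y T \<longleftrightarrow> (\<exists>K. bop K X Y T)"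
  unfolding operator_def bop_def by blast

lemma bop_operator: "bop K X Y T \<Longrightarrow> operator X Y T"
  by (auto simp: operator_iff_bop)

lemma operator_bop_nonneg:
  assumes "operator X Y T" "normed_nspace X"
  obtains K where "0 \<le> K" "bop K X Y T"
proof -
  interpret normed_nspace X by fact
  obtain K where K: "bop K X Y T"
    using assms(1) by (auto simp: operator_iff_bop)
  have "vnorm Y (T x) \<le> \<bar>K\<bar> * vnorm X x" if "x \<in> vecs X" for x
    using bopD(4)[OF K that] mult_right_mono[OF abs_ge_self nonneg[OF that], of K] by linarith
  then have "bop \<bar>K\<bar> X Y T"
    using bopD[OF K] by (intro bopI)
  then show thesis
    by (rule that[rotated]) simp
qed

lemma operatorD:
  assumes "operator X Y T"
  shows "x \<in> vecs X \<Longrightarrow> T x \<in> vecs Y"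
    "x \<in> vecs X \<Longrightarrow> y \<in> vecs X \<Longrightarrow> T (x + y) = T x + T y"
    "x \<in> vecs X \<Longrightarrow> T (c *\<^sub>R x) = c *\<^sub>R T x"
  using assms by (auto simp: operator_def)

lemma operator_diff_arg:
  assumes T: "operator X Y T" and X: "normed_nspace X" and xy: "x \<in> vecs X" "y \<in> vecs X"
  shows "T (x - y) = T x - T y"
proof -
  interpret normed_nspace X by fact
  have "T (x + (-1) *\<^sub>R y) = T x + (-1) *\<^sub>R T y"
    using operatorD(2)[OF T xy(1) scaled[OF xy(2), of "-1"]] operatorD(3)[OF T xy(2), of "-1"] by (simp only:)
  then show ?thesis by simp
qed

lemma operator_zero_arg:
  assumes "operator X Y T" "normed_nspace X"
  shows "T 0 = 0"
proof -
  interpret normed_nspace X by fact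
  show ?thesis
    using operatorD(3)[OF assms(1), of 0 0] by simp
qed

lemma operator_sum_arg:
  assumes T: "operator X Y T" and X: "normed_nspace X"
    and "finite I" "\<And>i. i \<in> I \<Longrightarrow> x i \<in> vecs X"
  shows "T (\<Sum>i\<in>I. x i) = (\<Sum>i\<in>I. T (x i))" "(\<Sum>i\<in>I. x i) \<in> vecs X"
proof -
  interpret normed_nspace X by fact
  have "T (\<Sum>i\<in>I. x i) = (\<Sum>i\<in>I. T (x i)) \<and> (\<Sum>i\<in>I. x i) \<in> vecs X"
    using assms(3,4)
    by (induction I rule: finite_induct)
       (auto simp: operator_zero_arg[OF T X] operatorD(2)[OF T])
  then show "T (\<Sum>i\<in>I. x i) = (\<Sum>i\<in>I. T (x i))" "(\<Sum>i\<in>I. x i) \<in> vecs X"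
    by auto
qed

lemma bop_comp:
  assumes T: "bop K X Y T" and S: "bop L Y Z S" and L: "0 \<le> L"
  shows "bop (L * K) X Z (\<lambda>x. S (T x))"
proof (rule bopI)
  fix x assume x: "x \<in> vecs X"
  have "vnorm Z (S (T x)) \<le> L * vnorm Y (T x)"
    using bopD[OF S] bopD[OF T] x by blast
  also have "\<dots> \<le> L * (K * vnorm X x)"
    using bopD[OF T] x L by (intro mult_left_mono) auto
  finally show "vnorm Z (S (T x)) \<le> L * K * vnorm X x"
    by (simp add: mult.assoc)
qed (use bopD[OF S] bopD[OF T] in auto)

lemma operator_comp:
  assumes "operator X Y T" "operator Y Z S" "normed_nspace Y"
  shows "operator X Z (\<lambda>x. S (T x))"
proof -
  obtain L where L: "0 \<le> L" "bop L Y Z S"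
    using assms by (blast elim: operator_bop_nonneg)
  obtain K where "bop K X Y T"
    using assms by (auto simp: operator_iff_bop)
  from bop_comp[OF this L(2,1)] show ?thesis
    by (rule bop_operator)
qed

lemma bop_id: "bop 1 X X (\<lambda>x. x)"
  by (auto simp: bop_def)

lemma operator_id: "operator X X (\<lambda>x. x)"
  using bop_id by (rule bop_operator)

lemma operator_cong:
  assumes S: "operator X Y S" and X: "normed_nspace X" and eq: "\<And>x. x \<in> vecs X \<Longrightarrow> T x = S x"
  shows "operator X Y T"
proof -
  interpret normed_nspace X by fact
  show ?thesis
    using S eq unfolding operator_def by auto
qed

lemma operator_add:
  assumes S: "operator X Y S" and T: "operator X Y T" and Y: "normed_nspace Y"
  shows "operator X Y (\<lambda>x. S x + T x)"
proof -
  interpret Y: normed_nspace Y by fact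
  obtain K L where K: "bop K X Y S" and L: "bop L X Y T"
    using S T by (auto simp: operator_iff_bop)
  have "bop (K + L) X Y (\<lambda>x. S x + T x)"
  proof (rule bopI)
    fix x assume x: "x \<in> vecs X"
    have "vnorm Y (S x + T x) \<le> vnorm Y (S x) + vnorm Y (T x)"
      using x bopD(1)[OF K] bopD(1)[OF L] by (intro Y.triangle) auto
    also have "\<dots> \<le> (K + L) * vnorm X x"
      using bopD(4)[OF K x] bopD(4)[OF L x] by (simp add: distrib_right)
    finally show "vnorm Y (S x + T x) \<le> (K + L) * vnorm X x" .
  qed (use bopD[OF K] bopD[OF L] in \<open>auto simp: scaleR_add_right\<close>)
  then show ?thesis
    by (rule bop_operator)
qed

lemma operator_diff:
  assumes S: "operator X Y S" and T: "operator X Y T" and Y: "normed_nspace Y"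
  shows "operator X Y (\<lambda>x. S x - T x)"
proof -
  interpret Y: normed_nspace Y by fact
  have "bop 1 Y Y (\<lambda>y. (-1) *\<^sub>R y)"
    by (rule bopI) (simp_all only: Y.scaled Y.scale scaleR_add_right scaleR_left_commute abs_minus_cancel abs_one)
  then have "operator X Y (\<lambda>x. (-1) *\<^sub>R T x)"
    using T Y by (intro operator_comp[OF T _ Y]) (rule bop_operator)
  from operator_add[OF S this Y] show ?thesis
    by simp
qed

section \<open>Complemented embeddings, isomorphisms, products and ranges\<close>

text \<open>\<open>X\<close> is isomorphic to a complemented subspace of \<open>Y\<close>:
  \<open>A\<close> after \<open>B\<close> is a projection onto the image of \<open>A\<close>. With
  the pair of maps in place of the subspace, transitivity is composition.\<close>

definition cembeds :: "'a::real_vector nspace \<Rightarrow> 'b::real_vector nspace \<Rightarrow> bool"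
  where "cembeds X Y \<longleftrightarrow>
    (\<exists>A B. operator X Y A \<and> operator Y X B \<and> (\<forall>x\<in>vecs X. B (A x) = x))"

lemma cembeds_trans:
  assumes "cembeds X Y" "cembeds Y Z" and Y: "normed_nspace Y"
  shows "cembeds X Z"
proof -
  obtain A B C D where A: "operator X Y A" and B: "operator Y X B" and "\<forall>x\<in>vecs X. B (A x) = x"
    and C: "operator Y Z C" and D: "operator Z Y D" and "\<forall>y\<in>vecs Y. D (C y) = y"
    using assms by (auto simp: cembeds_def)
  then have "\<forall>x\<in>vecs X. B (D (C (A x))) = x"
    using operatorD(1)[OF A] operatorD(1)[OF D] by auto
  moreover have "operator X Z (\<lambda>x. C (A x))" "operator Z X (\<lambda>z. B (D z))"
    using operator_comp[OF A C Y] operator_comp[OF D B Y] .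
  ultimately show ?thesis
    unfolding cembeds_def by blast
qed

lemma isomorphic_sym: "isomorphic X Y \<Longrightarrow> isomorphic Y X"
  unfolding isomorphic_def by blast

lemma isomorphic_cembeds: "isomorphic X Y \<Longrightarrow> cembeds X Y"
  unfolding isomorphic_def cembeds_def by blast

lemma isomorphic_trans:
  assumes "isomorphic X Y" "isomorphic Y Z" and Y: "normed_nspace Y"
  shows "isomorphic X Z"
proof -
  obtain A B C D where A: "operator X Y A" and B: "operator Y X B"
    and "\<forall>x\<in>vecs X. B (A x) = x" "\<forall>y\<in>vecs Y. A (B y) = y"
    and C: "operator Y Z C" and D: "operator Z Y D" and "\<forall>y\<in>vecs Y. D (C y) = y" "\<forall>z\<in>vecs Z. C (D z) = z"
    using assms by (auto simp: isomorphic_def)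
  then have "\<forall>x\<in>vecs X. B (D (C (A x))) = x" "\<forall>z\<in>vecs Z. C (A (B (D z))) = z"
    using operatorD(1)[OF A] operatorD(1)[OF D] by auto
  moreover have "operator X Z (\<lambda>x. C (A x))" "operator Z X (\<lambda>z. B (D z))"
    using operator_comp[OF A C Y] operator_comp[OF D B Y] .
  ultimately show ?thesis
    unfolding isomorphic_def by blast
qed

definition nprod :: "'a::real_vector nspace \<Rightarrow> 'b::real_vector nspace \<Rightarrow> ('a \<times> 'b) nspace"
  where "nprod X Y = \<lparr>vecs = vecs X \<times> vecs Y, vnorm = (\<lambda>z. vnorm X (fst z) + vnorm Y (snd z))\<rparr>"

lemma normed_nprod:
  assumes "normed_nspace X" "normed_nspace Y"
  shows "normed_nspace (nprod X Y)"
proof -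
  interpret X: normed_nspace X by fact
  interpret Y: normed_nspace Y by fact
  show ?thesis
  proof
    show "subspace (vecs (nprod X Y))"
      using X.subspace Y.subspace by (auto simp: nprod_def subspace_Times)
  next
    fix x y :: "'a \<times> 'b" and c :: real
    assume x: "x \<in> vecs (nprod X Y)"
    then show "0 \<le> vnorm (nprod X Y) x" "vnorm (nprod X Y) (c *\<^sub>R x) = \<bar>c\<bar> * vnorm (nprod X Y) x"
      using X.nonneg Y.nonneg by (auto simp: nprod_def X.scale Y.scale distrib_left intro!: add_nonneg_nonneg)
    assume "y \<in> vecs (nprod X Y)"
    then show "vnorm (nprod X Y) (x + y) \<le> vnorm (nprod X Y) x + vnorm (nprod X Y) y"
      using x X.triangle[of "fst x" "fst y"] Y.triangle[of "snd x" "snd y"]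
      by (auto simp: nprod_def)
  qed
qed

lemma operator_pair:
  assumes "operator Z X A" "operator Z Y B"
  shows "operator Z (nprod X Y) (\<lambda>z. (A z, B z))"
proof -
  obtain K L where K: "bop K Z X A" and L: "bop L Z Y B"
    using assms by (auto simp: operator_iff_bop)
  have "bop (K + L) Z (nprod X Y) (\<lambda>z. (A z, B z))"
    using bopD[OF K] bopD[OF L]
    by (intro bopI) (auto simp: nprod_def distrib_right intro: add_mono)
  then show ?thesis by (rule bop_operator)
qed

lemma operator_fst:
  assumes "normed_nspace Y"
  shows "operator (nprod X Y) X fst"
  by (rule bop_operator[of 1])
     (use normed_nspace.nonneg[OF assms] in \<open>auto simp: bop_def nprod_def\<close>)

lemma operator_snd:
  assumes "normed_nspace X"
  shows "operator (nprod X Y) Y snd"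
  by (rule bop_operator[of 1])
     (use normed_nspace.nonneg[OF assms] in \<open>auto simp: bop_def nprod_def\<close>)

lemma operator_op_range_into:
  assumes "operator X X Q"
  shows "operator (op_range X X Q) X (\<lambda>x. x)"
  by (rule bop_operator[of 1]) (use operatorD(1)[OF assms] in \<open>auto simp: bop_def op_range_def\<close>)

lemma normed_op_range:
  assumes Q: "operator X X Q" and X: "normed_nspace X"
  shows "normed_nspace (op_range X X Q)"
proof -
  interpret normed_nspace X by fact
  have sub: "Q ` vecs X \<subseteq> vecs X"
    using operatorD(1)[OF Q] by auto
  have "subspace (Q ` vecs X)"
    unfolding subspace_def
    using operator_zero_arg[OF Q X] operatorD(2,3)[OF Q]
    by (auto simp: image_iff) (metis add scaled zero)+
  then show ?thesis
    using subsetD[OF sub] nonneg scale triangle by unfold_locales (simp_all add: op_range_def)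
qed

lemma operator_into_op_range:
  assumes "operator Z X A" "\<And>z. z \<in> vecs Z \<Longrightarrow> Q (A z) = A z" 
  shows "operator Z (op_range X X Q) A"
  using assms unfolding operator_def op_range_def by (auto simp: image_iff) metis+

section \<open>Direct sums\<close>

lemma in_direct_sum:
  "F \<in> vecs (direct_sum r Z) \<longleftrightarrow> (\<forall>n. F n \<in> vecs (Z n)) \<and> ell_mem r (\<lambda>n. vnorm (Z n) (F n))"
  by (simp add: direct_sum_def)

lemma direct_sum_norm: "vnorm (direct_sum r Z) F = ell_norm r (\<lambda>n. vnorm (Z n) (F n))"
  by (simp add: direct_sum_def)

lemma direct_sum_le_iff:
  "F \<in> vecs (direct_sum r Z) \<and> vnorm (direct_sum r Z) F \<le> c \<longleftrightarrow>
    (\<forall>n. F n \<in> vecs (Z n)) \<and> ell_le r (\<lambda>n. vnorm (Z n) (F n)) c"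
  by (auto simp: direct_sum_def ell_le_def)

lemma direct_sumI:
  assumes "\<And>n. F n \<in> vecs (Z n)" "ell_le r (\<lambda>n. vnorm (Z n) (F n)) c"
  shows "F \<in> vecs (direct_sum r Z)" "vnorm (direct_sum r Z) F \<le> c"
  using assms direct_sum_le_iff by blast+

lemma direct_sum_ell_le:
  assumes "F \<in> vecs (direct_sum r Z)"
  shows "ell_le r (\<lambda>n. vnorm (Z n) (F n)) (vnorm (direct_sum r Z) F)"
  using assms direct_sum_le_iff by blast

lemma direct_sum_component: "F \<in> vecs (direct_sum r Z) \<Longrightarrow> F n \<in> vecs (Z n)"
  by (simp add: in_direct_sum)

lemma direct_sum_norm_nonneg: "F \<in> vecs (direct_sum r Z) \<Longrightarrow> 0 \<le> vnorm (direct_sum r Z) F"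
  by (simp add: direct_sum_norm in_direct_sum ell_norm_nonneg)

text \<open>Choosing \<open>\<sigma>\<close> and \<open>M\<close> yields diagonal operators,
  coordinate cuts, shifts in both directions and the placement of summands along a sparse set of
  indices, all with the bound of the components.\<close>

lemma direct_sum_map:
  assumes r: "1 \<le> r" and K: "0 \<le> K" and \<sigma>: "inj_on \<sigma> M"
    and T: "\<And>n. n \<in> M \<Longrightarrow> bop K (Z (\<sigma> n)) (Z' n) (T n)"
    and Z': "\<And>n. normed_nspace (Z' n)"
  shows "bop K (direct_sum r Z) (direct_sum r Z') (\<lambda>F n. if n \<in> M then T n (F (\<sigma> n)) else 0)"
proof (rule bopI)
  interpret Z': normed_nspace "Z' n" for n by fact
  fix F assume F: "F \<in> vecs (direct_sum r Z)"
  have "vnorm (Z' n) (T n (F (\<sigma> n))) \<le> K * vnorm (Z (\<sigma> n)) (F (\<sigma> n))"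
    "T n (F (\<sigma> n)) \<in> vecs (Z' n)" if "n \<in> M" for n
    using bopD(1,4)[OF T[OF that]] F by (auto simp: in_direct_sum)
  then have *: "\<bar>vnorm (Z' n) (T n (F (\<sigma> n)))\<bar> \<le> K * \<bar>vnorm (Z (\<sigma> n)) (F (\<sigma> n))\<bar>"
    "T n (F (\<sigma> n)) \<in> vecs (Z' n)" if "n \<in> M" for n
    using that Z'.nonneg
    by (auto intro: order_trans[OF _ mult_left_mono[OF abs_ge_self K]])
  have "ell_le r (\<lambda>n. vnorm (Z' n) (if n \<in> M then T n (F (\<sigma> n)) else 0)) (K * vnorm (direct_sum r Z) F)"
    by (rule ell_le_reindex[OF r direct_sum_ell_le[OF F] K \<sigma>]) (auto simp: *)
  from direct_sumI[OF _ this] *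
  show "(\<lambda>n. if n \<in> M then T n (F (\<sigma> n)) else 0) \<in> vecs (direct_sum r Z')"
    "vnorm (direct_sum r Z') (\<lambda>n. if n \<in> M then T n (F (\<sigma> n)) else 0) \<le> K * vnorm (direct_sum r Z) F"
    by auto
next
  fix F G assume "F \<in> vecs (direct_sum r Z)" "G \<in> vecs (direct_sum r Z)"
  then show "(\<lambda>n. if n \<in> M then T n ((F + G) (\<sigma> n)) else 0) =
      (\<lambda>n. if n \<in> M then T n (F (\<sigma> n)) else 0) + (\<lambda>n. if n \<in> M then T n (G (\<sigma> n)) else 0)"
    using bopD(2)[OF T] by (auto simp: fun_eq_iff in_direct_sum)
next
  fix F c assume "F \<in> vecs (direct_sum r Z)"
  then show "(\<lambda>n. if n \<in> M then T n ((c *\<^sub>R F) (\<sigma> n)) else 0) =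
      c *\<^sub>R (\<lambda>n. if n \<in> M then T n (F (\<sigma> n)) else 0)"
    using bopD(3)[OF T] by (auto simp: fun_eq_iff in_direct_sum scaleR_fun_def)
qed

lemma normed_direct_sum:
  assumes r: "1 \<le> r" and Z: "\<And>n. normed_nspace (Z n)"
  shows "normed_nspace (direct_sum r Z)"
proof -
  interpret Z: normed_nspace "Z n" for n by fact
  let ?X = "direct_sum r Z"
  have sc: "c *\<^sub>R F \<in> vecs ?X \<and> vnorm ?X (c *\<^sub>R F) \<le> \<bar>c\<bar> * vnorm ?X F" if F: "F \<in> vecs ?X" for c F
  proof -
    have "ell_le r (\<lambda>n. vnorm (Z n) ((c *\<^sub>R F) n)) (\<bar>c\<bar> * vnorm ?X F)"
      by (rule ell_le_reindex[OF r direct_sum_ell_le[OF F], where M = UNIV and \<sigma> = "\<lambda>n. n"])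
         (use F in \<open>auto simp: scaleR_fun_def Z.scale in_direct_sum abs_mult\<close>)
    from direct_sumI[OF _ this] show ?thesis
      using F by (auto simp: scaleR_fun_def in_direct_sum)
  qed
  have ad: "F + G \<in> vecs ?X \<and> vnorm ?X (F + G) \<le> vnorm ?X F + vnorm ?X G"
    if F: "F \<in> vecs ?X" and G: "G \<in> vecs ?X" for F G
  proof -
    have "\<bar>vnorm (Z n) ((F + G) n)\<bar> \<le> \<bar>vnorm (Z n) (F n) + vnorm (Z n) (G n)\<bar>" for n
      using Z.triangle[of "F n" n "G n"] Z.nonneg[of "F n + G n" n] F G by (auto simp: in_direct_sum)
    then have "ell_le r (\<lambda>n. vnorm (Z n) ((F + G) n)) (vnorm ?X F + vnorm ?X G)"
      by (rule ell_le_mono[OF r ell_le_add[OF r direct_sum_ell_le[OF F] direct_sum_ell_le[OF G]]])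
    moreover have "(F + G) n \<in> vecs (Z n)" for n
      using F G by (auto simp: in_direct_sum)
    ultimately show ?thesis
      using direct_sumI[of "F + G" Z r] by blast
  qed
  have "ell_le r (\<lambda>n. 0) 0"
    using r by (cases "r = top") (auto simp: ell_le_top ell_le_finite)
  then have z: "0 \<in> vecs ?X"
    by (intro direct_sumI(1)[where c = 0]) auto
  show ?thesis
    using z sc ad direct_sum_norm_nonneg by (intro normed_nspaceI)
qed

lemma bop_component:
  assumes r: "1 \<le> r"
  shows "bop 1 (direct_sum r Z) (Z n) (\<lambda>F. F n)"
  using ell_le_component[OF r direct_sum_ell_le, of _ Z n]
  by (intro bopI) (auto simp: direct_sum_component scaleR_fun_def dest: abs_le_D1)

lemma bop_single:
  assumes r: "1 \<le> r" and Z: "\<And>n. normed_nspace (Z n)"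
  shows "bop 1 (Z n) (direct_sum r Z) (\<lambda>x m. if m = n then x else 0)"
proof (rule bopI)
  interpret Z: normed_nspace "Z n" for n by fact
  fix x assume x: "x \<in> vecs (Z n)"
  have "ell_le r (\<lambda>m. vnorm (Z m) (if m = n then x else 0)) (vnorm (Z n) x)"
  proof (cases "r = top")
    case True
    then show ?thesis
      using Z.nonneg[OF x] by (simp add: ell_le_top)
  next
    case False
    have "(\<Sum>m. ennreal (\<bar>vnorm (Z m) (if m = n then x else 0)\<bar> powr enn2real r)) = ennreal (vnorm (Z n) x powr enn2real r)"
      using Z.nonneg[OF x] by (subst suminf_finite[of "{n}"]) auto
    then show ?thesis
      using Z.nonneg[OF x] by (simp add: ell_le_finite[OF r False])
  qed
  from direct_sumI[OF _ this]
  show "(\<lambda>m. if m = n then x else 0) \<in> vecs (direct_sum r Z)"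
    "vnorm (direct_sum r Z) (\<lambda>m. if m = n then x else 0) \<le> 1 * vnorm (Z n) x"
    using x by auto
qed (auto simp: fun_eq_iff scaleR_fun_def)

lemma isomorphic_direct_sum:
  assumes r: "1 \<le> r" and Z: "\<And>n. normed_nspace (Z n)" and Z': "\<And>n. normed_nspace (Z' n)"
    and U: "\<And>n. bop 1 (Z n) (Z' n) (U n)" and V: "\<And>n. bop 1 (Z' n) (Z n) (V n)"
    and VU: "\<And>n x. x \<in> vecs (Z n) \<Longrightarrow> V n (U n x) = x" "\<And>n y. y \<in> vecs (Z' n) \<Longrightarrow> U n (V n y) = y"
  shows "bop 1 (direct_sum r Z) (direct_sum r Z') (\<lambda>F n. U n (F n))"
    "bop 1 (direct_sum r Z') (direct_sum r Z) (\<lambda>F n. V n (F n))"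
    "isomorphic (direct_sum r Z) (direct_sum r Z')"
proof -
  show 1: "bop 1 (direct_sum r Z) (direct_sum r Z') (\<lambda>F n. U n (F n))"
    using direct_sum_map[OF r, where M = UNIV and \<sigma> = "\<lambda>n. n" and T = U and K = 1, OF _ _ U Z'] by simp
  show 2: "bop 1 (direct_sum r Z') (direct_sum r Z) (\<lambda>F n. V n (F n))"
    using direct_sum_map[OF r, where M = UNIV and \<sigma> = "\<lambda>n. n" and T = V and K = 1, OF _ _ V Z] by simp
  show "isomorphic (direct_sum r Z) (direct_sum r Z')"
    unfolding isomorphic_def
    using bop_operator[OF 1] bop_operator[OF 2] VU
    by (auto intro!: exI[of _ "\<lambda>F n. U n (F n)"] exI[of _ "\<lambda>F n. V n (F n)"] simp: in_direct_sum)
qed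

text \<open>Double sequences are read along \<open>prod_decode\<close>, isometrically by
  \<open>ell_le_double\<close>. On the right every \<open>Z j\<close> occurs infinitely often; for
  constant \<open>Z\<close> the right side is the inner sum again, so a sum of copies of one space
  is isomorphic to the sum of copies of itself.\<close>

lemma isomorphic_direct_sum_double:
  assumes r: "1 \<le> r"
  shows "isomorphic (direct_sum r (\<lambda>i. direct_sum r Z)) (direct_sum r (\<lambda>m. Z (snd (prod_decode m))))"
    (is "isomorphic ?X ?Y")
proof -
  define U :: "(nat \<Rightarrow> nat \<Rightarrow> 'a) \<Rightarrow> nat \<Rightarrow> 'a"
    where "U F m = F (fst (prod_decode m)) (snd (prod_decode m))" for F m
  define V :: "(nat \<Rightarrow> 'a) \<Rightarrow> nat \<Rightarrow> nat \<Rightarrow> 'a" where "V G i j = G (prod_encode (i, j))" for G i j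
  have VU: "V (U F) = F" "U (V G) = G" for F G
    by (simp_all add: U_def V_def fun_eq_iff)
  have iff: "F \<in> vecs ?X \<and> vnorm ?X F \<le> c \<longleftrightarrow> U F \<in> vecs ?Y \<and> vnorm ?Y (U F) \<le> c" for F c
  proof -
    have "F \<in> vecs ?X \<and> vnorm ?X F \<le> c \<longleftrightarrow> (\<forall>i j. F i j \<in> vecs (Z j)) \<and>
      (\<forall>i. ell_mem r (\<lambda>j. vnorm (Z j) (F i j))) \<and> ell_le r (\<lambda>i. ell_norm r (\<lambda>j. vnorm (Z j) (F i j))) c"
      unfolding direct_sum_le_iff by (auto simp: in_direct_sum direct_sum_norm)
    also have "\<dots> \<longleftrightarrow> (\<forall>i j. F i j \<in> vecs (Z j)) \<and>
      ell_le r (\<lambda>m. vnorm (Z (snd (prod_decode m))) (U F m)) c"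
      unfolding U_def using ell_le_double[OF r, of "\<lambda>i j. vnorm (Z j) (F i j)" c] by simp
    also have "(\<forall>i j. F i j \<in> vecs (Z j)) \<longleftrightarrow> (\<forall>m. U F m \<in> vecs (Z (snd (prod_decode m))))"
      unfolding U_def by (metis fst_conv prod_encode_inverse snd_conv)
    finally show ?thesis
      unfolding direct_sum_le_iff .
  qed
  have "operator ?X ?Y U"
    by (rule bop_operator[of 1], rule bopI)
       (use iff in \<open>auto simp: U_def fun_eq_iff scaleR_fun_def\<close>)
  moreover have "operator ?Y ?X V"
    by (rule bop_operator[of 1], rule bopI)
       (use iff[of "V _"] in \<open>auto simp: VU V_def fun_eq_iff scaleR_fun_def\<close>)
  ultimately show ?thesis
    unfolding isomorphic_def using VU by blast
qed

section \<open>Pelczynski's decomposition method\<close>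

text \<open>Think of \<open>W\<close> as the sum of \<open>Y\<close> and the kernel of
  \<open>P\<close>. Both sides then consist of countably many copies of \<open>Y\<close> and of that
  kernel, and moving the copies of \<open>Y\<close> by one place absorbs the additional one.\<close>

lemma pelczynski_absorb:
  assumes r: "1 \<le> r" and W: "normed_nspace W" and Y: "normed_nspace Y" and YW: "cembeds Y W"
  shows "isomorphic (nprod Y (direct_sum r (\<lambda>_. W))) (direct_sum r (\<lambda>_. W))"
proof -
  let ?L = "direct_sum r (\<lambda>_. W)"
  interpret W: normed_nspace W by fact
  interpret Y: normed_nspace Y by fact
  have L: "normed_nspace ?L"
    using r W by (rule normed_direct_sum)
  note YL = normed_nprod[OF Y L]
  obtain A B where A: "operator Y W A" and B: "operator W Y B" and BA: "\<And>y. y \<in> vecs Y \<Longrightarrow> B (A y) = y"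
    using YW by (auto simp: cembeds_def)
  define P where "P x = A (B x)" for x
  have P: "operator W W P"
    unfolding P_def using B A Y by (rule operator_comp)
  obtain K where K: "0 \<le> K" "bop K W W P"
    using operator_bop_nonneg[OF P W] by blast
  have BP: "B (P x) = B x" if "x \<in> vecs W" for x
    using that by (simp add: P_def BA operatorD(1)[OF B])
  have PP: "P (P x) = P x" if "x \<in> vecs W" for x
    using BP[OF that] by (simp add: P_def)
  have PA: "P (A y) = A y" if "y \<in> vecs Y" for y
    using that by (simp add: P_def BA)
  have Pm: "P x \<in> vecs W" if "x \<in> vecs W" for x
    using that operatorD(1)[OF P] by blast
  have Pdiff: "P (x - y) = P x - P y" "B (x - y) = B x - B y"  if "x \<in> vecs W" "y \<in> vecs W" for x y
    using that operator_diff_arg[OF P W] operator_diff_arg[OF B W] by auto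
  have Padd: "P (x + y) = P x + P y" "B (x + y) = B x + B y" if "x \<in> vecs W" "y \<in> vecs W" for x y
    using that operatorD(2)[OF P] operatorD(2)[OF B] by auto
  have P0: "P 0 = 0"
    using P W by (rule operator_zero_arg)
  \<comment> \<open>\<open>U\<close> keeps the kernel part of each coordinate, moves its
    \<open>P\<close> part one place to the right and puts the additional copy of \<open>Y\<close>
    into place 0, where room has been made; \<open>V\<close> moves everything back.\<close>
  define U where "U z = (\<lambda>i. (if i = 0 then A (fst z) else 0) + (snd z i - P (snd z i))
    + (if 0 < i then P (snd z (i - 1)) else 0))" for z :: "'b \<times> (nat \<Rightarrow> 'a)"
  define V where "V v = (B (v 0), (\<lambda>i. v i - P (v i) + P (v (Suc i))))" for v :: "nat \<Rightarrow> 'a"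
  have diag: "operator ?L ?L (\<lambda>v i. v i - P (v i))"
  proof -
    have "operator ?L ?L (\<lambda>v i. P (v i))"
      using direct_sum_map[OF r K(1), where M = UNIV and \<sigma> = "\<lambda>n. n", OF _ K(2) W]
      by (auto intro: bop_operator)
    from operator_diff[OF operator_id this L] show ?thesis
      by (simp add: fun_diff_def)
  qed
  have right: "operator ?L ?L (\<lambda>v i. if 0 < i then P (v (i - 1)) else 0)"
    using direct_sum_map[OF r K(1), where M = "{0<..}" and \<sigma> = "\<lambda>n. n - 1", OF _ K(2) W]
    by (force intro: bop_operator simp: inj_on_def)
  have left: "operator ?L ?L (\<lambda>v i. P (v (Suc i)))"
    using direct_sum_map[OF r K(1), where M = UNIV and \<sigma> = Suc, OF _ K(2) W]
    by (auto intro: bop_operator)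
  have single: "operator W ?L (\<lambda>x m. if m = 0 then x else 0)"
    using bop_single[OF r, of "\<lambda>_. W" 0] W by (auto intro: bop_operator)
  have "operator (nprod Y ?L) ?L (\<lambda>z. (\<lambda>i. if i = 0 then A (fst z) else 0) + (\<lambda>i. snd z i - P (snd z i))
    + (\<lambda>i. if 0 < i then P (snd z (i - 1)) else 0))"
    by (intro operator_add L operator_comp[OF operator_comp[OF operator_fst[OF L] A Y] single W]
        operator_comp[OF operator_snd[OF Y] diag L] operator_comp[OF operator_snd[OF Y] right L])
  then have opU: "operator (nprod Y ?L) ?L U"
    by (rule operator_cong[OF _ YL]) (simp add: U_def fun_eq_iff)
  have comp0: "operator ?L W (\<lambda>v. v 0)"
    using bop_component[OF r] by (rule bop_operator)
  have "operator ?L (nprod Y ?L) (\<lambda>v. (B (v 0), (\<lambda>i. v i - P (v i)) + (\<lambda>i. P (v (Suc i)))))"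
    by (intro operator_pair operator_comp[OF comp0 B W] operator_add diag left L)
  then have opV: "operator ?L (nprod Y ?L) V"
    by (rule operator_cong[OF _ L]) (simp add: V_def fun_eq_iff)
  have "V (U z) = z" if z: "z \<in> vecs (nprod Y ?L)" for z
  proof -
    obtain y w where "z = (y, w)" "y \<in> vecs Y" "\<And>i. w i \<in> vecs W"
      using z by (cases z) (auto simp: nprod_def in_direct_sum)
    then show ?thesis
      using operatorD(1)[OF A]
      by (auto simp: U_def V_def fun_eq_iff Padd Pdiff PP PA Pm BP BA P0)
  qed
  moreover have "U (V v) = v" if "v \<in> vecs ?L" for v
  proof -
    have "v i \<in> vecs W" for i
      using that by (auto simp: in_direct_sum)
    then show ?thesis
      by (auto simp: U_def V_def fun_eq_iff Padd Pdiff PP Pm BP simp flip: P_def)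
  qed
  ultimately show ?thesis
    unfolding isomorphic_def using opU opV by blast
qed

text \<open>\<open>Y\<close> contains a complemented copy of \<open>?L\<close>, and
  \<open>?L\<close> absorbs a further \<open>?L\<close>, so \<open>Y\<close> is isomorphic to its
  product with \<open>?L\<close>. That product is isomorphic to \<open>?L\<close> because
  \<open>Y\<close> is complemented in \<open>W\<close>, and \<open>?L\<close> is isomorphic to
  \<open>W\<close>.\<close>

theorem pelczynski_decomposition:
  assumes r: "1 \<le> r" and W: "normed_nspace W" and Y: "normed_nspace Y"
    and WW: "isomorphic (direct_sum r (\<lambda>_. W)) W" and YW: "cembeds Y W" and WY: "cembeds W Y"
  shows "isomorphic Y W"
proof -
  let ?L = "direct_sum r (\<lambda>_. W)"
  interpret Y: normed_nspace Y by fact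
  have L: "normed_nspace ?L"
    using r W by (rule normed_direct_sum)
  have LW: "cembeds ?L W" and WL: "cembeds W ?L"
    using WW by (auto intro: isomorphic_cembeds isomorphic_sym)
  have LY: "cembeds ?L Y"
    using LW WY W by (rule cembeds_trans)
  obtain \<theta> \<theta>' where \<theta>: "operator (nprod ?L ?L) ?L \<theta>" and \<theta>': "operator ?L (nprod ?L ?L) \<theta>'"
    and \<theta>\<theta>: "\<And>z. z \<in> vecs (nprod ?L ?L) \<Longrightarrow> \<theta>' (\<theta> z) = z" "\<And>w. w \<in> vecs ?L \<Longrightarrow> \<theta> (\<theta>' w) = w"
    using pelczynski_absorb[OF r W L LW] by (auto simp: isomorphic_def)
  obtain C D where C: "operator ?L Y C" and D: "operator Y ?L D" and DC: "\<And>w. w \<in> vecs ?L \<Longrightarrow> D (C w) = w"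
    using LY by (auto simp: cembeds_def)
  note LLn = normed_nprod[OF L L] and YLn = normed_nprod[OF Y L]
  have CD: "operator Y Y (\<lambda>y. y - C (D y))"
    by (intro operator_diff operator_id Y operator_comp[OF D C L])
  \<comment> \<open>\<open>\<theta>\<close> merges two copies of \<open>?L\<close> into one.
    \<open>U\<close> leaves the complement of the copy of \<open>?L\<close> in \<open>Y\<close>
    alone and merges the \<open>?L\<close> part of \<open>Y\<close> with the second factor.\<close>
  define U where "U z = (fst z - C (D (fst z))) + C (\<theta> (D (fst z), snd z))" for z
  define V where "V y = ((y - C (D y)) + C (fst (\<theta>' (D y))), snd (\<theta>' (D y)))" for y
  have U: "operator (nprod Y ?L) Y U"
    unfolding U_def
    by (intro operator_add Y operator_comp[OF operator_fst[OF L] CD Y]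
        operator_comp[OF operator_comp[OF operator_pair[OF operator_comp[OF operator_fst[OF L] D Y]
        operator_snd[OF Y]] \<theta> LLn] C L])
  have V: "operator Y (nprod Y ?L) V"
    unfolding V_def
    by (intro operator_pair operator_add Y CD
        operator_comp[OF operator_comp[OF operator_comp[OF D \<theta>' L] operator_fst[OF L] LLn] C L]
        operator_comp[OF operator_comp[OF D \<theta>' L] operator_snd[OF L] LLn])
  have mem: "C w \<in> vecs Y" "fst (\<theta>' w) \<in> vecs ?L" "snd (\<theta>' w) \<in> vecs ?L" if "w \<in> vecs ?L" for w
    using operatorD(1)[OF C that] operatorD(1)[OF \<theta>' that] by (auto simp: nprod_def)
  have Dm: "D y \<in> vecs ?L" if "y \<in> vecs Y" for y
    using operatorD(1)[OF D that] .
  have \<theta>m: "\<theta> (v, w) \<in> vecs ?L" "\<theta>' (\<theta> (v, w)) = (v, w)" if "v \<in> vecs ?L" "w \<in> vecs ?L" for v w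
    using operatorD(1)[OF \<theta>, of "(v, w)"] \<theta>\<theta>(1)[of "(v, w)"] that by (auto simp: nprod_def)
  have Dadd: "D (x + y) = D x + D y" "D (x - y) = D x - D y" if "x \<in> vecs Y" "y \<in> vecs Y" for x y
    using operatorD(2)[OF D that] operator_diff_arg[OF D Y that] by auto
  have DU: "D ((y - C (D y)) + C w) = w" if "y \<in> vecs Y" "w \<in> vecs ?L" for y w
    using that by (simp add: Dadd mem Dm DC)
  have "V (U z) = z" if z: "z \<in> vecs (nprod Y ?L)" for z
  proof -
    obtain y w where z: "z = (y, w)" "y \<in> vecs Y" "w \<in> vecs ?L"
      using z by (cases z) (auto simp: nprod_def)
    then show ?thesis
      by (simp add: V_def U_def DU Dm \<theta>m)
  qed
  moreover have "U (V y) = y" if y: "y \<in> vecs Y" for y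
    using y by (simp add: V_def U_def DU Dm mem \<theta>\<theta>(2))
  ultimately have "isomorphic (nprod Y ?L) Y"
    unfolding isomorphic_def using U V by blast
  then have "isomorphic Y (nprod Y ?L)"
    by (rule isomorphic_sym)
  then show ?thesis
    using isomorphic_trans[OF pelczynski_absorb[OF r W Y YW] WW L] YLn by (rule isomorphic_trans)
qed

text \<open>Factoring the identity of \<open>X\<close> through one of two complementary projections embeds \<open>X\<close>
  complementably into the range, so that the decomposition method applies to the range.\<close>

theorem primaryI:
  assumes r: "1 \<le> r" and X: "normed_nspace X" and E: "normed_nspace E" and EX: "isomorphic E X"
    and factor: "\<And>T. operator X X T \<Longrightarrow> \<exists>R S. operator X X R \<and> operator X X S \<and>
      (\<exists>H\<in>{T, \<lambda>x. x - T x}. \<forall>x\<in>vecs X. S (H (R x)) = x)"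
    and WX: "cembeds (direct_sum r (\<lambda>_. X)) X"
  shows "primary E"
  unfolding primary_def
proof (intro allI impI)
  let ?W = "direct_sum r (\<lambda>_. X)"
  have W: "normed_nspace ?W"
    using r X by (rule normed_direct_sum)
  have WW: "isomorphic (direct_sum r (\<lambda>_. ?W)) ?W"
    using isomorphic_direct_sum_double[OF r, of "\<lambda>_. X"] by simp
  have XW: "cembeds X ?W"
    using bop_single[OF r X, of 0] bop_component[OF r, of "\<lambda>_. X" 0]
    unfolding cembeds_def by (auto intro!: exI bop_operator)
  \<comment> \<open>A first use of the decomposition method, for \<open>X\<close> itself: afterwards
    \<open>?W\<close> can serve as the absorbing space for the ranges, and the result is carried
    back to \<open>X\<close>.\<close>
  have XW_iso: "isomorphic X ?W"
    using r W X WW XW WX by (rule pelczynski_decomposition)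
  have XE: "cembeds X E" "cembeds E X"
    using EX by (auto intro: isomorphic_cembeds isomorphic_sym)
  obtain U V where U: "operator E X U" and V: "operator X E V"
    and VU: "\<And>x. x \<in> vecs E \<Longrightarrow> V (U x) = x" and UV: "\<And>x. x \<in> vecs X \<Longrightarrow> U (V x) = x"
    using EX by (auto simp: isomorphic_def)
  fix Q assume "projection E Q"
  then have Q: "operator E E Q" and QQ: "\<And>x. x \<in> vecs E \<Longrightarrow> Q (Q x) = Q x"
    by (auto simp: projection_def)
  \<comment> \<open>\<open>G\<close> stands for \<open>Q\<close> or its complementary projection.
    The identity of \<open>X\<close> factors through the range of \<open>G\<close>, so
    \<open>X\<close> is complemented in that range, while the range is complemented in
    \<open>E\<close>.\<close>
  have range: "isomorphic (op_range E E G) E"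
    if G: "operator E E G" and GG: "\<And>x. x \<in> vecs E \<Longrightarrow> G (G x) = G x"
      and R: "operator X X R" and S: "operator X X S"
      and SR: "\<And>x. x \<in> vecs X \<Longrightarrow> S (U (G (V (R x)))) = x" for G R S
  proof -
    let ?Y = "op_range E E G"
    have Y: "normed_nspace ?Y"
      using G E by (rule normed_op_range)
    have "operator E ?Y G"
      using G GG by (intro operator_into_op_range) auto
    then have YE: "cembeds ?Y E"
      unfolding cembeds_def using operator_op_range_into[OF G] GG by (auto simp: op_range_def)
    have "operator X ?Y (\<lambda>x. G (V (R x)))"
      by (intro operator_comp[OF operator_comp[OF R V X] \<open>operator E ?Y G\<close> E])
    moreover have "operator ?Y X (\<lambda>y. S (U y))"
      by (intro operator_comp[OF operator_comp[OF operator_op_range_into[OF G] U E] S X])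
    ultimately have XY: "cembeds X ?Y"
      unfolding cembeds_def using SR by blast
    have "isomorphic ?Y ?W"
      using cembeds_trans[OF cembeds_trans[OF YE XE(2) E] XW X] cembeds_trans[OF WX XY X]
      by (rule pelczynski_decomposition[OF r W Y WW])
    then have "isomorphic ?Y X"
      using isomorphic_sym[OF XW_iso] W by (rule isomorphic_trans)
    then show ?thesis
      using isomorphic_sym[OF EX] X by (rule isomorphic_trans)
  qed
  have T: "operator X X (\<lambda>x. U (Q (V x)))"
    by (intro operator_comp[OF operator_comp[OF V Q E] U E])
  from factor[OF T] obtain R S H where R: "operator X X R" and S: "operator X X S"
    and H: "H \<in> {\<lambda>x. U (Q (V x)), \<lambda>x. x - U (Q (V x))}" and SHR: "\<And>x. x \<in> vecs X \<Longrightarrow> S (H (R x)) = x"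
    by blast
  from H consider "H = (\<lambda>x. U (Q (V x)))" | "H = (\<lambda>x. x - U (Q (V x)))"
    by blast
  then show "isomorphic (op_range E E Q) E \<or> isomorphic (op_range E E (\<lambda>x. x - Q x)) E"
  proof cases
    case 1
    then have "isomorphic (op_range E E Q) E"
      using SHR by (intro range[OF Q _ R S]) (auto simp: QQ)
    then show ?thesis ..
  next
    case 2
    have Q': "operator E E (\<lambda>x. x - Q x)"
      using operator_id Q E by (rule operator_diff)
    have "(x - Q x) - Q (x - Q x) = x - Q x" if "x \<in> vecs E" for x
      using operator_diff_arg[OF Q E that operatorD(1)[OF Q that]] QQ[OF that] by simp
    moreover have "S (U (V (R x) - Q (V (R x)))) = x" if x: "x \<in> vecs X" for x
    proof -
      have v: "R x \<in> vecs X" "V (R x) \<in> vecs E"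
        using x operatorD(1)[OF R] operatorD(1)[OF V] by auto
      have "U (V (R x) - Q (V (R x))) = U (V (R x)) - U (Q (V (R x)))"
        using v operatorD(1)[OF Q] by (intro operator_diff_arg[OF U E]) auto
      also have "\<dots> = H (R x)"
        using 2 UV[OF v(1)] by simp
      finally show ?thesis
        using SHR[OF x] by simp
    qed
    ultimately have "isomorphic (op_range E E (\<lambda>x. x - Q x)) E"
      by (intro range[OF Q' _ R S])
    then show ?thesis ..
  qed
qed

section \<open>Coefficient trees\<close>

text \<open>A node of the dyadic tree is coded by the bits of the path from the root, so that the
  dyadic intervals containing \<open>I\<close> are the prefixes of \<open>I\<close>.\<close>

definition branch :: "(bool list \<Rightarrow> real) \<Rightarrow> bool list \<Rightarrow> real"
  where "branch a xs = L2_set (\<lambda>k. a (take k xs)) {..length xs}"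

definition tree_norm :: "(bool list \<Rightarrow> real) \<Rightarrow> real"
  where "tree_norm a = (SUP xs. branch a xs)"

definition tree_inf :: "(bool list \<Rightarrow> real) nspace"
  where "tree_inf = \<lparr>vecs = {a. bdd_above (range (branch a))}, vnorm = tree_norm\<rparr>"

definition tree :: "nat \<Rightarrow> (bool list \<Rightarrow> real) nspace"
  where "tree n = \<lparr>vecs = {a. \<forall>xs. n < length xs \<longrightarrow> a xs = 0}, vnorm = tree_norm\<rparr>"

lemma branch_nonneg [simp]: "0 \<le> branch a xs"
  by (simp add: branch_def L2_set_nonneg)

lemma branch_le_iff:
  assumes "0 \<le> c"
  shows "branch a xs \<le> c \<longleftrightarrow> (\<Sum>k\<le>length xs. (a (take k xs))\<^sup>2) \<le> c\<^sup>2"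
  unfolding branch_def L2_set_def
  using real_sqrt_le_iff[of "\<Sum>k\<le>length xs. (a (take k xs))\<^sup>2" "c\<^sup>2"] assms by simp

lemma branch_square: "(branch a xs)\<^sup>2 = (\<Sum>k\<le>length xs. (a (take k xs))\<^sup>2)"
  by (simp add: branch_def L2_set_def sum_nonneg)

lemma abs_le_branch: "\<bar>a xs\<bar> \<le> branch a xs"
proof -
  have "\<bar>a (take (length xs) xs)\<bar> = sqrt ((a (take (length xs) xs))\<^sup>2)"
    by simp
  also have "\<dots> \<le> branch a xs"
    unfolding branch_def L2_set_def
    by (intro real_sqrt_le_mono member_le_sum) auto
  finally show ?thesis by simp
qed

lemma branch_add: "branch (\<lambda>xs. a xs + b xs) xs \<le> branch a xs + branch b xs"
  unfolding branch_def by (rule L2_set_triangle_ineq)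

lemma branch_scale: "branch (\<lambda>xs. c * a xs) xs = \<bar>c\<bar> * branch a xs"
  by (simp add: branch_def L2_set_def power_mult_distrib real_sqrt_mult flip: sum_distrib_left)

lemma branch_mono: "(\<And>xs. \<bar>a xs\<bar> \<le> \<bar>b xs\<bar>) \<Longrightarrow> branch a xs \<le> branch b xs"
  unfolding branch_def L2_set_def by (intro real_sqrt_le_mono sum_mono) (simp add: abs_le_square_iff)

lemma branch_le_tree_norm: "a \<in> vecs tree_inf \<Longrightarrow> branch a xs \<le> tree_norm a"
  unfolding tree_norm_def tree_inf_def by (intro cSUP_upper) auto

lemma tree_infI:
  assumes "\<And>xs. branch a xs \<le> c"
  shows "a \<in> vecs tree_inf" "tree_norm a \<le> c"
  using assms unfolding tree_norm_def tree_inf_def by (auto intro!: cSUP_least bdd_aboveI[of _ c])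

lemma tree_norm_nonneg: "a \<in> vecs tree_inf \<Longrightarrow> 0 \<le> tree_norm a"
  using branch_le_tree_norm[of a "[]"] branch_nonneg[of a "[]"] by linarith

lemma normed_tree_inf: "normed_nspace tree_inf"
proof -
  have nrm: "vnorm tree_inf = tree_norm"
    by (simp add: tree_inf_def)
  have ad: "a + b \<in> vecs tree_inf \<and> tree_norm (a + b) \<le> tree_norm a + tree_norm b"
    if "a \<in> vecs tree_inf" "b \<in> vecs tree_inf" for a b
  proof -
    have "branch (a + b) xs \<le> tree_norm a + tree_norm b" for xs
      unfolding plus_fun_def
      using branch_add[of a b xs] branch_le_tree_norm[OF that(1), of xs] branch_le_tree_norm[OF that(2), of xs]
      by linarith
    then show ?thesis
      using tree_infI by blast
  qed
  have sc: "c *\<^sub>R a \<in> vecs tree_inf \<and> tree_norm (c *\<^sub>R a) \<le> \<bar>c\<bar> * tree_norm a"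
    if "a \<in> vecs tree_inf" for c a
  proof -
    have "branch (c *\<^sub>R a) xs \<le> \<bar>c\<bar> * tree_norm a" for xs
      by (simp add: scaleR_fun_def branch_scale mult_left_mono branch_le_tree_norm[OF that])
    then show ?thesis
      using tree_infI by blast
  qed
  have z: "0 \<in> vecs tree_inf"
    by (rule tree_infI[of _ 0]) (simp add: branch_def L2_set_def)
  show ?thesis
    using z sc ad tree_norm_nonneg by (intro normed_nspaceI) (simp_all add: nrm)
qed

lemma in_tree: "a \<in> vecs (tree n) \<longleftrightarrow> (\<forall>xs. n < length xs \<longrightarrow> a xs = 0)"
  by (simp add: tree_def)

lemma vnorm_tree [simp]: "vnorm (tree n) = tree_norm" "vnorm tree_inf = tree_norm"
  by (simp_all add: tree_def tree_inf_def)

lemma finite_bool_lists: "finite {xs :: bool list. length xs \<le> n}"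
  using finite_lists_length_le[of "UNIV :: bool set" n] by simp

lemma tree_subset: "vecs (tree n) \<subseteq> vecs tree_inf"
proof
  fix a assume a: "a \<in> vecs (tree n)"
  have "branch a xs \<le> (\<Sum>ys\<in>{ys. length ys \<le> n}. \<bar>a ys\<bar>)" for xs
  proof -
    have "branch a xs \<le> (\<Sum>k\<le>length xs. \<bar>a (take k xs)\<bar>)"
      unfolding branch_def by (rule L2_set_le_sum_abs)
    also have "\<dots> = (\<Sum>ys\<in>(\<lambda>k. take k xs) ` {..length xs}. \<bar>a ys\<bar>)"
      by (subst sum.reindex) (auto simp: inj_on_def dest: arg_cong[where f = length])
    also have "\<dots> = (\<Sum>ys\<in>(\<lambda>k. take k xs) ` {..length xs} \<inter> {ys. length ys \<le> n}. \<bar>a ys\<bar>)"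
      using a by (intro sum.mono_neutral_right) (auto simp: in_tree not_le)
    also have "\<dots> \<le> (\<Sum>ys\<in>{ys. length ys \<le> n}. \<bar>a ys\<bar>)"
      using finite_bool_lists by (intro sum_mono2) auto
    finally show ?thesis .
  qed
  then show "a \<in> vecs tree_inf"
    by (rule tree_infI)
qed

lemma tree_branch_le: "a \<in> vecs (tree n) \<Longrightarrow> branch a xs \<le> tree_norm a"
  using tree_subset branch_le_tree_norm by blast

lemma normed_tree: "normed_nspace (tree n)"
proof -
  interpret normed_nspace tree_inf
    by (rule normed_tree_inf)
  note sub = subsetD[OF tree_subset]
  show ?thesis
    using nonneg scale triangle
    by unfold_locales (auto simp: sub subspace_def in_tree scaleR_fun_def)
qed

lemma bop_treeI:
  assumes "\<And>a. a \<in> vecs (tree n) \<Longrightarrow> T a \<in> vecs (tree m)"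
    "\<And>a b xs. a \<in> vecs (tree n) \<Longrightarrow> b \<in> vecs (tree n) \<Longrightarrow> T (a + b) xs = T a xs + T b xs"
    "\<And>c a xs. a \<in> vecs (tree n) \<Longrightarrow> T (c *\<^sub>R a) xs = c * T a xs"
    "\<And>a xs. a \<in> vecs (tree n) \<Longrightarrow> branch (T a) xs \<le> K * tree_norm a"
  shows "bop K (tree n) (tree m) T"
  using assms tree_infI(2) by (intro bopI) (auto simp: fun_eq_iff scaleR_fun_def)

section \<open>Embedding a tree into a taller tree\<close>

text \<open>Besides the prefix order the direction is kept: the copy of child \<open>b\<close> lies
  in the subtree of child \<open>b\<close> of the copy, at any distance. Hence incomparable nodes
  stay incomparable. Nodes deeper than \<open>n\<close> are unconstrained.\<close>

definition tree_emb :: "nat \<Rightarrow> (bool list \<Rightarrow> bool list) \<Rightarrow> bool"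
  where "tree_emb n \<phi> \<longleftrightarrow> (\<forall>xs b. length xs < n \<longrightarrow> (\<exists>w. \<phi> (xs @ [b]) = \<phi> xs @ b # w))"

lemma tree_emb_prefix:
  assumes "tree_emb n \<phi>" "prefix xs ys" "length ys \<le> n"
  shows "prefix (\<phi> xs) (\<phi> ys)" "xs \<noteq> ys \<Longrightarrow> length (\<phi> xs) < length (\<phi> ys)"
proof -
  have "prefix (\<phi> xs) (\<phi> (xs @ zs)) \<and> (zs \<noteq> [] \<longrightarrow> length (\<phi> xs) < length (\<phi> (xs @ zs)))"
    if "length (xs @ zs) \<le> n" for zs
    using that
  proof (induction zs rule: rev_induct)
    case (snoc b zs)
    then obtain w where "\<phi> (xs @ zs @ [b]) = \<phi> (xs @ zs) @ b # w"
      using assms(1) unfolding tree_emb_def by (metis append.assoc length_append_singleton less_eq_Suc_le)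
    moreover have "prefix (\<phi> xs) (\<phi> (xs @ zs))"
      using snoc by simp
    ultimately show ?case
      using prefix_length_le by (fastforce simp: prefix_append)
  qed simp
  moreover obtain zs where "ys = xs @ zs"
    using assms(2) by (auto simp: prefix_def)
  ultimately show "prefix (\<phi> xs) (\<phi> ys)" "xs \<noteq> ys \<Longrightarrow> length (\<phi> xs) < length (\<phi> ys)"
    using assms(3) by auto
qed

text \<open>Incomparable nodes part at some bit, and their copies part directly after the copy of
  the last common node.\<close>

lemma tree_emb_reflect:
  assumes \<phi>: "tree_emb n \<phi>" and n: "length xs \<le> n" "length ys \<le> n" and p: "prefix (\<phi> xs) (\<phi> ys)"
  shows "prefix xs ys"
proof (rule ccontr)
  assume np: "\<not> prefix xs ys"
  show False
  proof (cases "prefix ys xs")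
    case True
    then have "length (\<phi> ys) < length (\<phi> xs)"
      using tree_emb_prefix(2)[OF \<phi> True n(1)] np by auto
    then show False
      using prefix_length_le[OF p] by simp
  next
    case False
    then have par: "parallel xs ys"
      using np by blast
    obtain zs b c us vs where bc: "b \<noteq> c" "xs = zs @ b # us" "ys = zs @ c # vs"
      using parallel_decomp[OF par] by blast
    have "length zs < n"
      using n(1) bc(2) by simp
    then obtain w w' where w: "\<phi> (zs @ [b]) = \<phi> zs @ b # w" "\<phi> (zs @ [c]) = \<phi> zs @ c # w'"
      using \<phi> unfolding tree_emb_def by blast
    have "prefix (\<phi> (zs @ [b])) (\<phi> xs)" "prefix (\<phi> (zs @ [c])) (\<phi> ys)"
      using bc n by (auto intro!: tree_emb_prefix(1)[OF \<phi>])
    then have "prefix (\<phi> (zs @ [b])) (\<phi> ys)" "prefix (\<phi> (zs @ [c])) (\<phi> ys)"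
      using p prefix_order.trans by blast+
    then show False
      using w bc(1) by (auto simp: prefix_def)
  qed
qed

lemma tree_emb_inj:
  assumes \<phi>: "tree_emb n \<phi>"
  shows "inj_on \<phi> {xs. length xs \<le> n}"
  using tree_emb_reflect[OF \<phi>] by (auto simp: inj_on_def intro: prefix_order.antisym)

definition pull :: "nat \<Rightarrow> (bool list \<Rightarrow> bool list) \<Rightarrow> (bool list \<Rightarrow> real) \<Rightarrow> bool list \<Rightarrow> real"
  where "pull n \<phi> a xs = (if length xs \<le> n then a (\<phi> xs) else 0)"

definition push :: "nat \<Rightarrow> (bool list \<Rightarrow> bool list) \<Rightarrow> (bool list \<Rightarrow> real) \<Rightarrow> bool list \<Rightarrow> real"
  where "push n \<phi> a zs = (if zs \<in> \<phi> ` {xs. length xs \<le> n} then a (inv_into {xs. length xs \<le> n} \<phi> zs) else 0)"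

lemma push_image:
  assumes "tree_emb n \<phi>" "length xs \<le> n"
  shows "push n \<phi> a (\<phi> xs) = a xs"
  using assms inv_into_f_f[OF tree_emb_inj[OF assms(1)]] by (auto simp: push_def)

text \<open>The nodes of a branch are sent to distinct nodes of one branch, so the sum of squares
  read off is a partial sum of the one along the target branch.\<close>

lemma branch_pull:
  assumes \<phi>: "tree_emb n \<phi>"
  shows "branch (pull n \<phi> a) xs \<le> branch a (\<phi> (take n xs))"
proof -
  define ys where "ys = take n xs"
  have lys: "length ys \<le> n"
    by (simp add: ys_def)
  have pre: "prefix (\<phi> (take k ys)) (\<phi> ys)" for k
    using tree_emb_prefix(1)[OF \<phi> take_is_prefix lys] .
  have lt: "length (\<phi> (take j ys)) < length (\<phi> (take k ys))" if "j < k" "k \<le> length ys" for j k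
  proof (rule tree_emb_prefix(2)[OF \<phi>])
    show "prefix (take j ys) (take k ys)"
      using that by (metis less_imp_le min.absorb1 take_is_prefix take_take)
    show "take j ys \<noteq> take k ys"
      using that by (metis length_take less_le_trans min.absorb2 nat_less_le)
  qed (use lys in simp)
  have inj: "inj_on (\<lambda>k. length (\<phi> (take k ys))) {..length ys}"
    using lt by (intro linorder_inj_onI) (auto, metis less_irrefl)
  have "(branch (pull n \<phi> a) xs)\<^sup>2 = (\<Sum>k\<le>length ys. (a (\<phi> (take k ys)))\<^sup>2)"
    unfolding branch_square
    by (rule sum.mono_neutral_cong_right) (auto simp: pull_def ys_def min_def not_le)
  also have "\<dots> = (\<Sum>k\<le>length ys. (a (take (length (\<phi> (take k ys))) (\<phi> ys)))\<^sup>2)"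
    using pre by (intro sum.cong refl) (metis append_eq_conv_conj prefix_def)
  also have "\<dots> = (\<Sum>t\<in>(\<lambda>k. length (\<phi> (take k ys))) ` {..length ys}. (a (take t (\<phi> ys)))\<^sup>2)"
    by (subst sum.reindex[OF inj]) simp
  also have "\<dots> \<le> (branch a (\<phi> ys))\<^sup>2"
    unfolding branch_square using pre prefix_length_le by (intro sum_mono2) fastforce+
  finally show ?thesis
    by (simp add: ys_def power2_le_iff_abs_le)
qed

text \<open>The copies met by one branch of the big tree come from nodes of one branch, since
  \<open>\<phi>\<close> reflects the prefix order.\<close>

lemma branch_push:
  assumes \<phi>: "tree_emb n \<phi>" and c: "\<And>ys. branch a ys \<le> c"
  shows "branch (push n \<phi> a) zs \<le> c"
proof -
  have c0: "0 \<le> c"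
    using c[of "[]"] branch_nonneg[of a "[]"] by linarith
  let ?D = "{xs. length xs \<le> n}"
  define \<psi> where "\<psi> = inv_into ?D \<phi>"
  define K where "K = {k \<in> {..length zs}. take k zs \<in> \<phi> ` ?D}"
  have fin: "finite K"
    by (simp add: K_def)
  have \<psi>: "\<psi> (take k zs) \<in> ?D" "\<phi> (\<psi> (take k zs)) = take k zs" if "k \<in> K" for k
    using that inv_into_into[of "take k zs" \<phi> ?D] f_inv_into_f[of "take k zs" \<phi> ?D]
    unfolding K_def \<psi>_def by blast+
  have "(\<Sum>k\<le>length zs. (push n \<phi> a (take k zs))\<^sup>2) = (\<Sum>k\<in>K. (a (\<psi> (take k zs)))\<^sup>2)"
    by (rule sum.mono_neutral_cong_right) (auto simp: K_def push_def \<psi>_def)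
  also have "\<dots> \<le> c\<^sup>2"
  proof (cases "K = {}")
    case False
    \<comment> \<open>The preimage of the deepest copy on the branch \<open>zs\<close>; every other
      preimage is a prefix of it, so the branch of \<open>y\<close> collects all terms.\<close>
    define y where "y = \<psi> (take (Max K) zs)"
    have mem: "Max K \<in> K"
      using fin False by (rule Max_in)
    have pre: "prefix (\<psi> (take k zs)) y" if "k \<in> K" for k
    proof (rule tree_emb_reflect[OF \<phi>])
      have "k \<le> Max K"
        using fin that by simp
      then have "prefix (take k zs) (take (Max K) zs)"
        by (metis min.absorb1 take_is_prefix take_take)
      then show "prefix (\<phi> (\<psi> (take k zs))) (\<phi> y)"
        using \<psi>(2) that mem by (simp add: y_def)
    qed (use \<psi>(1) that mem in \<open>auto simp: y_def\<close>)
    have tk: "take (length (\<psi> (take k zs))) y = \<psi> (take k zs)" if "k \<in> K" for k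
      using pre[OF that] by (metis append_eq_conv_conj prefix_def)
    have inj: "inj_on (\<lambda>k. length (\<psi> (take k zs))) K"
    proof (rule inj_onI)
      fix j k assume jk: "j \<in> K" "k \<in> K" "length (\<psi> (take j zs)) = length (\<psi> (take k zs))"
      then have "\<psi> (take j zs) = \<psi> (take k zs)"
        using tk by metis
      then have "take j zs = take k zs"
        using \<psi>(2) jk by metis
      then have "length (take j zs) = length (take k zs)"
        by simp
      then show "j = k"
        using jk by (simp add: K_def)
    qed
    have "(\<Sum>k\<in>K. (a (\<psi> (take k zs)))\<^sup>2) = (\<Sum>k\<in>K. (a (take (length (\<psi> (take k zs))) y))\<^sup>2)"
      using tk by simp
    also have "\<dots> = (\<Sum>t\<in>(\<lambda>k. length (\<psi> (take k zs))) ` K. (a (take t y))\<^sup>2)"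
      by (subst sum.reindex[OF inj]) simp
    also have "\<dots> \<le> (branch a y)\<^sup>2"
      unfolding branch_square using pre prefix_length_le by (intro sum_mono2) fastforce+
    also have "\<dots> \<le> c\<^sup>2"
      using c by (intro power_mono) auto
    finally show ?thesis .
  qed simp
  finally show ?thesis
    using c0 by (simp add: branch_le_iff)
qed

section \<open>A Ramsey property of binary trees\<close>

definition contains_tree :: "bool list set \<Rightarrow> nat \<Rightarrow> nat \<Rightarrow> bool"
  where "contains_tree C a d \<longleftrightarrow>
    (\<exists>\<phi>. tree_emb a \<phi> \<and> (\<forall>xs. length xs \<le> a \<longrightarrow> length (\<phi> xs) \<le> d \<and> \<phi> xs \<in> C))"

lemma contains_tree_child:
  assumes "contains_tree {xs. x # xs \<in> C} a d"
  shows "contains_tree C a (Suc d)"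
proof -
  obtain \<phi> where "tree_emb a \<phi>" "\<forall>xs. length xs \<le> a \<longrightarrow> length (\<phi> xs) \<le> d \<and> \<phi> xs \<in> {xs. x # xs \<in> C}"
    using assms by (auto simp: contains_tree_def)
  then show ?thesis
    unfolding contains_tree_def by (intro exI[of _ "\<lambda>xs. x # \<phi> xs"]) (auto simp: tree_emb_def)
qed

lemma contains_tree_node:
  assumes root: "[] \<in> C" and "\<And>x. contains_tree {xs. x # xs \<in> C} a d"
  shows "contains_tree C (Suc a) (Suc d)"
proof -
  obtain \<phi> where \<phi>: "\<And>x. tree_emb a (\<phi> x)"
    "\<And>x xs. length xs \<le> a \<Longrightarrow> length (\<phi> x xs) \<le> d \<and> x # \<phi> x xs \<in> C"
    using assms(2) unfolding contains_tree_def mem_Collect_eq by metis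
  define \<psi> where "\<psi> xs = (case xs of [] \<Rightarrow> [] | x # xs \<Rightarrow> x # \<phi> x xs)" for xs
  have "tree_emb (Suc a) \<psi>"
    using \<phi>(1) unfolding tree_emb_def by (auto simp: \<psi>_def split: list.split)
  moreover have "length (\<psi> xs) \<le> Suc d \<and> \<psi> xs \<in> C" if "length xs \<le> Suc a" for xs
    using that root \<phi>(2) by (auto simp: \<psi>_def split: list.split)
  ultimately show ?thesis
    unfolding contains_tree_def by blast
qed

lemma contains_tree_trivial: "[] \<in> C \<Longrightarrow> contains_tree C 0 d"
  unfolding contains_tree_def by (intro exI[of _ "\<lambda>_. []"]) (simp add: tree_emb_def)

text \<open>Induction on \<open>a + b\<close>, by the colour of the root. If the root lies in
  \<open>C\<close> and \<open>a\<close> is positive, each of the two subtrees contains a tree of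
  depth \<open>a - 1\<close> in \<open>C\<close> or one of depth \<open>b\<close> in the complement.
  One occurrence of the latter suffices; otherwise two trees of the former kind are joined at the
  root. The other colour is symmetric.\<close>

lemma monochromatic_tree: "contains_tree C a (a + b) \<or> contains_tree (- C) b (a + b)"
proof (induction "a + b" arbitrary: C a b)
  case 0
  then show ?case
    using contains_tree_trivial[of C] contains_tree_trivial[of "- C"] by auto
next
  case (Suc d)
  have *: "contains_tree C a (Suc d) \<or> contains_tree (- C) b (Suc d)"
    if root: "[] \<in> C" and IH: "\<And>a b C. d = a + b \<Longrightarrow> contains_tree C a d \<or> contains_tree (- C) b d"
      and ab: "Suc d = a + b" for C a b
  proof (cases a)
    case 0
    then show ?thesis
      using contains_tree_trivial[OF root] by simp
  next
    case (Suc a')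
    have "contains_tree {xs. x # xs \<in> C} a' d \<or> contains_tree {xs. x # xs \<in> - C} b d" for x
      using IH[of a' b "{xs. x # xs \<in> C}"] ab Suc by (simp add: Collect_neg_eq)
    then show ?thesis
      using contains_tree_node[OF root, of a' d] contains_tree_child[of _ "- C" b d] Suc by blast
  qed
  show ?case
  proof (cases "[] \<in> C")
    case True
    then show ?thesis
      using *[OF True, of a b] Suc by metis
  next
    case False
    then show ?thesis
      using *[of "- C" b a] Suc by (metis ComplI add.commute double_complement)
  qed
qed

section \<open>Replacing nodes by chains\<close>

text \<open>The chain of \<open>xs\<close> consists of the nodes \<open>chain_node L xs s\<close>
  for \<open>s < L\<close>, at depths \<open>length xs * L + s\<close>. It descends through left
  children, and the bit \<open>b\<close> taken at its last node leads to the first node of the chain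
  of \<open>xs @ [b]\<close>.\<close>

definition spread :: "nat \<Rightarrow> bool list \<Rightarrow> bool list"
  where "spread L xs = concat (map (\<lambda>b. replicate (L - 1) False @ [b]) xs)"

definition chain_node :: "nat \<Rightarrow> bool list \<Rightarrow> nat \<Rightarrow> bool list"
  where "chain_node L xs s = spread L xs @ replicate s False"

text \<open>Only the bits taken at the ends of chains count. So every node of the tall tree, on a
  chain or not, is assigned a node of the small tree, and \<open>length zs mod L\<close> is its
  position within the block of levels.\<close>

definition trace_bits :: "nat \<Rightarrow> bool list \<Rightarrow> bool list"
  where "trace_bits L zs = map (\<lambda>j. zs ! (j * L + (L - 1))) [0..<length zs div L]"

lemma length_spread: "0 < L \<Longrightarrow> length (spread L xs) = length xs * L"
  by (induction xs) (auto simp: spread_def)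

lemma length_chain: "0 < L \<Longrightarrow> length (chain_node L xs s) = length xs * L + s"
  by (simp add: chain_node_def length_spread)

lemma spread_nth:
  assumes L: "0 < L" and j: "j < length xs"
  shows "spread L xs ! (j * L + (L - 1)) = xs ! j"
  using j
proof (induction xs arbitrary: j)
  case (Cons x xs)
  show ?case
  proof (cases j)
    case 0
    then show ?thesis
      using L by (simp add: spread_def nth_append)
  next
    case (Suc i)
    have idx: "j * L + (L - 1) = length (replicate (L - 1) False @ [x]) + (i * L + (L - 1))"
      using L Suc by simp
    have "spread L (x # xs) ! (j * L + (L - 1)) = spread L xs ! (i * L + (L - 1))"
      unfolding idx by (simp add: spread_def nth_append_length_plus del: length_append append.simps append_assoc)
    with Cons Suc show ?thesis by simp
  qed
qed simp

lemma trace_chain: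
  assumes "s < L"
  shows "trace_bits L (chain_node L xs s) = xs"
proof (rule nth_equalityI)
  have L: "0 < L"
    using assms by simp
  show len: "length (trace_bits L (chain_node L xs s)) = length xs"
    using assms by (simp add: trace_bits_def length_chain)
  fix j assume "j < length (trace_bits L (chain_node L xs s))"
  then have j: "j < length xs"
    by (simp add: len)
  have "Suc j * L \<le> length xs * L"
    using j by (intro mult_le_mono1) simp
  then have "j * L + (L - 1) < length (spread L xs)"
    using L by (simp add: length_spread)
  then show "trace_bits L (chain_node L xs s) ! j = xs ! j"
    using j len spread_nth[OF L j] by (simp add: trace_bits_def chain_node_def nth_append)
qed

lemma trace_take:
  assumes "0 < L" "t \<le> length zs"
  shows "trace_bits L (take t zs) = take (t div L) (trace_bits L zs)"
proof (rule nth_equalityI)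
  have le: "t div L \<le> length zs div L"
    using assms by (simp add: div_le_mono)
  then show len: "length (trace_bits L (take t zs)) = length (take (t div L) (trace_bits L zs))"
    using assms by (simp add: trace_bits_def)
  fix j assume "j < length (trace_bits L (take t zs))"
  then have j: "j < t div L"
    using assms by (simp add: trace_bits_def)
  then have "Suc j * L \<le> t"
    by (metis Suc_leI assms(1) less_eq_div_iff_mult_less_eq)
  then have "j * L + (L - 1) < t"
    using assms(1) by simp
  then show "trace_bits L (take t zs) ! j = take (t div L) (trace_bits L zs) ! j"
    using j le assms by (simp add: trace_bits_def)
qed

lemma take_chain:
  assumes s: "s < L" and j: "j \<le> length xs"
  shows "take (j * L + s) (chain_node L xs (L - 1)) = chain_node L (take j xs) s"
  using j
proof (induction xs arbitrary: j)
  case Nil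
  then show ?case
    using s by (simp add: chain_node_def spread_def min_def)
next
  case (Cons x xs)
  show ?case
  proof (cases j)
    case 0
    then show ?thesis
      using s by (simp add: chain_node_def spread_def min_def)
  next
    case (Suc i)
    have "take (j * L + s) (chain_node L (x # xs) (L - 1))
      = (replicate (L - 1) False @ [x]) @ take (i * L + s) (chain_node L xs (L - 1))"
      using s Suc by (simp add: chain_node_def spread_def min_def)
    also have "\<dots> = chain_node L (take j (x # xs)) s"
      using Cons Suc by (simp add: chain_node_def spread_def)
    finally show ?thesis .
  qed
qed

text \<open>The coefficient is copied to all nodes with the given trace, so each branch of the tall
  tree sees one branch of the small one. \<open>sample\<close> reads along the chains only, which is
  enough to undo \<open>stretch\<close> when the \<open>c xs\<close> are unit vectors.\<close>

definition stretch :: "nat \<Rightarrow> (bool list \<Rightarrow> nat \<Rightarrow> real) \<Rightarrow> (bool list \<Rightarrow> real) \<Rightarrow> bool list \<Rightarrow> real"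
  where "stretch L c a zs = a (trace_bits L zs) * c (trace_bits L zs) (length zs mod L)"

definition sample :: "nat \<Rightarrow> (bool list \<Rightarrow> nat \<Rightarrow> real) \<Rightarrow> (bool list \<Rightarrow> real) \<Rightarrow> bool list \<Rightarrow> real"
  where "sample L c f xs = (\<Sum>s<L. c xs s * f (chain_node L xs s))"

lemma sum_block: "(\<Sum>t\<in>{m * L..<m * L + L}. G t) = (\<Sum>s<L. G (m * L + s))"
  for G :: "nat \<Rightarrow> real"
  using sum.shift_bounds_nat_ivl[of G 0 "m * L" L] by (simp add: atLeast0LessThan add.commute)

text \<open>Depths are grouped into blocks of length \<open>L\<close>. The trace is constant within
  a block, which therefore contributes one squared coefficient times a sum of squares at most
  1.\<close>

lemma branch_stretch:
  assumes L: "0 < L" and c: "\<And>xs. (\<Sum>s<L. (c xs s)\<^sup>2) \<le> 1"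
  shows "branch (stretch L c a) zs \<le> branch a (trace_bits L zs)"
proof -
  define q where "q = length zs div L"
  define G where "G t = (a (take (t div L) (trace_bits L zs)) * c (take (t div L) (trace_bits L zs)) (t mod L))\<^sup>2" for t
  have "(branch (stretch L c a) zs)\<^sup>2 = (\<Sum>t\<le>length zs. G t)"
    unfolding branch_square using L
    by (intro sum.cong) (auto simp: stretch_def G_def trace_take min_def)
  \<comment> \<open>The branch may end inside a block; completing the block only adds
    squares.\<close>
  also have "\<dots> \<le> (\<Sum>t<Suc q * L. G t)"
  proof (rule sum_mono2)
    show "{..length zs} \<subseteq> {..<Suc q * L}"
      using L by (auto simp: q_def) (metis add.commute dividend_less_div_times le_less_trans)
  qed (auto simp: G_def)
  also have "\<dots> = (\<Sum>m<Suc q. \<Sum>t\<in>{m * L..<m * L + L}. G t)"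
    by (rule sum.nat_group[symmetric])
  also have "\<dots> = (\<Sum>m<Suc q. \<Sum>s<L. G (m * L + s))"
    by (simp only: sum_block)
  also have "\<dots> = (\<Sum>m<Suc q. (a (take m (trace_bits L zs)))\<^sup>2 * (\<Sum>s<L. (c (take m (trace_bits L zs)) s)\<^sup>2))"
    using L by (simp add: G_def power_mult_distrib sum_distrib_left del: sum.lessThan_Suc)
  also have "\<dots> \<le> (\<Sum>m<Suc q. (a (take m (trace_bits L zs)))\<^sup>2 * 1)"
    by (intro sum_mono mult_left_mono c) auto
  also have "\<dots> = (branch a (trace_bits L zs))\<^sup>2"
    unfolding branch_square by (simp add: lessThan_Suc_atMost q_def trace_bits_def)
  finally show ?thesis
    by (simp add: power2_le_iff_abs_le)
qed

text \<open>Cauchy-Schwarz on each chain; the chains of the prefixes of \<open>xs\<close>, one after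
  another, make up the branch that ends with the chain of \<open>xs\<close>.\<close>

lemma branch_sample:
  assumes L: "0 < L" and c: "\<And>xs. (\<Sum>s<L. (c xs s)\<^sup>2) \<le> 1"
  shows "branch (sample L c f) xs \<le> branch f (chain_node L xs (L - 1))"
proof -
  define m where "m = length xs"
  define G where "G t = (f (take t (chain_node L xs (L - 1))))\<^sup>2" for t
  have "(branch (sample L c f) xs)\<^sup>2 \<le> (\<Sum>j\<le>m. \<Sum>s<L. G (j * L + s))"
    unfolding branch_square m_def
  proof (rule sum_mono)
    fix j assume j: "j \<in> {..length xs}"
    have "(sample L c f (take j xs))\<^sup>2 \<le>
      (\<Sum>s<L. (c (take j xs) s)\<^sup>2) * (\<Sum>s<L. (f (chain_node L (take j xs) s))\<^sup>2)"
      unfolding sample_def by (rule Cauchy_Schwarz_ineq_sum)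
    also have "\<dots> \<le> 1 * (\<Sum>s<L. (f (chain_node L (take j xs) s))\<^sup>2)"
      by (intro mult_right_mono c sum_nonneg) auto
    also have "\<dots> = (\<Sum>s<L. G (j * L + s))"
      using j by (simp add: G_def take_chain del: One_nat_def)
    finally show "(sample L c f (take j xs))\<^sup>2 \<le> (\<Sum>s<L. G (j * L + s))" .
  qed
  also have "\<dots> = (\<Sum>j<Suc m. \<Sum>t\<in>{j * L..<j * L + L}. G t)"
    unfolding lessThan_Suc_atMost
    by (simp only: sum_block)
  also have "\<dots> = (\<Sum>t<Suc m * L. G t)"
    by (rule sum.nat_group)
  also have "{..<Suc m * L} = {..length (chain_node L xs (L - 1))}"
    using L by (auto simp: length_chain m_def)
  also have "(\<Sum>t\<in>\<dots>. G t) = (branch f (chain_node L xs (L - 1)))\<^sup>2"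
    by (simp add: branch_square G_def)
  finally show ?thesis
    by (simp add: power2_le_iff_abs_le)
qed

section \<open>Biorthogonalisation\<close>

lemma homogeneous_system:
  fixes A :: "'p \<Rightarrow> 's \<Rightarrow> real"
  assumes "finite S" "finite P" "card P < card S"
  shows "\<exists>c. (\<exists>s\<in>S. c s \<noteq> 0) \<and> (\<forall>p\<in>P. (\<Sum>s\<in>S. A p s * c s) = 0)"
  using assms(2,1,3)
proof (induction P arbitrary: A S rule: finite_induct)
  case empty
  then obtain s where "s \<in> S"
    by fastforce
  then show ?case
    by (intro exI[of _ "\<lambda>_. 1"]) auto
next
  case (insert q P)
  show ?case
  proof (cases "\<forall>s\<in>S. A q s = 0")
    case True
    then have "(\<Sum>s\<in>S. A q s * c s) = 0" for c
      by simp
    moreover obtain c where "\<exists>s\<in>S. c s \<noteq> 0" "\<forall>p\<in>P. (\<Sum>s\<in>S. A p s * c s) = 0"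
      using insert.IH[of S A] insert.prems insert.hyps by auto
    ultimately show ?thesis
      by blast
  next
    case False
    then obtain s0 where s0: "s0 \<in> S" "A q s0 \<noteq> 0"
      by blast
    \<comment> \<open>Gaussian elimination: equation \<open>q\<close> is solved for the unknown
      \<open>s0\<close> and substituted into the others; \<open>d\<close> below restores the value
      at \<open>s0\<close>.\<close>
    define A' where "A' p s = A p s - A p s0 / A q s0 * A q s" for p s
    have "card P < card (S - {s0})"
      using insert s0 by simp
    then obtain c where c: "\<exists>s\<in>S - {s0}. c s \<noteq> 0" "\<forall>p\<in>P. (\<Sum>s\<in>S - {s0}. A' p s * c s) = 0"
      using insert.IH[of "S - {s0}" A'] insert.prems by auto
    define R where "R p = (\<Sum>s\<in>S - {s0}. A p s * c s)" for p
    define d where "d = c(s0 := - R q / A q s0)"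
    have sum: "(\<Sum>s\<in>S. A p s * d s) = A p s0 * (- R q / A q s0) + R p" for p
      using insert.prems s0 by (simp add: sum.remove[of S s0] d_def R_def)
    have "R p - A p s0 / A q s0 * R q = 0" if "p \<in> P" for p
    proof -
      have "(\<Sum>s\<in>S - {s0}. A' p s * c s) = R p - A p s0 / A q s0 * R q"
        by (simp add: A'_def R_def left_diff_distrib sum_subtractf sum_distrib_left mult.assoc)
      then show ?thesis
        using c(2) that by simp
    qed
    then have "(\<Sum>s\<in>S. A p s * d s) = 0" if "p \<in> insert q P" for p
      using that s0 unfolding sum by auto
    moreover have "\<exists>s\<in>S. d s \<noteq> 0"
      using c(1) by (auto simp: d_def)
    ultimately show ?thesis
      by blast
  qed
qed

lemma homogeneous_system_unit:
  fixes A :: "'p \<Rightarrow> nat \<Rightarrow> real"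
  assumes "finite P" "card P < L"
  shows "\<exists>c. (\<Sum>s<L. (c s)\<^sup>2) = 1 \<and> (\<forall>p\<in>P. (\<Sum>s<L. A p s * c s) = 0)"
proof -
  obtain c where c: "\<exists>s\<in>{..<L}. c s \<noteq> 0" "\<forall>p\<in>P. (\<Sum>s<L. A p s * c s) = 0"
    using homogeneous_system[of "{..<L}" P A] assms by auto
  define N where "N = L2_set c {..<L}"
  have N: "0 < N"
    using c(1) unfolding N_def by (metis L2_set_eq_0_iff L2_set_nonneg finite_lessThan order_le_less)
  have "(\<Sum>s<L. (c s)\<^sup>2) = N\<^sup>2"
    by (simp add: N_def L2_set_def sum_nonneg)
  then have "(\<Sum>s<L. (c s / N)\<^sup>2) = 1"
    using N by (simp add: power_divide flip: sum_divide_distrib)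
  moreover have "(\<Sum>s<L. A p s * (c s / N)) = 0" if "p \<in> P" for p
    using c(2) that by (simp flip: sum_divide_distrib)
  ultimately show ?thesis
    by (intro exI[of _ "\<lambda>s. c s / N"]) blast
qed

text \<open>Each index has more coordinates than there are conditions coming from the earlier indices.\<close>

lemma biorthogonal_choice:
  fixes B :: "'i \<Rightarrow> nat \<Rightarrow> 'i \<Rightarrow> nat \<Rightarrow> real" and f :: "'i \<Rightarrow> nat"
  assumes f: "inj f" and L: "\<And>i. i \<in> I \<Longrightarrow> 2 * f i < L i"
  shows "\<exists>c. (\<forall>i\<in>I. (\<Sum>s<L i. (c i s)\<^sup>2) = 1) \<and>
    (\<forall>i\<in>I. \<forall>j\<in>I. i \<noteq> j \<longrightarrow> (\<Sum>s<L i. \<Sum>t<L j. c i s * c j t * B i s j t) = 0)"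
proof -
  \<comment> \<open>A pair of indices is handled when the later one is chosen. The coefficients of
    the earlier one are then fixed, so both orders of the pair give linear conditions on
    \<open>x\<close>: two for each earlier index.\<close>
  define Q where "Q c i x \<longleftrightarrow> (i \<in> I \<longrightarrow> (\<Sum>s<L i. (x s)\<^sup>2) = 1 \<and>
    (\<forall>j\<in>I. f j < f i \<longrightarrow> (\<Sum>s<L i. (\<Sum>t<L j. c j t * B i s j t) * x s) = 0 \<and>
      (\<Sum>s<L i. (\<Sum>t<L j. c j t * B j t i s) * x s) = 0))" for c i x
  have "\<exists>c. \<forall>i. Q c i (c i)"
  proof (rule dependent_wf_choice)
    show "wf (Wellfounded.measure f)"
      by simp
    show "Q c i x = Q d i x" if "\<And>j. (j, i) \<in> Wellfounded.measure f \<Longrightarrow> c j = d j" for c d i x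
      using that unfolding Q_def by simp
    fix i :: 'i and c :: "'i \<Rightarrow> nat \<Rightarrow> real"
    show "\<exists>x. Q c i x"
    proof (cases "i \<in> I")
      case False
      then show ?thesis by (simp add: Q_def)
    next
      case True
      let ?J = "{j. f j < f i}"
      \<comment> \<open>The Boolean tells entries with \<open>i\<close> as row from those with
        \<open>i\<close> as column. Injectivity of \<open>f\<close> leaves at most
        \<open>f i\<close> earlier indices, whence the requirement
        \<open>2 * f i < L i\<close>.\<close>
      define P where "P = ?J \<times> (UNIV :: bool set)"
      define A where "A p s = (if snd p then \<Sum>t<L (fst p). c (fst p) t * B i s (fst p) t
        else \<Sum>t<L (fst p). c (fst p) t * B (fst p) t i s)" for p s
      have fin: "finite ?J"
        using f by (rule finite_vimageI[of "{..<f i}", unfolded vimage_def lessThan_iff mem_Collect_eq, rotated]) simp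
      have "card ?J \<le> f i"
        using card_inj_on_le[of f ?J "{..<f i}"] f by (auto intro: inj_on_subset)
      then have P: "finite P" "card P < L i"
        using L[OF True] fin by (auto simp: P_def card_cartesian_product)
      obtain x where x: "(\<Sum>s<L i. (x s)\<^sup>2) = 1" "\<And>p. p \<in> P \<Longrightarrow> (\<Sum>s<L i. A p s * x s) = 0"
        using homogeneous_system_unit[OF P, of A] by auto
      have "(\<Sum>s<L i. (\<Sum>t<L j. c j t * B i s j t) * x s) = 0"
        "(\<Sum>s<L i. (\<Sum>t<L j. c j t * B j t i s) * x s) = 0" if "f j < f i" for j
        using x(2)[of "(j, True)"] x(2)[of "(j, False)"] that by (simp_all add: P_def A_def)
      then have "Q c i x"
        unfolding Q_def using x(1) by blast
      then show ?thesis
        by (rule exI[of "Q c i"])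
    qed
  qed
  then obtain c where c: "\<And>i. Q c i (c i)"
    by blast
  have "(\<Sum>s<L i. \<Sum>t<L j. c i s * c j t * B i s j t) = 0" if ij: "i \<in> I" "j \<in> I" "i \<noteq> j" for i j
  proof -
    have "f i < f j \<or> f j < f i"
      using f ij(3) by (metis injD nat_neq_iff)
    then show ?thesis
    proof
      assume "f j < f i"
      then have "(\<Sum>s<L i. (\<Sum>t<L j. c j t * B i s j t) * c i s) = 0"
        using c[of i] ij unfolding Q_def by blast
      then show ?thesis
        by (simp add: sum_distrib_left mult_ac)
    next
      assume "f i < f j"
      then have "(\<Sum>t<L j. (\<Sum>s<L i. c i s * B i s j t) * c j t) = 0"
        using c[of j] ij unfolding Q_def by blast
      then show ?thesis
        by (subst sum.swap) (simp add: sum_distrib_left mult_ac)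
    qed
  qed
  moreover have "(\<Sum>s<L i. (c i s)\<^sup>2) = 1" if "i \<in> I" for i
    using c[of i] that by (simp add: Q_def)
  ultimately show ?thesis
    by blast
qed

section \<open>Functionals on direct sums\<close>

definition functional :: "'a::real_vector nspace \<Rightarrow> ('a \<Rightarrow> real) \<Rightarrow> bool"
  where "functional X \<psi> \<longleftrightarrow> operator X \<lparr>vecs = UNIV, vnorm = abs\<rparr> \<psi>"

lemma functionalI:
  assumes "\<And>x y. x \<in> vecs X \<Longrightarrow> y \<in> vecs X \<Longrightarrow> \<psi> (x + y) = \<psi> x + \<psi> y"
    "\<And>c x. x \<in> vecs X \<Longrightarrow> \<psi> (c *\<^sub>R x) = c * \<psi> x"
    "\<And>x. x \<in> vecs X \<Longrightarrow> \<bar>\<psi> x\<bar> \<le> K * vnorm X x"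
  shows "functional X \<psi>"
  using assms unfolding functional_def operator_def by (auto intro: exI[of _ K])

lemma functional_comp:
  assumes "operator X Y T" "functional Y \<psi>" "normed_nspace Y"
  shows "functional X (\<lambda>x. \<psi> (T x))"
  using assms operator_comp unfolding functional_def by blast

lemma functionalD:
  assumes "functional X \<psi>"
  shows "x \<in> vecs X \<Longrightarrow> y \<in> vecs X \<Longrightarrow> \<psi> (x + y) = \<psi> x + \<psi> y"
    "x \<in> vecs X \<Longrightarrow> \<psi> (c *\<^sub>R x) = c * \<psi> x"
  using operatorD[OF assms[unfolded functional_def]] by auto

lemma functional_sum:
  assumes "functional X \<psi>" "normed_nspace X" "finite I" "\<And>i. i \<in> I \<Longrightarrow> x i \<in> vecs X"
  shows "\<psi> (\<Sum>i\<in>I. x i) = (\<Sum>i\<in>I. \<psi> (x i))" "(\<Sum>i\<in>I. x i) \<in> vecs X"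
  using operator_sum_arg[OF assms(1)[unfolded functional_def] assms(2-4)] by auto

lemma functional_zero: "functional X \<psi> \<Longrightarrow> normed_nspace X \<Longrightarrow> \<psi> 0 = 0"
  unfolding functional_def by (rule operator_zero_arg)

lemma functional_bound:
  assumes "functional X \<psi>" "normed_nspace X"
  obtains K where "0 \<le> K" "\<And>x. x \<in> vecs X \<Longrightarrow> \<bar>\<psi> x\<bar> \<le> K * vnorm X x"
proof -
  obtain K where K: "0 \<le> K" "bop K X \<lparr>vecs = UNIV, vnorm = abs\<rparr> \<psi>"
    using operator_bop_nonneg[OF assms[unfolded functional_def]] by blast
  show thesis
    using that[OF K(1)] bopD(4)[OF K(2)] by simp
qed

lemma sum_fun_apply: "(\<Sum>i\<in>I. f i) x = (\<Sum>i\<in>I. f i x)" for f :: "'i \<Rightarrow> 'a \<Rightarrow> 'b::comm_monoid_add"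
  by (induction I rule: infinite_finite_induct) (simp_all add: zero_fun_def)

section \<open>Almost disjoint supports\<close>

text \<open>The pairs \<open>(n, \<lfloor>x * real n\<rfloor>)\<close> follow a line of slope
  \<open>x\<close>. Lines of different slopes drift apart, so only finitely many pairs are shared.
  Enumerating \<open>M\<close> carries the pairs into \<open>M\<close>.\<close>

lemma almost_disjoint_family:
  fixes M :: "nat set"
  assumes M: "infinite M"
  obtains \<Lambda> :: "real \<Rightarrow> nat set"
  where "\<And>x. \<Lambda> x \<subseteq> M" "\<And>x. infinite (\<Lambda> x)" "\<And>x y. x \<noteq> y \<Longrightarrow> finite (\<Lambda> x \<inter> \<Lambda> y)"
proof -
  define code where "code x n = enumerate M (to_nat (n, \<lfloor>x * real n\<rfloor>))" for x :: real and n :: nat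
  have code_eq: "m = n \<and> \<lfloor>x * real m\<rfloor> = \<lfloor>y * real n\<rfloor>" if "code x m = code y n" for x y m n
  proof -
    have "to_nat (m, \<lfloor>x * real m\<rfloor>) = to_nat (n, \<lfloor>y * real n\<rfloor>)"
      using that inj_enumerate[OF M] unfolding code_def inj_def by blast
    then show ?thesis
      by auto
  qed
  define \<Lambda> where "\<Lambda> x = range (code x)" for x
  show thesis
  proof (rule that[of \<Lambda>])
    show "\<Lambda> x \<subseteq> M" for x
      using enumerate_in_set[OF M] by (auto simp: \<Lambda>_def code_def)
    have "inj (code x)" for x
      using code_eq[of x _ x] by (intro injI) blast
    then show "infinite (\<Lambda> x)" for x
      unfolding \<Lambda>_def by (rule range_inj_infinite)
    fix x y :: real assume xy: "x \<noteq> y"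
    have "\<Lambda> x \<inter> \<Lambda> y \<subseteq> code x ` {n. n \<le> nat \<lceil>1 / \<bar>x - y\<bar>\<rceil>}"
    proof
      fix z assume "z \<in> \<Lambda> x \<inter> \<Lambda> y"
      then obtain n where n: "z = code x n" "\<lfloor>x * real n\<rfloor> = \<lfloor>y * real n\<rfloor>"
        using code_eq unfolding \<Lambda>_def by blast
      have "\<bar>x * real n - y * real n\<bar> < 1"
        using n(2) by linarith
      then have "\<bar>x - y\<bar> * real n < 1"
        by (metis abs_mult abs_of_nat left_diff_distrib)
      then have "real n < 1 / \<bar>x - y\<bar>"
        using xy by (simp add: field_simps)
      then have "n \<le> nat \<lceil>1 / \<bar>x - y\<bar>\<rceil>"
        by linarith
      then show "z \<in> code x ` {n. n \<le> nat \<lceil>1 / \<bar>x - y\<bar>\<rceil>}"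
        using n(1) by blast
    qed
    then show "finite (\<Lambda> x \<inter> \<Lambda> y)"
      by (rule finite_subset) simp
  qed
qed

definition single :: "nat \<Rightarrow> 'a::zero \<Rightarrow> nat \<Rightarrow> 'a"
  where "single n x = (\<lambda>m. if m = n then x else 0)"

definition cut :: "nat set \<Rightarrow> (nat \<Rightarrow> 'a::zero) \<Rightarrow> nat \<Rightarrow> 'a"
  where "cut A F = (\<lambda>n. if n \<in> A then F n else 0)"

lemma cut_add: "cut A F + cut (- A) F = F" for F :: "nat \<Rightarrow> 'a::real_vector"
  by (auto simp: cut_def fun_eq_iff)

lemma bop_cut:
  assumes "1 \<le> r" "\<And>n. normed_nspace (Z n)"
  shows "bop 1 (direct_sum r Z) (direct_sum r Z) (cut A)"
  using direct_sum_map[OF assms(1), where M = A and \<sigma> = "\<lambda>n. n" and K = 1 and Z = Z and Z' = Z and T = "\<lambda>_ x. x",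
    OF _ _ bop_id assms(2)] unfolding cut_def[abs_def] by simp

lemma single_in_direct_sum:
  assumes "1 \<le> r" "\<And>n. normed_nspace (Z n)" "x \<in> vecs (Z n)"
  shows "single n x \<in> vecs (direct_sum r Z)"
  using bopD(1)[OF bop_single[OF assms(1), of Z n] assms(3)] assms(2) by (simp add: single_def)

lemma functional_cut_finite:
  assumes r: "1 \<le> r" and Z: "\<And>n. normed_nspace (Z n)" and \<psi>: "functional (direct_sum r Z) \<psi>"
    and F: "F \<in> vecs (direct_sum r Z)" and A: "finite A" and null: "\<And>n. \<psi> (single n (F n)) = 0"
  shows "\<psi> (cut A F) = 0" "\<psi> (cut (- A) F) = \<psi> F"
proof -
  note X = normed_direct_sum[OF r Z]
  have "cut A F = (\<Sum>n\<in>A. single n (F n))"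
    using A by (auto simp: fun_eq_iff sum_fun_apply cut_def single_def)
  moreover have "single n (F n) \<in> vecs (direct_sum r Z)" for n
    using F by (intro single_in_direct_sum r Z) (simp add: in_direct_sum)
  ultimately show 1: "\<psi> (cut A F) = 0"
    using functional_sum(1)[OF \<psi> X A] null by simp
  have "\<psi> (cut A F + cut (- A) F) = \<psi> (cut A F) + \<psi> (cut (- A) F)"
    using bopD(1)[OF bop_cut[OF r Z] F] by (intro functionalD(1)[OF \<psi>])
  then show "\<psi> (cut (- A) F) = \<psi> F"
    using 1 by (simp add: cut_add)
qed

text \<open>For \<open>r < \<infinity>\<close> this is density of the finitely supported sequences. For \<open>r = \<infinity>\<close>, sequences
  supported on almost disjoint sets can be modified at finitely many places, which a functional
  vanishing on single coordinates does not notice, so that their sum has the norm of a single one;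
  hence each functional is nonzero on only countably many members of an almost disjoint family.\<close>

lemma functionals_null_on_subset:
  fixes \<psi> :: "'i::countable \<Rightarrow> (nat \<Rightarrow> 'a::real_vector) \<Rightarrow> real"
  assumes r: "1 \<le> r" and Z: "\<And>n. normed_nspace (Z n)" and \<psi>: "\<And>i. functional (direct_sum r Z) (\<psi> i)"
    and M: "infinite M"
  obtains \<Lambda> where "\<Lambda> \<subseteq> M" "infinite \<Lambda>"
    "\<And>i F. F \<in> vecs (direct_sum r Z) \<Longrightarrow> (\<And>n. n \<notin> \<Lambda> \<Longrightarrow> F n = 0) \<Longrightarrow>
      (\<And>n. \<psi> i (single n (F n)) = 0) \<Longrightarrow> \<psi> i F = 0"
proof (cases "r = top")
  case False
  let ?X = "direct_sum r Z"
  interpret Z: normed_nspace "Z n" for n by fact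
  interpret X: normed_nspace ?X
    by (intro normed_direct_sum r Z)
  have "\<psi> i F = 0" if F: "F \<in> vecs ?X" and null: "\<And>n. \<psi> i (single n (F n)) = 0" for i F
  proof (rule ccontr)
    assume nz: "\<psi> i F \<noteq> 0"
    obtain K where K: "0 \<le> K" "\<And>x. x \<in> vecs ?X \<Longrightarrow> \<bar>\<psi> i x\<bar> \<le> K * vnorm ?X x"
      using functional_bound[OF \<psi> X.normed_nspace_axioms] by blast
    \<comment> \<open>Chosen so that \<open>K * e < \<bar>\<psi> i F\<bar>\<close>; the summand 1
      allows for \<open>K = 0\<close>.\<close>
    define e where "e = \<bar>\<psi> i F\<bar> / (2 * (K + 1))"
    have e: "0 < e"
      using nz K(1) by (simp add: e_def)
    obtain m where m: "ell_le r (\<lambda>n. if n < m then 0 else vnorm (Z n) (F n)) e"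
      using ell_le_tail[OF r False _ e] F by (auto simp: in_direct_sum)
    have "(\<lambda>n. if n < m then 0 else vnorm (Z n) (F n)) = (\<lambda>n. vnorm (Z n) (cut (- {..<m}) F n))"
      by (auto simp: cut_def fun_eq_iff)
    then have "vnorm ?X (cut (- {..<m}) F) \<le> e" "cut (- {..<m}) F \<in> vecs ?X"
      using direct_sumI[of "cut (- {..<m}) F" Z r e] m F by (auto simp: cut_def in_direct_sum)
    then have "\<bar>\<psi> i (cut (- {..<m}) F)\<bar> \<le> K * e"
      using K by (meson mult_left_mono order_trans)
    then have "\<bar>\<psi> i F\<bar> \<le> K * e"
      using functional_cut_finite(2)[OF r Z \<psi> F _ null, of "{..<m}"] by simp
    also have "\<dots> < \<bar>\<psi> i F\<bar>"
      using nz K(1) by (simp add: e_def field_simps add_nonneg_pos)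
    finally show False by simp
  qed
  with subset_refl M show thesis
    by (rule that)
next
  case True
  let ?X = "direct_sum r Z"
  interpret Z: normed_nspace "Z n" for n by fact
  interpret X: normed_nspace ?X
    by (intro normed_direct_sum r Z)
  obtain \<Lambda> :: "real \<Rightarrow> nat set" where \<Lambda>: "\<And>x. \<Lambda> x \<subseteq> M" "\<And>x. infinite (\<Lambda> x)"
      "\<And>x y. x \<noteq> y \<Longrightarrow> finite (\<Lambda> x \<inter> \<Lambda> y)"
    using almost_disjoint_family[OF M] by blast
  \<comment> \<open>Scaling turns any nonzero value into one that is at least
    \<open>1 / real (Suc q)\<close>, for some \<open>q\<close>, on a vector of norm at most 1. Thus
    countably many classes, indexed by \<open>i\<close> and \<open>q\<close>, cover all exceptional
    reals.\<close>
  define bad where "bad i q x F \<longleftrightarrow> F \<in> vecs ?X \<and> (\<forall>n. n \<notin> \<Lambda> x \<longrightarrow> F n = 0) \<and>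
    (\<forall>n. \<psi> i (single n (F n)) = 0) \<and> vnorm ?X F \<le> 1 \<and> 1 / real (Suc q) \<le> \<psi> i F" for i q x F
  have fin: "finite {x. \<exists>F. bad i q x F}" for i q
  proof -
    obtain K where K: "0 \<le> K" "\<And>x. x \<in> vecs ?X \<Longrightarrow> \<bar>\<psi> i x\<bar> \<le> K * vnorm ?X x"
      using functional_bound[OF \<psi> X.normed_nspace_axioms] by blast
    have card: "card Y \<le> nat \<lceil>K * real (Suc q)\<rceil>"
      if Y: "Y \<subseteq> {x. \<exists>F. bad i q x F}" "finite Y" for Y
    proof -
      have "\<forall>x\<in>Y. \<exists>F. bad i q x F"
        using Y(1) by blast
      from bchoice[OF this] obtain F where F: "\<And>x. x \<in> Y \<Longrightarrow> bad i q x (F x)"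
        by blast
      \<comment> \<open>The pairwise overlaps of the chosen sets. Off \<open>D\<close> the vectors
        have disjoint supports, so in the supremum norm their sum has norm at most 1, while the
        values of the functional add up. This bounds the number of vectors by
        \<open>K * real (Suc q)\<close>.\<close>
      define D where "D = (\<Union>x\<in>Y. \<Union>y\<in>Y - {x}. \<Lambda> x \<inter> \<Lambda> y)"
      have "finite D"
        unfolding D_def using Y(2) \<Lambda>(3) by (intro finite_UN_I) auto
      define G where "G x = cut (- D) (F x)" for x
      have GX: "G x \<in> vecs ?X" if "x \<in> Y" for x
        using F[OF that] bopD(1)[OF bop_cut[OF r Z]] by (auto simp: G_def bad_def)
      have \<psi>G: "1 / real (Suc q) \<le> \<psi> i (G x)" if "x \<in> Y" for x
        using F[OF that] functional_cut_finite(2)[OF r Z \<psi> _ \<open>finite D\<close>, of "F x" i]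
        by (auto simp: G_def bad_def)
      have "vnorm (Z n) ((\<Sum>x\<in>Y. G x) n) \<le> 1" for n
      proof (cases "\<exists>x\<in>Y. G x n \<noteq> 0")
        case False
        then show ?thesis
          by (simp add: sum_fun_apply)
      next
        case True
        then obtain x where x: "x \<in> Y" "G x n \<noteq> 0"
          by blast
        then have nD: "n \<notin> D" "n \<in> \<Lambda> x"
          using F[OF x(1)] by (auto simp: G_def cut_def bad_def split: if_splits)
        have "G y n = 0" if "y \<in> Y - {x}" for y
        proof -
          have "n \<notin> \<Lambda> y"
            using nD that x(1) by (auto simp: D_def)
          then show ?thesis
            using F[of y] that by (auto simp: G_def cut_def bad_def)
        qed
        then have "(\<Sum>x\<in>Y. G x) n = G x n"
          using Y(2) x(1) by (simp add: sum_fun_apply sum.remove[of Y x])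
        moreover have "vnorm (Z n) (F x n) \<le> 1"
          using F[OF x(1)] bopD(4)[OF bop_component[OF r], of "F x" Z n] unfolding bad_def by force
        ultimately show ?thesis
          using nD by (simp add: G_def cut_def)
      qed
      moreover have "(\<Sum>x\<in>Y. G x) n \<in> vecs (Z n)" for n
        using GX functional_sum(2)[OF \<psi> X.normed_nspace_axioms Y(2), of G] by (auto simp: in_direct_sum)
      ultimately have G: "(\<Sum>x\<in>Y. G x) \<in> vecs ?X" "vnorm ?X (\<Sum>x\<in>Y. G x) \<le> 1"
        using direct_sumI[of "\<Sum>x\<in>Y. G x" Z r 1] Z.nonneg by (auto simp: True ell_le_top)
      have "real (card Y) * (1 / real (Suc q)) \<le> (\<Sum>x\<in>Y. \<psi> i (G x))"
        using sum_mono[OF \<psi>G, of Y] by simp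
      also have "\<dots> = \<psi> i (\<Sum>x\<in>Y. G x)"
        using functional_sum(1)[OF \<psi> X.normed_nspace_axioms Y(2) GX] by simp
      also have "\<dots> \<le> K * 1"
        using K(2)[OF G(1)] mult_left_mono[OF G(2) K(1)] by linarith
      finally have "real (card Y) \<le> K * real (Suc q)"
        by (simp add: field_simps)
      then show ?thesis
        by linarith
    qed
    then show ?thesis
      using finite_if_finite_subsets_card_bdd by blast
  qed
  have "countable (\<Union>i. \<Union>q. {x. \<exists>F. bad i q x F})"
    by (intro countable_UN countableI_type countable_finite fin)
  then have "(\<Union>i. \<Union>q. {x. \<exists>F. bad i q x F}) \<noteq> UNIV"
    using uncountable_UNIV_real by auto
  then obtain x where x: "\<And>i q F. \<not> bad i q x F"
    by blast
  have "\<psi> i F = 0" if F: "F \<in> vecs ?X" "\<And>n. n \<notin> \<Lambda> x \<Longrightarrow> F n = 0" "\<And>n. \<psi> i (single n (F n)) = 0" for i F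
  proof (rule ccontr)
    assume nz: "\<psi> i F \<noteq> 0"
    define c where "c = sgn (\<psi> i F) / (vnorm ?X F + 1)"
    have nn: "0 < vnorm ?X F + 1"
      using X.nonneg[OF F(1)] by simp
    have c: "\<bar>c\<bar> * vnorm ?X F \<le> 1" "0 < c * \<psi> i F"
      using nz nn by (auto simp: c_def field_simps abs_sgn_eq sgn_if)
    obtain q where q: "1 / real (Suc q) < c * \<psi> i F"
      using c(2) nat_approx_posE by blast
    have "single n ((c *\<^sub>R F) n) = c *\<^sub>R single n (F n)" for n
      by (auto simp: single_def scaleR_fun_def)
    moreover have "single n (F n) \<in> vecs ?X" for n
      using F(1) by (intro single_in_direct_sum r Z) (simp add: in_direct_sum)
    moreover have "(c *\<^sub>R F) n = c *\<^sub>R F n" for n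
      by (simp add: scaleR_fun_def)
    ultimately have "bad i q x (c *\<^sub>R F)"
      using F c q X.scale[OF F(1)] functionalD(2)[OF \<psi>] unfolding bad_def by simp
    with x show False by blast
  qed
  with \<Lambda>(1,2) show thesis
    by (rule that)
qed

section \<open>Block vectors\<close>

text \<open>Coordinate vectors of the stretched tree: all nodes with trace \<open>xs\<close> at
  position \<open>s\<close> share the value 1, in agreement with \<open>stretch\<close>.\<close>

definition node_vec :: "(nat \<Rightarrow> nat) \<Rightarrow> (nat \<Rightarrow> nat) \<Rightarrow> nat \<Rightarrow> bool list \<Rightarrow> nat \<Rightarrow> nat \<Rightarrow> bool list \<Rightarrow> real"
  where "node_vec L N k xs s = single (N k) (\<lambda>zs. if trace_bits (L k) zs = xs \<and> length zs mod L k = s then 1 else 0)"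

text \<open>The \<open>k\<close>-th tree has depth \<open>2 * k\<close>, leaving room for a
  monochromatic tree of depth \<open>k\<close>. Its \<open>2 * k + 1\<close> levels become
  \<open>(2 * k + 1) * L k\<close> levels, which must fit into the summand \<open>N k\<close>;
  distinct trees use distinct summands.\<close>

locale block_sizes =
  fixes r :: ennreal and L N :: "nat \<Rightarrow> nat"
  assumes r: "1 \<le> r" and L: "\<And>k. 0 < L k" and inj_N: "inj N" and N: "\<And>k. (2 * k + 1) * L k \<le> N k"
begin

abbreviation X :: "(nat \<Rightarrow> bool list \<Rightarrow> real) nspace"
  where "X \<equiv> direct_sum r tree"

lemma X: "normed_nspace X"
  using r normed_tree by (rule normed_direct_sum)

sublocale X: normed_nspace X
  by (rule X)

lemma trace_long: "N k < length zs \<Longrightarrow> 2 * k < length (trace_bits (L k) zs)"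
proof -
  assume "N k < length zs"
  then have "(2 * k + 1) * L k \<le> length zs"
    using N[of k] by simp
  then have "2 * k + 1 \<le> length zs div L k"
    using L[of k] by (simp add: less_eq_div_iff_mult_less_eq)
  then show ?thesis
    by (simp add: trace_bits_def)
qed

lemma node_vec_in: "length xs \<le> 2 * k \<Longrightarrow> node_vec L N k xs s \<in> vecs X"
  unfolding node_vec_def using trace_long[of k]
  by (intro single_in_direct_sum r normed_tree) (fastforce simp: in_tree)

end

text \<open>The weights vanish beyond depth \<open>2 * k\<close>, which makes \<open>stretch\<close>
  land in \<open>tree (N k)\<close>: nodes below depth \<open>N k\<close> have longer
  traces.\<close>

locale block_system = block_sizes +
  fixes c :: "nat \<Rightarrow> bool list \<Rightarrow> nat \<Rightarrow> real"
  assumes c_unit: "\<And>k xs. length xs \<le> 2 * k \<Longrightarrow> (\<Sum>s<L k. (c k xs s)\<^sup>2) = 1"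
    and c_zero: "\<And>k xs s. 2 * k < length xs \<Longrightarrow> c k xs s = 0"
begin

definition block :: "nat \<Rightarrow> bool list \<Rightarrow> nat \<Rightarrow> bool list \<Rightarrow> real"
  where "block k xs = (\<Sum>s<L k. c k xs s *\<^sub>R node_vec L N k xs s)"

text \<open>The functional biorthogonal to \<open>block k xs\<close>: the same unit vector, read
  along the chain of \<open>xs\<close>. The matrix of \<open>T\<close> with respect to the blocks
  has the entries \<open>coblock k xs (T (block l ys))\<close>.\<close>

definition coblock :: "nat \<Rightarrow> bool list \<Rightarrow> (nat \<Rightarrow> bool list \<Rightarrow> real) \<Rightarrow> real"
  where "coblock k xs F = sample (L k) (c k) (F (N k)) xs"

lemma c_le: "(\<Sum>s<L k. (c k xs s)\<^sup>2) \<le> 1"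
  using c_unit[of xs k] c_zero[of k xs] by (cases "length xs \<le> 2 * k") simp_all

lemma block_in: "length xs \<le> 2 * k \<Longrightarrow> block k xs \<in> vecs X"
  unfolding block_def by (intro subspace_sum X.subspace X.scaled node_vec_in)

lemma coblock_eq: "coblock k xs F = (\<Sum>s<L k. c k xs s * F (N k) (chain_node (L k) xs s))"
  by (simp add: coblock_def sample_def)

lemma functional_coblock: "functional X (coblock k xs)"
proof (rule functionalI[where K = 1])
  fix F assume F: "F \<in> vecs X"
  then have FN: "F (N k) \<in> vecs (tree (N k))"
    by (simp add: in_direct_sum)
  have "\<bar>coblock k xs F\<bar> \<le> branch (sample (L k) (c k) (F (N k))) xs"
    unfolding coblock_def by (rule abs_le_branch)
  also have "\<dots> \<le> branch (F (N k)) (chain_node (L k) xs (L k - 1))"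
    by (intro branch_sample L c_le)
  also have "\<dots> \<le> tree_norm (F (N k))"
    using FN by (rule tree_branch_le)
  also have "\<dots> \<le> 1 * vnorm X F"
    using bopD(4)[OF bop_component[OF r] F] by simp
  finally show "\<bar>coblock k xs F\<bar> \<le> 1 * vnorm X F" .
qed (simp_all add: coblock_eq scaleR_fun_def sum.distrib sum_distrib_left algebra_simps)

lemma coblock_operator_block:
  assumes T: "operator X X T" and ys: "length ys \<le> 2 * l"
  shows "coblock k xs (T (block l ys)) =
    (\<Sum>s<L k. \<Sum>t<L l. c k xs s * c l ys t * T (node_vec L N l ys t) (N k) (chain_node (L k) xs s))"
proof -
  have "T (block l ys) = (\<Sum>t<L l. T (c l ys t *\<^sub>R node_vec L N l ys t))"
    unfolding block_def using node_vec_in[OF ys] by (intro operator_sum_arg[OF T X]) auto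
  also have "\<dots> = (\<Sum>t<L l. c l ys t *\<^sub>R T (node_vec L N l ys t))"
    using operatorD(3)[OF T node_vec_in[OF ys]] by simp
  finally show ?thesis
    by (simp add: coblock_eq sum_fun_apply scaleR_fun_def sum_distrib_left mult.assoc)
qed

lemma coblock_block:
  assumes "length xs \<le> 2 * k" "length ys \<le> 2 * l"
  shows "coblock k xs (block l ys) = (if (k, xs) = (l, ys) then 1 else 0)"
proof -
  have "node_vec L N l ys t (N k) (chain_node (L k) xs s) = (if (k, xs) = (l, ys) \<and> s = t then 1 else 0)"
    if "s < L k" for s t
    using that inj_N by (auto simp: node_vec_def single_def trace_chain length_chain inj_eq)
  then have "coblock k xs (block l ys) =
    (\<Sum>s<L k. \<Sum>t<L l. c k xs s * c l ys t * (if (k, xs) = (l, ys) \<and> s = t then 1 else 0))"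
    using coblock_operator_block[OF operator_id assms(2)] by simp
  also have "\<dots> = (if (k, xs) = (l, ys) then 1 else 0)"
  proof (cases "(k, xs) = (l, ys)")
    case True
    then have "(\<Sum>s<L k. \<Sum>t<L l. c k xs s * c l ys t * (if (k, xs) = (l, ys) \<and> s = t then 1 else 0))
      = (\<Sum>s<L k. \<Sum>t<L k. if s = t then c k xs s * c k xs t else 0)"
      by (intro sum.cong) auto
    also have "\<dots> = (\<Sum>s<L k. (c k xs s)\<^sup>2)"
      by (simp add: power2_eq_square)
    finally show ?thesis
      using True c_unit[OF assms(1)] by simp
  next
    case False
    then have "\<not> ((k, xs) = (l, ys) \<and> s = t)" for s t :: nat
      by auto
    with False show ?thesis
      by (simp only: if_False mult_zero_right sum.neutral_const)
  qed
  finally show ?thesis .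
qed

text \<open>The bridge between two descriptions of the embedding: norms are estimated through
  \<open>branch_push\<close> and \<open>branch_stretch\<close>, whereas operators are evaluated on
  combinations of blocks, where their matrix is known.\<close>

lemma single_stretch_push:
  assumes \<phi>: "tree_emb k \<phi>" "\<And>xs. length xs \<le> k \<Longrightarrow> length (\<phi> xs) \<le> 2 * k"
  shows "single (N k) (stretch (L k) (c k) (push k \<phi> a)) = (\<Sum>xs\<in>{xs. length xs \<le> k}. a xs *\<^sub>R block k (\<phi> xs))"
proof (intro ext)
  fix n :: nat and zs :: "bool list"
  let ?D = "{xs :: bool list. length xs \<le> k}" and ?c = "\<lambda>xs. c k xs (length zs mod L k)"
  have blk: "block k ys n zs = (if n = N k \<and> trace_bits (L k) zs = ys then ?c ys else 0)" for ys
  proof -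
    have "block k ys n zs = (\<Sum>s<L k. if s = length zs mod L k then (if n = N k \<and> trace_bits (L k) zs = ys then c k ys s else 0) else 0)"
      unfolding block_def sum_fun_apply by (intro sum.cong) (auto simp: scaleR_fun_def node_vec_def single_def)
    also have "\<dots> = (if n = N k \<and> trace_bits (L k) zs = ys then ?c ys else 0)"
      using L[of k] by (subst sum.delta) auto
    finally show ?thesis .
  qed
  have "(\<Sum>xs\<in>?D. a xs *\<^sub>R block k (\<phi> xs)) n zs = (\<Sum>xs\<in>?D. a xs * (if n = N k \<and> trace_bits (L k) zs = \<phi> xs then ?c (\<phi> xs) else 0))"
    by (simp add: sum_fun_apply scaleR_fun_def blk)
  also have "\<dots> = single (N k) (stretch (L k) (c k) (push k \<phi> a)) n zs"
  proof (cases "n = N k \<and> trace_bits (L k) zs \<in> \<phi> ` ?D")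
    case True
    then obtain ys where ys: "ys \<in> ?D" "trace_bits (L k) zs = \<phi> ys"
      by blast
    have "(\<Sum>xs\<in>?D. a xs * (if n = N k \<and> trace_bits (L k) zs = \<phi> xs then ?c (\<phi> xs) else 0))
      = (\<Sum>xs\<in>?D. if xs = ys then a ys * ?c (\<phi> ys) else 0)"
      using True ys inj_onD[OF tree_emb_inj[OF \<phi>(1)]] by (intro sum.cong) auto
    also have "\<dots> = a ys * ?c (\<phi> ys)"
      using ys(1) finite_bool_lists by (subst sum.delta) auto
    finally show ?thesis
      using True ys push_image[OF \<phi>(1)] by (simp add: single_def stretch_def)
  next
    case False
    then have "push k \<phi> a (trace_bits (L k) zs) = 0 \<or> n \<noteq> N k"
      by (auto simp: push_def)
    moreover have "(\<Sum>xs\<in>?D. a xs * (if n = N k \<and> trace_bits (L k) zs = \<phi> xs then ?c (\<phi> xs) else 0)) = 0"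
      using False by (intro sum.neutral) auto
    ultimately show ?thesis
      by (auto simp: single_def stretch_def)
  qed
  finally show "single (N k) (stretch (L k) (c k) (push k \<phi> a)) n zs = (\<Sum>xs\<in>?D. a xs *\<^sub>R block k (\<phi> xs)) n zs" ..
qed

lemma bop_stretch_push:
  assumes \<phi>: "tree_emb k \<phi>" "\<And>xs. length xs \<le> k \<Longrightarrow> length (\<phi> xs) \<le> 2 * k"
  shows "bop 1 (tree n) (tree (N k)) (\<lambda>a. stretch (L k) (c k) (push k \<phi> a))"
proof (rule bop_treeI)
  fix a xs assume a: "a \<in> vecs (tree n)"
  have "stretch (L k) (c k) (push k \<phi> a) zs = 0" if "N k < length zs" for zs
    using trace_long[OF that] by (simp add: stretch_def c_zero)
  then show "stretch (L k) (c k) (push k \<phi> a) \<in> vecs (tree (N k))"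
    by (simp add: in_tree)
  show "branch (stretch (L k) (c k) (push k \<phi> a)) xs \<le> 1 * tree_norm a"
    using branch_stretch[where c = "c k" and L = "L k", OF L c_le] branch_push[OF \<phi>(1) tree_branch_le[OF a]]
    by (auto intro: order_trans)
qed (simp_all add: stretch_def push_def scaleR_fun_def algebra_simps)

text \<open>Division by diagonal entries that are at least 1 / 2 is the origin of the constant 2;
  pulling back, sampling and restricting to depth \<open>n\<close> do not increase the norm.\<close>

lemma bop_sample_pull:
  assumes \<phi>: "tree_emb k \<phi>" and n: "n \<le> k" and d: "\<And>xs. length xs \<le> n \<Longrightarrow> 1 / 2 \<le> d xs"
  shows "bop 2 (tree (N k)) (tree n)
    (\<lambda>f xs. if length xs \<le> n then sample (L k) (c k) f (\<phi> xs) / d xs else 0)"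
proof (rule bop_treeI)
  fix f xs assume f: "f \<in> vecs (tree (N k))"
  let ?g = "\<lambda>xs. if length xs \<le> n then sample (L k) (c k) f (\<phi> xs) / d xs else 0"
  have "\<bar>?g ys\<bar> \<le> \<bar>2 * pull k \<phi> (sample (L k) (c k) f) ys\<bar>" for ys
  proof (cases "length ys \<le> n")
    case True
    then have "\<bar>?g ys\<bar> = \<bar>sample (L k) (c k) f (\<phi> ys)\<bar> / d ys"
      using d[OF True] by simp
    also have "\<dots> \<le> \<bar>sample (L k) (c k) f (\<phi> ys)\<bar> / (1 / 2)"
      using d[OF True] by (intro divide_left_mono) auto
    finally show ?thesis
      using True n by (simp add: pull_def abs_mult)
  qed simp
  then have "branch ?g xs \<le> 2 * branch (pull k \<phi> (sample (L k) (c k) f)) xs"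
    using branch_mono[of ?g "\<lambda>ys. 2 * pull k \<phi> (sample (L k) (c k) f) ys" xs] by (simp add: branch_scale)
  also have "branch (pull k \<phi> (sample (L k) (c k) f)) xs \<le> branch (sample (L k) (c k) f) (\<phi> (take k xs))"
    by (rule branch_pull[OF \<phi>])
  also have "\<dots> \<le> branch f (chain_node (L k) (\<phi> (take k xs)) (L k - 1))"
    by (rule branch_sample[OF L c_le])
  also have "\<dots> \<le> tree_norm f"
    using f by (rule tree_branch_le)
  finally show "branch ?g xs \<le> 2 * tree_norm f"
    by simp
  show "?g \<in> vecs (tree n)"
    by (simp add: in_tree)
qed (simp_all add: sample_def scaleR_fun_def sum.distrib sum_distrib_left add_divide_distrib algebra_simps)

text \<open>\<open>R\<close> places summand \<open>n\<close> as a combination of blocks into summand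
  \<open>N (e n)\<close>; \<open>S\<close> reads off block coefficients and divides by the diagonal.
  For finitely many summands the matrix conditions give the identity. For infinitely many they need
  not suffice if r = \<infinity>; so the target summands are confined to \<open>\<Lambda>\<close>,
  where a functional that vanishes on every single coordinate of a vector vanishes on the
  vector.\<close>

lemma diagonal_factorization:
  assumes H: "operator X X H" and M: "infinite M"
    and off_diag: "\<And>k xs l ys. length xs \<le> 2 * k \<Longrightarrow> length ys \<le> 2 * l \<Longrightarrow> (k, xs) \<noteq> (l, ys) \<Longrightarrow>
      coblock k xs (H (block l ys)) = 0"
    and diag: "\<And>k. k \<in> M \<Longrightarrow> \<exists>\<phi>. tree_emb k \<phi> \<and>
      (\<forall>xs. length xs \<le> k \<longrightarrow> length (\<phi> xs) \<le> 2 * k \<and> 1 / 2 \<le> coblock k (\<phi> xs) (H (block k (\<phi> xs))))"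
  shows "\<exists>R S. bop 1 X X R \<and> bop 2 X X S \<and> (\<forall>F\<in>vecs X. S (H (R F)) = F)"
proof -
  from bchoice[OF ballI[OF diag]] obtain \<phi> where
    *: "\<forall>k\<in>M. tree_emb k (\<phi> k) \<and> (\<forall>xs. length xs \<le> k \<longrightarrow> length (\<phi> k xs) \<le> 2 * k \<and>
      1 / 2 \<le> coblock k (\<phi> k xs) (H (block k (\<phi> k xs))))" ..
  have \<phi>: "tree_emb k (\<phi> k)" "length xs \<le> k \<Longrightarrow> length (\<phi> k xs) \<le> 2 * k"
      "length xs \<le> k \<Longrightarrow> 1 / 2 \<le> coblock k (\<phi> k xs) (H (block k (\<phi> k xs)))" if "k \<in> M" for k xs
    using bspec[OF * that] by simp_all
  define \<psi> where "\<psi> i F = coblock (fst i) (snd i) (H F)" for i F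
  have \<psi>: "functional X (\<psi> i)" for i
    unfolding \<psi>_def using H functional_coblock X by (rule functional_comp)
  have NM: "infinite (N ` M)"
    using M inj_N by (metis finite_imageD inj_on_subset subset_UNIV)
  obtain \<Lambda> where \<Lambda>: "\<Lambda> \<subseteq> N ` M" "infinite \<Lambda>"
    and null: "\<And>i F. F \<in> vecs X \<Longrightarrow> (\<And>n. n \<notin> \<Lambda> \<Longrightarrow> F n = 0) \<Longrightarrow>
      (\<And>n. \<psi> i (single n (F n)) = 0) \<Longrightarrow> \<psi> i F = 0"
  proof (rule functionals_null_on_subset[where \<psi> = \<psi>, OF r normed_tree \<psi> NM])
    fix \<Lambda>
    assume "\<Lambda> \<subseteq> N ` M" "infinite \<Lambda>" and null: "\<And>i F. F \<in> vecs X \<Longrightarrow> (\<And>n. n \<notin> \<Lambda> \<Longrightarrow> F n = 0) \<Longrightarrow>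
      (\<And>n. \<psi> i (single n (F n)) = 0) \<Longrightarrow> \<psi> i F = 0"
    then show thesis
      by (intro that[of \<Lambda>]) (assumption+, rule null)
  qed
  define \<Lambda>' where "\<Lambda>' = {k \<in> M. N k \<in> \<Lambda>}"
  have "N ` \<Lambda>' = \<Lambda>"
    using \<Lambda>(1) by (auto simp: \<Lambda>'_def)
  then have inf: "infinite \<Lambda>'"
    using \<Lambda>(2) by auto
  \<comment> \<open>\<open>e n\<close> is the tree used for summand \<open>n\<close>. As
    \<open>n \<le> e n\<close>, a monochromatic tree of depth \<open>e n\<close> has room for depth
    \<open>n\<close>.\<close>
  define e where "e = enumerate \<Lambda>'"
  have eM: "e n \<in> M" "N (e n) \<in> \<Lambda>" for n
    using enumerate_in_set[OF inf, of n] by (auto simp: e_def \<Lambda>'_def)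
  have e_ge: "n \<le> e n" for n
    unfolding e_def using inf by (rule le_enumerate)
  have inj_Ne: "inj (\<lambda>n. N (e n))"
    using inj_compose[OF inj_N inj_enumerate[OF inf]] by (simp add: e_def comp_def)
  have "range (\<lambda>n. N (e n)) = N ` range e"
    by auto
  then have range_Ne: "range (\<lambda>n. N (e n)) = \<Lambda>"
    using \<open>N ` \<Lambda>' = \<Lambda>\<close> range_enumerate[OF inf] by (simp add: e_def)
  define idx where "idx m = inv (\<lambda>n. N (e n)) m" for m
  have idx: "idx (N (e n)) = n" for n
    unfolding idx_def by (rule inv_f_f[OF inj_Ne])
  define d where "d n xs = coblock (e n) (\<phi> (e n) xs) (H (block (e n) (\<phi> (e n) xs)))" for n xs
  define P where "P n a = stretch (L (e n)) (c (e n)) (push (e n) (\<phi> (e n)) a)" for n a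
  define R where "R F = (\<lambda>m. if m \<in> \<Lambda> then P (idx m) (F (idx m)) else 0)" for F
  define S where "S F = (\<lambda>n xs. if length xs \<le> n then
    sample (L (e n)) (c (e n)) (F (N (e n))) (\<phi> (e n) xs) / d n xs else 0)" for F
  have R: "bop 1 X X R"
    unfolding R_def
  proof (rule direct_sum_map[OF r _ _ _ normed_tree, where T = "\<lambda>m. P (idx m)"])
    show "inj_on idx \<Lambda>"
      unfolding range_Ne[symmetric] by (auto simp: inj_on_def idx)
    fix m assume "m \<in> \<Lambda>"
    then obtain n where m: "m = N (e n)"
      unfolding range_Ne[symmetric] by blast
    show "bop 1 (tree (idx m)) (tree m) (P (idx m))"
      unfolding m idx P_def[abs_def] by (intro bop_stretch_push \<phi> eM)
  qed simp
  have "bop 2 X X (\<lambda>F n. if n \<in> UNIV then (\<lambda>f xs. if length xs \<le> n then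
    sample (L (e n)) (c (e n)) f (\<phi> (e n) xs) / d n xs else 0) (F (N (e n))) else 0)"
  proof (rule direct_sum_map[OF r _ _ _ normed_tree])
    show "bop 2 (tree (N (e n))) (tree n) (\<lambda>f xs. if length xs \<le> n then
        sample (L (e n)) (c (e n)) f (\<phi> (e n) xs) / d n xs else 0)" for n
      using e_ge[of n] \<phi>(3)[OF eM(1)] unfolding d_def
      by (intro bop_sample_pull \<phi> eM) auto
  qed (use inj_Ne in auto)
  then have S: "bop 2 X X S"
    unfolding S_def by simp
  have "S (H (R F)) = F" if F: "F \<in> vecs X" for F
  proof (intro ext)
    fix n xs
    show "S (H (R F)) n xs = F n xs"
    proof (cases "length xs \<le> n")
      case False
      then show ?thesis
        using F by (auto simp: S_def in_direct_sum in_tree)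
    next
      case True
      define k where "k = e n"
      define \<alpha> where "\<alpha> = \<phi> k xs"
      have kM: "k \<in> M" and xs: "length xs \<le> k"
        using eM e_ge[of n] True by (auto simp: k_def)
      have \<alpha>: "length \<alpha> \<le> 2 * k"
        unfolding \<alpha>_def using \<phi>(2)[OF kM xs] .
      define G where "G = R F"
      have GX: "G \<in> vecs X"
        unfolding G_def using bopD(1)[OF R F] .
      have G: "single (N (e m)) (G (N (e m))) = (\<Sum>ys\<in>{ys. length ys \<le> e m}. F m ys *\<^sub>R block (e m) (\<phi> (e m) ys))" for m
        using eM(2) single_stretch_push[OF \<phi>(1,2)[OF eM(1)]] by (simp add: G_def R_def P_def idx)
      have \<psi>G: "\<psi> (k, \<alpha>) (single (N (e m)) (G (N (e m)))) = (if m = n then F n xs * d n xs else 0)" for m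
      proof -
        let ?D = "{ys :: bool list. length ys \<le> e m}"
        have bl: "block (e m) (\<phi> (e m) ys) \<in> vecs X" if "ys \<in> ?D" for ys
          using that \<phi>(2)[OF eM(1)] by (intro block_in) auto
        have "\<psi> (k, \<alpha>) (single (N (e m)) (G (N (e m)))) = (\<Sum>ys\<in>?D. \<psi> (k, \<alpha>) (F m ys *\<^sub>R block (e m) (\<phi> (e m) ys)))"
          unfolding G using bl by (intro functional_sum(1)[OF \<psi> X finite_bool_lists]) simp
        also have "\<dots> = (\<Sum>ys\<in>?D. F m ys * \<psi> (k, \<alpha>) (block (e m) (\<phi> (e m) ys)))"
          using bl functionalD(2)[OF \<psi>] by (intro sum.cong) auto
        also have "\<dots> = (\<Sum>ys\<in>?D. if ys = xs then (if m = n then F n xs * d n xs else 0) else 0)"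
        proof (intro sum.cong refl)
          fix ys assume ys: "ys \<in> ?D"
          show "F m ys * \<psi> (k, \<alpha>) (block (e m) (\<phi> (e m) ys)) =
            (if ys = xs then (if m = n then F n xs * d n xs else 0) else 0)"
          proof (cases "m = n \<and> ys = xs")
            case True
            then show ?thesis
              by (simp add: \<psi>_def d_def k_def \<alpha>_def)
          next
            case False
            have "(k, \<alpha>) \<noteq> (e m, \<phi> (e m) ys)"
            proof
              assume eq: "(k, \<alpha>) = (e m, \<phi> (e m) ys)"
              then have "e m = e n"
                by (simp add: k_def)
              then have "m = n"
                using injD[OF inj_Ne, of m n] by simp
              moreover have "\<phi> k xs = \<phi> k ys"
                using eq by (auto simp: \<alpha>_def)
              then have "xs = ys"
                using inj_onD[OF tree_emb_inj[OF \<phi>(1)[OF kM]]] xs ys eq by auto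
              ultimately show False
                using False by simp
            qed
            then have "\<psi> (k, \<alpha>) (block (e m) (\<phi> (e m) ys)) = 0"
              unfolding \<psi>_def using \<alpha> ys \<phi>(2)[OF eM(1)] by (simp add: off_diag)
            then show ?thesis
              using False by auto
          qed
        qed
        also have "\<dots> = (if m = n then F n xs * d n xs else 0)"
          using xs finite_bool_lists[of "e m"] by (subst sum.delta) (auto simp: k_def)
        finally show ?thesis .
      qed
      have cutX: "cut A G \<in> vecs X" for A
        using bopD(1)[OF bop_cut[OF r normed_tree] GX] .
      \<comment> \<open>The contribution of all other summands. Each alone gives 0 by the
        off-diagonal conditions, and the support lies in \<open>\<Lambda>\<close>, so the infinite
        remainder gives 0 as well.\<close>
      have "\<psi> (k, \<alpha>) (cut (- {N k}) G) = 0"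
      proof (rule null[OF cutX])
        show "cut (- {N k}) G m = 0" if "m \<notin> \<Lambda>" for m
          using that by (auto simp: cut_def G_def R_def)
        show "\<psi> (k, \<alpha>) (single m (cut (- {N k}) G m)) = 0" for m
        proof (cases "m \<in> \<Lambda> \<and> m \<noteq> N k")
          case True
          then obtain j where j: "m = N (e j)"
            unfolding range_Ne[symmetric] by blast
          then have "j \<noteq> n"
            using True by (auto simp: k_def)
          then show ?thesis
            using \<psi>G[of j] True j by (simp add: cut_def)
        next
          case False
          then have "single m (cut (- {N k}) G m) = 0"
            by (auto simp: cut_def G_def R_def single_def fun_eq_iff)
          then show ?thesis
            using functional_zero[OF \<psi> X] by simp
        qed
      qed
      moreover have "\<psi> (k, \<alpha>) (cut {N k} G) = F n xs * d n xs"
      proof -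
        have "cut {N k} G = single (N k) (G (N k))"
          by (auto simp: cut_def single_def)
        then show ?thesis
          using \<psi>G[of n] by (simp add: k_def)
      qed
      moreover have "\<psi> (k, \<alpha>) (cut {N k} G + cut (- {N k}) G) = \<psi> (k, \<alpha>) (cut {N k} G) + \<psi> (k, \<alpha>) (cut (- {N k}) G)"
        by (intro functionalD(1)[OF \<psi>] cutX)
      ultimately have "coblock k \<alpha> (H G) = F n xs * d n xs"
        unfolding cut_add by (simp add: \<psi>_def)
      moreover have "d n xs \<noteq> 0"
        using \<phi>(3)[OF kM xs] by (simp add: d_def k_def)
      ultimately show ?thesis
        using True by (simp add: S_def G_def coblock_def k_def \<alpha>_def)
    qed
  qed
  then show ?thesis
    using R S by blast
qed

end

section \<open>Factorization on the sums of trees\<close>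

theorem tree_sum_factorization:
  assumes r: "1 \<le> r" and T: "operator (direct_sum r tree) (direct_sum r tree) T"
  shows "\<exists>R S. bop 1 (direct_sum r tree) (direct_sum r tree) R \<and> bop 2 (direct_sum r tree) (direct_sum r tree) S \<and>
    (\<exists>H\<in>{T, \<lambda>x. x - T x}. \<forall>x\<in>vecs (direct_sum r tree). S (H (R x)) = x)"
proof -
  let ?I = "{(k, xs :: bool list). length xs \<le> 2 * k}"
  \<comment> \<open>More than twice the number of any node of depth at most \<open>2 * k\<close>, as
    the count of linear conditions demands. The maximum over the whole tree is taken because all
    chains of one tree have the same length.\<close>
  define L where "L k = Suc (2 * Max (to_nat ` ({k} \<times> {xs :: bool list. length xs \<le> 2 * k})))" for k :: nat
  \<comment> \<open>Pairing with \<open>k\<close> makes \<open>N\<close> injective, and a pair code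
    is at least its second component.\<close>
  define N where "N k = prod_encode (k, (2 * k + 1) * L k)" for k
  have L_big: "2 * to_nat (k, xs) < L k" if "length xs \<le> 2 * k" for k and xs :: "bool list"
  proof -
    have "to_nat (k, xs) \<le> Max (to_nat ` ({k} \<times> {xs :: bool list. length xs \<le> 2 * k}))"
      using that finite_bool_lists[of "2 * k"] by (intro Max_ge) auto
    then show ?thesis
      by (simp add: L_def)
  qed
  interpret block_sizes r L N
  proof
    show "inj N"
      by (auto simp: N_def inj_def)
    show "(2 * k + 1) * L k \<le> N k" for k
      unfolding N_def by (rule le_prod_encode_2)
  qed (use r in \<open>auto simp: L_def\<close>)
  have "\<exists>c. (\<forall>i\<in>?I. (\<Sum>s<L (fst i). (c i s)\<^sup>2) = 1) \<and>
    (\<forall>i\<in>?I. \<forall>j\<in>?I. i \<noteq> j \<longrightarrow> (\<Sum>s<L (fst i). \<Sum>t<L (fst j). c i s * c j t *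
      T (node_vec L N (fst j) (snd j) t) (N (fst i)) (chain_node (L (fst i)) (snd i) s)) = 0)"
  proof (rule biorthogonal_choice)
    show "inj (to_nat :: nat \<times> bool list \<Rightarrow> nat)"
      by simp
  qed (use L_big in auto)
  then obtain c where c: "\<forall>i\<in>?I. (\<Sum>s<L (fst i). (c i s)\<^sup>2) = 1"
    and ortho: "\<forall>i\<in>?I. \<forall>j\<in>?I. i \<noteq> j \<longrightarrow> (\<Sum>s<L (fst i). \<Sum>t<L (fst j). c i s * c j t *
      T (node_vec L N (fst j) (snd j) t) (N (fst i)) (chain_node (L (fst i)) (snd i) s)) = 0"
    by (elim exE conjE)
  define c' where "c' k xs s = (if length xs \<le> 2 * k then c (k, xs) s else 0)" for k xs s
  interpret block_system r L N c'
    by unfold_locales (use c in \<open>auto simp: c'_def\<close>)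
  have off_diag: "coblock k xs (T (block l ys)) = 0"
    if "length xs \<le> 2 * k" "length ys \<le> 2 * l" "(k, xs) \<noteq> (l, ys)" for k xs l ys
    using ortho[rule_format, of "(k, xs)" "(l, ys)"] that by (simp add: coblock_operator_block[OF T] c'_def)
  define C where "C k = {xs. 1 / 2 \<le> coblock k xs (T (block k xs))}" for k
  have factor: ?thesis
    if H: "operator X X H" "H \<in> {T, \<lambda>x. x - T x}" and M: "infinite M"
      and HT: "\<And>k xs l ys. length xs \<le> 2 * k \<Longrightarrow> length ys \<le> 2 * l \<Longrightarrow> (k, xs) \<noteq> (l, ys) \<Longrightarrow>
        coblock k xs (H (block l ys)) = 0"
      and D: "\<And>k. k \<in> M \<Longrightarrow> contains_tree (D k) k (k + k)"
      and DH: "\<And>k xs. length xs \<le> 2 * k \<Longrightarrow> xs \<in> D k \<Longrightarrow> 1 / 2 \<le> coblock k xs (H (block k xs))" for H M D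
  proof -
    have "\<exists>\<phi>. tree_emb k \<phi> \<and>
      (\<forall>xs. length xs \<le> k \<longrightarrow> length (\<phi> xs) \<le> 2 * k \<and> 1 / 2 \<le> coblock k (\<phi> xs) (H (block k (\<phi> xs))))"
      if k: "k \<in> M" for k
    proof -
      obtain \<phi> where "tree_emb k \<phi>" "\<forall>xs. length xs \<le> k \<longrightarrow> length (\<phi> xs) \<le> k + k \<and> \<phi> xs \<in> D k"
        using D[OF k] unfolding contains_tree_def by blast
      then show ?thesis
        using DH[where k = k] by (intro exI[of _ \<phi>]) (simp add: mult_2)
    qed
    note diag = this
    have "\<exists>R S. bop 1 X X R \<and> bop 2 X X S \<and> (\<forall>F\<in>vecs X. S (H (R F)) = F)"
      by (rule diagonal_factorization[OF H(1) M]) (fact HT, fact diag)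
    then obtain R S where "bop 1 X X R" "bop 2 X X S" "\<forall>F\<in>vecs X. S (H (R F)) = F"
      by (elim exE conjE)
    then show ?thesis
      by (intro exI[of _ R] exI[of _ S] conjI bexI[OF _ H(2)])
  qed
  have mono: "contains_tree (C k) k (k + k) \<or> contains_tree (- C k) k (k + k)" for k
    by (rule monochromatic_tree)
  show ?thesis
  proof (cases "infinite {k. contains_tree (C k) k (k + k)}")
    case True
    show ?thesis
      by (rule factor[OF T _ True off_diag, of C]) (auto simp: C_def)
  next
    case False
    then have inf: "infinite {k. contains_tree (- C k) k (k + k)}"
      using mono by (metis (mono_tags, lifting) Collect_mono_iff finite_Collect_disjI infinite_UNIV_nat rev_finite_subset UNIV_I mem_Collect_eq subsetI)
    have H: "operator X X (\<lambda>x. x - T x)"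
      using operator_id T X by (rule operator_diff)
    \<comment> \<open>By biorthogonality the identity has the identity matrix on the blocks. Hence
      \<open>Id - T\<close> inherits the vanishing off-diagonal entries, and its diagonal entries
      exceed 1 / 2 outside \<open>C k\<close>.\<close>
    have HT: "coblock k xs (block l ys - T (block l ys)) = (if (k, xs) = (l, ys) then 1 else 0) - coblock k xs (T (block l ys))"
      if "length xs \<le> 2 * k" "length ys \<le> 2 * l" for k xs l ys
      using operator_diff_arg[OF functional_coblock[unfolded functional_def] X block_in[OF that(2)] operatorD(1)[OF T block_in[OF that(2)]]]
        coblock_block[OF that] by simp
    show ?thesis
    proof (rule factor[OF H _ inf])
      show "coblock k xs (block l ys - T (block l ys)) = 0"
        if "length xs \<le> 2 * k" "length ys \<le> 2 * l" "(k, xs) \<noteq> (l, ys)" for k xs l ys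
        using HT[OF that(1,2)] off_diag[OF that] that(3) by simp
      show "1 / 2 \<le> coblock k xs (block k xs - T (block k xs))" if "length xs \<le> 2 * k" "xs \<in> - C k" for k xs
        using HT[OF that(1) that(1)] that(2) by (simp add: C_def)
    qed auto
  qed
qed

section \<open>The decomposition method for the tree spaces\<close>

definition trunc :: "nat \<Rightarrow> (bool list \<Rightarrow> real) \<Rightarrow> bool list \<Rightarrow> real"
  where "trunc n a xs = (if length xs \<le> n then a xs else 0)"

lemma branch_trunc: "branch (trunc n a) xs \<le> branch a xs"
  by (rule branch_mono) (simp add: trunc_def)

text \<open>Flattened to a single sum, the \<open>m\<close>-th summand is a tree of depth
  \<open>snd (prod_decode m)\<close>, at most \<open>m\<close>. It sits inside
  \<open>tree m\<close>, with truncation as a left inverse.\<close>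

lemma cembeds_tree_sums:
  assumes r: "1 \<le> r"
  shows "cembeds (direct_sum r (\<lambda>_. direct_sum r tree)) (direct_sum r tree)"
proof -
  let ?Z = "\<lambda>m. tree (snd (prod_decode m))"
  have le: "snd (prod_decode m) \<le> m" for m
    using le_prod_encode_2[of "snd (prod_decode m)" "fst (prod_decode m)"] by simp
  have "bop 1 (?Z m) (tree m) (\<lambda>a. a)" for m
    using le[of m] by (intro bopI) (auto simp: in_tree)
  then have A: "bop 1 (direct_sum r ?Z) (direct_sum r tree) (\<lambda>F n. if n \<in> UNIV then F n else 0)"
    by (intro direct_sum_map[OF r, where \<sigma> = "\<lambda>n. n" and T = "\<lambda>_ a. a"] normed_tree) auto
  have "bop 1 (tree m) (?Z m) (trunc (snd (prod_decode m)))" for m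
    by (rule bop_treeI)
       (auto simp: in_tree trunc_def scaleR_fun_def intro: order_trans[OF branch_trunc tree_branch_le])
  then have B: "bop 1 (direct_sum r tree) (direct_sum r ?Z) (\<lambda>F n. if n \<in> UNIV then trunc (snd (prod_decode n)) (F n) else 0)"
    by (intro direct_sum_map[OF r, where \<sigma> = "\<lambda>n. n"] normed_tree) auto
  have "trunc (snd (prod_decode n)) (F n) = F n" if "F \<in> vecs (direct_sum r ?Z)" for F n
    using that by (auto simp: in_direct_sum in_tree trunc_def fun_eq_iff)
  then have 1: "cembeds (direct_sum r ?Z) (direct_sum r tree)"
    unfolding cembeds_def using bop_operator[OF A] bop_operator[OF B]
    by (intro exI conjI) (assumption, assumption, simp)
  have 2: "cembeds (direct_sum r (\<lambda>_. direct_sum r tree)) (direct_sum r ?Z)"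
    by (rule isomorphic_cembeds[OF isomorphic_direct_sum_double[OF r]])
  show ?thesis
    by (rule cembeds_trans[OF 2 1 normed_direct_sum[OF r normed_tree]])
qed

section \<open>Comparison of the infinite tree with the sum of finite trees\<close>

text \<open>This filter does the work of a free ultrafilter: all bounded sequences converge
  simultaneously. The points \<open>e m\<close>, whose coordinates are the \<open>m\<close>-th terms
  of all bounded sequences, lie in a product of compact intervals, and \<open>G\<close> is obtained
  from the neighbourhoods of a cluster point.\<close>

lemma bounded_sequences_converge_along_filter:
  obtains G :: "nat filter" where "G \<noteq> bot" "G \<le> sequentially"
    "\<And>g :: nat \<Rightarrow> real. bounded (range g) \<Longrightarrow> \<exists>l. (g \<longlongrightarrow> l) G"
proof -
  define e where "e m g = (if bounded (range g) then g m else 0)" for m and g :: "nat \<Rightarrow> real"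
  define b where "b g = (SUP m. \<bar>e m g\<bar>)" for g
  have b: "\<bar>e m g\<bar> \<le> b g" for m g
  proof -
    have "bdd_above (range (\<lambda>m. \<bar>e m g\<bar>))"
    proof (cases "bounded (range g)")
      case True
      then show ?thesis
        unfolding e_def bounded_iff bdd_above_def by auto
    qed (simp add: e_def)
    then show ?thesis
      unfolding b_def by (intro cSUP_upper) auto
  qed
  define K where "K = (\<Pi>\<^sub>E g\<in>UNIV. {- b g .. b g})"
  have "compact K"
    using compactin_PiE[of "\<lambda>_. euclidean" UNIV "\<lambda>g. {- b g .. b g}"]
    by (simp add: K_def euclidean_product_topology)
  moreover have "eventually (\<lambda>x. x \<in> K) (filtermap e sequentially)"
    unfolding eventually_filtermap
    using b by (intro always_eventually) (auto simp: K_def PiE_iff abs_le_iff minus_le_iff)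
  moreover have "filtermap e sequentially \<noteq> bot"
    by (simp add: filtermap_bot_iff)
  ultimately obtain x where x: "inf (nhds x) (filtermap e sequentially) \<noteq> bot"
    unfolding compact_filter by blast
  define G where "G = inf (filtercomap e (nhds x)) sequentially"
  show thesis
  proof (rule that[of G])
    show "G \<noteq> bot"
    proof
      assume "G = bot"
      then obtain P Q where P: "eventually P (nhds x)"
        and Q: "eventually Q sequentially" "\<And>m. P (e m) \<Longrightarrow> Q m \<Longrightarrow> False"
        unfolding G_def trivial_limit_def eventually_inf eventually_filtercomap by blast
      have "eventually (\<lambda>m. \<not> P (e m)) sequentially"
        using Q(1) by eventually_elim (use Q(2) in blast)
      with P have "eventually (\<lambda>_. False) (inf (nhds x) (filtermap e sequentially))"
        unfolding eventually_inf eventually_filtermap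
        by (intro exI[of _ P] exI[of _ "\<lambda>y. \<not> P y"]) simp
      with x show False
        by (simp add: trivial_limit_def)
    qed
    show "G \<le> sequentially"
      by (simp add: G_def)
    have e_lim: "filterlim e (nhds x) G"
      by (simp add: G_def filterlim_def filtermap_le_iff_le_filtercomap)
    have lim: "((\<lambda>m. e m g) \<longlongrightarrow> x g) G" for g
    proof (rule topological_tendstoI)
      fix U assume U: "open U" "x g \<in> U"
      have "open ((\<lambda>y. y g) -` U)"
        using U(1) continuous_on_product_coordinates by (rule open_vimage)
      then have "eventually (\<lambda>y. y g \<in> U) (nhds x)"
        using U(2) unfolding eventually_nhds by blast
      with e_lim show "eventually (\<lambda>m. e m g \<in> U) G"
        unfolding filterlim_iff by blast
    qed
    show "\<exists>l. (g \<longlongrightarrow> l) G" if "bounded (range g)" for g :: "nat \<Rightarrow> real"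
      using lim[of g] that by (auto simp: e_def)
  qed
qed

text \<open>A branch involves finitely many coefficients, so a bound on its norm survives limits
  taken coefficient by coefficient. Truncations are eventually constant at each node and
  \<open>G\<close> is finer than \<open>sequentially\<close>, so the limits recover the
  array.\<close>

lemma cembeds_tree_inf_sum: "cembeds tree_inf (direct_sum top tree)"
proof -
  let ?X = "direct_sum top tree"
  obtain G :: "nat filter" where G: "G \<noteq> bot" "G \<le> sequentially"
    and conv: "\<And>g :: nat \<Rightarrow> real. bounded (range g) \<Longrightarrow> \<exists>l. (g \<longlongrightarrow> l) G"
    using bounded_sequences_converge_along_filter by blast
  define A where "A a n = trunc n a" for a n
  define B where "B F xs = Lim G (\<lambda>n. F n xs)" for F :: "nat \<Rightarrow> bool list \<Rightarrow> real" and xs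
  have br: "branch (F n) xs \<le> vnorm ?X F" if "F \<in> vecs ?X" for F n xs
    using that bopD(4)[OF bop_component[of top tree n] that] tree_branch_le[of "F n" n xs]
    by (auto simp: in_direct_sum)
  have lim: "((\<lambda>n. F n xs) \<longlongrightarrow> B F xs) G" if F: "F \<in> vecs ?X" for F xs
  proof -
    have "bounded (range (\<lambda>n. F n xs))"
      using order_trans[OF abs_le_branch br[OF F]] by (auto simp: bounded_iff)
    then obtain l where "((\<lambda>n. F n xs) \<longlongrightarrow> l) G"
      using conv by blast
    then show ?thesis
      using tendsto_Lim[OF G(1)] by (auto simp: B_def)
  qed
  have B_eq: "B F xs = l" if "((\<lambda>n. F n xs) \<longlongrightarrow> l) G" for F xs l
    using tendsto_Lim[OF G(1) that] by (simp add: B_def)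
  have brB: "branch (B F) xs \<le> vnorm ?X F" if F: "F \<in> vecs ?X" for F xs
  proof -
    have "((\<lambda>n. \<Sum>k\<le>length xs. (F n (take k xs))\<^sup>2) \<longlongrightarrow> (\<Sum>k\<le>length xs. (B F (take k xs))\<^sup>2)) G"
      by (intro tendsto_sum tendsto_power lim F)
    moreover have "(\<Sum>k\<le>length xs. (F n (take k xs))\<^sup>2) \<le> (vnorm ?X F)\<^sup>2" for n
      unfolding branch_square[symmetric] using br[OF F] by (intro power_mono) auto
    ultimately have "(\<Sum>k\<le>length xs. (B F (take k xs))\<^sup>2) \<le> (vnorm ?X F)\<^sup>2"
      using G(1) by (intro tendsto_upperbound[OF _ always_eventually]) auto
    then show ?thesis
      using direct_sum_norm_nonneg[OF F] by (simp add: branch_le_iff)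
  qed
  have "bop 1 tree_inf ?X A"
  proof (rule bopI)
    fix a assume a: "a \<in> vecs tree_inf"
    have "branch (A a n) xs \<le> tree_norm a" for n xs
      unfolding A_def using branch_trunc branch_le_tree_norm[OF a] by (rule order_trans)
    then have "tree_norm (A a n) \<le> tree_norm a" "0 \<le> tree_norm (A a n)" for n
      using tree_infI[of "A a n"] tree_norm_nonneg[of "A a n"] by blast+
    moreover have "A a n \<in> vecs (tree n)" for n
      by (simp add: A_def in_tree trunc_def)
    ultimately have "ell_le top (\<lambda>n. vnorm (tree n) (A a n)) (tree_norm a)" "\<And>n. A a n \<in> vecs (tree n)"
      by (auto simp: ell_le_top)
    from direct_sumI[OF this(2,1)] show "A a \<in> vecs ?X" "vnorm ?X (A a) \<le> 1 * vnorm tree_inf a"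
      by simp_all
  qed (auto simp: A_def trunc_def scaleR_fun_def fun_eq_iff)
  moreover have "bop 1 ?X tree_inf B"
  proof (rule bopI)
    fix F assume F: "F \<in> vecs ?X"
    show "B F \<in> vecs tree_inf" "vnorm tree_inf (B F) \<le> 1 * vnorm ?X F"
      using tree_infI[OF brB[OF F]] by simp_all
    show "B (c *\<^sub>R F) = c *\<^sub>R B F" for c
    proof
      show "B (c *\<^sub>R F) xs = (c *\<^sub>R B F) xs" for xs
        using tendsto_mult_left[OF lim[OF F, of xs], of c] by (intro B_eq) (simp add: scaleR_fun_def)
    qed
    fix F' assume F': "F' \<in> vecs ?X"
    show "B (F + F') = B F + B F'"
    proof
      show "B (F + F') xs = (B F + B F') xs" for xs
        using tendsto_add[OF lim[OF F, of xs] lim[OF F', of xs]] by (intro B_eq) simp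
    qed
  qed
  moreover have "B (A a) = a" for a
  proof
    fix xs
    have "eventually (\<lambda>n. a xs = A a n xs) sequentially"
      unfolding eventually_sequentially A_def trunc_def by (intro exI[of _ "length xs"]) auto
    then have "eventually (\<lambda>n. a xs = A a n xs) G"
      by (rule filter_leD[OF G(2)])
    then have "((\<lambda>n. A a n xs) \<longlongrightarrow> a xs) G"
      by (rule Lim_transform_eventually[OF tendsto_const])
    then show "B (A a) xs = a xs"
      by (rule B_eq)
  qed
  ultimately show ?thesis
    unfolding cembeds_def by (blast intro: bop_operator)
qed

text \<open>The \<open>n\<close>-th summand is placed below the left child of the node reached by \<open>n\<close> steps to the right.\<close>

lemma cembeds_sum_tree_inf: "cembeds (direct_sum top tree) tree_inf"
proof -
  let ?X = "direct_sum top tree"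
  define pre where "pre n = replicate n True @ [False]" for n
  \<comment> \<open>The number of leading \<open>True\<close> bits selects the summand, the first
    \<open>False\<close> is a separator removed by \<open>tl\<close>, and the rest is the node.
    Nodes without \<open>False\<close> form the spine and get 0.\<close>
  define A where "A F xs = (if False \<in> set xs then F (length (takeWhile id xs)) (tl (dropWhile id xs)) else 0)"
    for F :: "nat \<Rightarrow> bool list \<Rightarrow> real" and xs
  define B where "B a n = trunc n (\<lambda>xs. a (pre n @ xs))" for a :: "bool list \<Rightarrow> real" and n
  have A_pre: "A F (pre n @ xs) = F n xs" for F n xs
    by (simp add: A_def pre_def takeWhile_append dropWhile_append)
  have A_short: "A F (take k (pre n @ xs)) = 0" if "k \<le> n" for F k n xs
    using that by (auto simp: A_def pre_def min_def)
  have split: "(\<Sum>k\<le>length (pre n @ xs). f (take k (pre n @ xs)))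
    = (\<Sum>k\<le>n. f (take k (pre n @ xs))) + (\<Sum>k\<le>length xs. f (pre n @ take k xs))" for f :: "bool list \<Rightarrow> real" and n xs
  proof -
    have "{..length (pre n @ xs)} = {..n} \<union> (\<lambda>k. k + Suc n) ` {..length xs}"
    proof safe
      fix k assume "k \<le> length (pre n @ xs)" "k \<notin> (\<lambda>k. k + Suc n) ` {..length xs}"
      moreover have "k = (k - Suc n) + Suc n" "k - Suc n \<le> length xs" if "\<not> k \<le> n"
        using that \<open>k \<le> length (pre n @ xs)\<close> by (auto simp: pre_def)
      ultimately show "k \<le> n"
        by blast
    qed (auto simp: pre_def)
    moreover have "(\<Sum>k\<in>(\<lambda>k. k + Suc n) ` {..length xs}. f (take k (pre n @ xs))) = (\<Sum>k\<le>length xs. f (pre n @ take k xs))"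
      by (subst sum.reindex) (auto simp: inj_on_def pre_def intro!: sum.cong)
    ultimately show ?thesis
      by (simp add: sum.union_disjoint image_iff disjoint_iff)
  qed
  have brA: "branch (A F) xs \<le> vnorm ?X F" if F: "F \<in> vecs ?X" for F xs
  proof (cases "False \<in> set xs")
    case False
    then have "A F (take k xs) = 0" for k
      by (auto simp: A_def dest: in_set_takeD)
    then show ?thesis
      using direct_sum_norm_nonneg[OF F] by (simp add: branch_le_iff)
  next
    case True
    then obtain us ys where us: "xs = us @ False # ys" "False \<notin> set us"
      by (auto dest: split_list_first)
    then have "us = replicate (length us) True"
      using us(2) by (intro replicate_eqI) (metis (full_types))+
    then obtain n where xs: "xs = pre n @ ys"
      using us by (auto simp: pre_def)
    have "(branch (A F) xs)\<^sup>2 = (branch (F n) ys)\<^sup>2"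
        unfolding branch_square xs
      by (subst split[where f = "\<lambda>zs. (A F zs)\<^sup>2"]) (simp add: A_short A_pre del: take_append)
    then have "branch (A F) xs = branch (F n) ys"
      by simp
    also have "\<dots> \<le> tree_norm (F n)"
      using F by (intro tree_branch_le) (auto simp: in_direct_sum)
    also have "\<dots> \<le> vnorm ?X F"
      using bopD(4)[OF bop_component[of top tree n] F] by simp
    finally show ?thesis .
  qed
  have brB: "branch (B a n) xs \<le> branch a (pre n @ xs)" for a n xs
  proof -
    have "branch (B a n) xs \<le> branch (\<lambda>xs. a (pre n @ xs)) xs"
      unfolding B_def by (rule branch_trunc)
    also have "\<dots> \<le> branch a (pre n @ xs)"
      unfolding branch_le_iff[OF branch_nonneg] branch_square
      by (subst split[where f = "\<lambda>zs. (a zs)\<^sup>2"]) (simp add: sum_nonneg)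
    finally show ?thesis .
  qed
  have "bop 1 ?X tree_inf A"
    by (rule bopI)
       (use tree_infI[OF brA] in \<open>auto simp: A_def scaleR_fun_def fun_eq_iff\<close>)
  moreover have "bop 1 tree_inf ?X B"
  proof (rule bopI)
    fix a assume a: "a \<in> vecs tree_inf"
    have "branch (B a n) xs \<le> tree_norm a" for n xs
      using brB branch_le_tree_norm[OF a] by (rule order_trans)
    then have "tree_norm (B a n) \<le> tree_norm a" "0 \<le> tree_norm (B a n)" for n
      using tree_infI[of "B a n"] tree_norm_nonneg[of "B a n"] by blast+
    moreover have "B a n \<in> vecs (tree n)" for n
      by (simp add: B_def in_tree trunc_def)
    ultimately have "ell_le top (\<lambda>n. vnorm (tree n) (B a n)) (tree_norm a)" "\<And>n. B a n \<in> vecs (tree n)"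
      by (auto simp: ell_le_top)
    from direct_sumI[OF this(2,1)] show "B a \<in> vecs ?X" "vnorm ?X (B a) \<le> 1 * vnorm tree_inf a"
      by simp_all
  qed (auto simp: B_def trunc_def scaleR_fun_def fun_eq_iff)
  moreover have "B (A F) = F" if "F \<in> vecs ?X" for F
    using that by (auto simp: B_def trunc_def A_pre fun_eq_iff in_direct_sum in_tree)
  ultimately show ?thesis
    unfolding cembeds_def by (blast intro: bop_operator)
qed

text \<open>Each space is complemented in the other, and the sum of copies of \<open>?X\<close> is
  the absorbing space of the decomposition method for both.\<close>

lemma isomorphic_tree_inf: "isomorphic tree_inf (direct_sum top tree)"
proof -
  let ?X = "direct_sum top tree" and ?W = "direct_sum top (\<lambda>_. direct_sum top tree)"
  have r: "1 \<le> (top :: ennreal)"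
    by simp
  have X: "normed_nspace ?X"
    using r normed_tree by (rule normed_direct_sum)
  have W: "normed_nspace ?W"
    using r X by (rule normed_direct_sum)
  have WW: "isomorphic (direct_sum top (\<lambda>_. ?W)) ?W"
    using isomorphic_direct_sum_double[OF r, of "\<lambda>_. ?X"] by simp
  have WX: "cembeds ?W ?X"
    using r by (rule cembeds_tree_sums)
  have XW: "cembeds ?X ?W"
    using bop_single[OF r, of "\<lambda>_. ?X" 0] X bop_component[OF r, of "\<lambda>_. ?X" 0]
    unfolding cembeds_def by (auto intro!: exI bop_operator)
  have "isomorphic tree_inf ?W"
    using cembeds_trans[OF cembeds_tree_inf_sum XW X] cembeds_trans[OF WX cembeds_sum_tree_inf X]
    by (rule pelczynski_decomposition[OF r W normed_tree_inf WW])
  moreover have "isomorphic ?X ?W"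
    using XW WX by (rule pelczynski_decomposition[OF r W X WW])
  ultimately show ?thesis
    using W by (blast intro: isomorphic_trans isomorphic_sym)
qed

section \<open>Completeness of the space of square-integrable functions\<close>

lemma abs_rep_lsq: "abs_lsq (rep_lsq F) = F"
  by (rule Quotient_abs_rep[OF Quotient_lsq])

lemma sq_integrable_rep: "sq_integrable (rep_lsq F)"
  using Quotient_rep_reflp[OF Quotient_lsq, of F] by (simp add: lsq_eq_def)

lemma lsq_eq_refl: "sq_integrable f \<Longrightarrow> lsq_eq f f"
  by (simp add: lsq_eq_def)

lemma sq_integrable_diff:
  assumes "sq_integrable f" "sq_integrable g"
  shows "sq_integrable (\<lambda>x. f x - g x)"
  using sq_integrable_add[OF assms(1) sq_integrable_scale[OF assms(2), of "-1"]] by simp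

lemma norm_abs_lsq_diff:
  assumes f: "sq_integrable f" and g: "sq_integrable g"
  shows "(norm (abs_lsq f - abs_lsq g))\<^sup>2 = (LINT x|unit_leb. (f x - g x)\<^sup>2)"
proof -
  have "abs_lsq f - abs_lsq g = abs_lsq f + (-1) *\<^sub>R abs_lsq g"
    by (rule minus_lsq_def)
  also have "\<dots> = abs_lsq (\<lambda>x. f x + (-1) * g x)"
    unfolding scaleR_lsq.abs_eq[OF lsq_eq_refl[OF g]]
    by (intro plus_lsq.abs_eq lsq_eq_refl f sq_integrable_scale g)
  finally have "abs_lsq f - abs_lsq g = abs_lsq (\<lambda>x. f x - g x)"
    by simp
  then show ?thesis
    using sq_integrable_diff[OF assms]
    by (simp add: power2_norm_eq_inner inner_lsq.abs_eq lsq_eq_refl flip: power2_eq_square)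
qed

lemma unit_leb_emeasure: "emeasure unit_leb {0..<1} = 1"
  by (simp add: emeasure_restrict_space)

lemma Cauchy_fast_subsequence:
  assumes "Cauchy (X :: nat \<Rightarrow> 'a::real_normed_vector)"
  obtains s :: "nat \<Rightarrow> nat" where "strict_mono s" "\<And>k. norm (X (s (Suc k)) - X (s k)) < (1 / 2) ^ k"
proof -
  have "\<exists>M. \<forall>m\<ge>M. \<forall>n\<ge>M. norm (X m - X n) < (1 / 2) ^ k" for k
    using CauchyD[OF assms, of "(1 / 2) ^ k"] by simp
  then obtain M where M: "\<And>k m n. M k \<le> m \<Longrightarrow> M k \<le> n \<Longrightarrow> norm (X m - X n) < (1 / 2) ^ k"
    by metis
  define s where "s k = k + (\<Sum>i\<le>k. M i)" for k
  have "M k \<le> s k" for k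
    unfolding s_def using member_le_sum[of k "{..k}" M] by simp
  moreover have mono: "strict_mono s"
    by (rule strict_monoI_Suc) (simp add: s_def)
  moreover have "s k \<le> s (Suc k)" for k
    using strict_monoD[OF mono, of k "Suc k"] by simp
  ultimately show thesis
    by (intro that[of s] M) (auto intro: order_trans)
qed

text \<open>The Riesz-Fischer argument for the quotient type: representatives of a rapidly
  converging subsequence converge almost everywhere, and Fatou's lemma turns this into convergence
  in norm. Completeness provides functions with prescribed Haar coefficients.\<close>

lemma lsq_Cauchy_convergent:
  fixes X :: "nat \<Rightarrow> lsq"
  assumes "Cauchy X"
  shows "\<exists>L. X \<longlonglongrightarrow> L"
proof -
  obtain s :: "nat \<Rightarrow> nat" where s: "strict_mono s" "\<And>k. norm (X (s (Suc k)) - X (s k)) < (1 / 2) ^ k"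
    using Cauchy_fast_subsequence[OF assms] by blast
  define g where "g k = rep_lsq (X (s k))" for k
  have g: "sq_integrable (g k)" "abs_lsq (g k) = X (s k)" for k
    by (simp_all add: g_def sq_integrable_rep abs_rep_lsq)
  have gm [measurable]: "g k \<in> borel_measurable unit_leb" for k
    using g(1) by (simp add: sq_integrable_def)
  have diff_int: "integrable unit_leb (\<lambda>x. (g j x - g k x)\<^sup>2)" for j k
    using sq_integrable_diff[OF g(1) g(1), of j k] by (simp add: sq_integrable_def)
  have diff: "(\<integral>\<^sup>+x. ennreal ((g j x - g k x)\<^sup>2) \<partial>unit_leb) = ennreal ((norm (X (s j) - X (s k)))\<^sup>2)" for j k
    using norm_abs_lsq_diff[OF g(1) g(1), of j k] diff_int[of j k] by (simp add: g(2) nn_integral_eq_integral)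
  text \<open>The increments are small in \<open>L\<^sup>1\<close>, by \<open>2 u \<le> t + u\<^sup>2 / t\<close> with \<open>t = 2\<^sup>-\<^sup>k\<close>.\<close>
  have incr: "(\<integral>\<^sup>+x. ennreal \<bar>g (Suc k) x - g k x\<bar> \<partial>unit_leb) \<le> ennreal ((1 / 2) ^ k)" for k
  proof -
    let ?t = "(1 / 2) ^ k :: real"
    have "\<bar>u\<bar> \<le> ?t / 2 + u\<^sup>2 * (2 ^ k / 2)" for u :: real
    proof -
      have "0 \<le> (\<bar>u\<bar> - ?t)\<^sup>2 * (2 ^ k / 2)"
        by simp
      also have "\<dots> = u\<^sup>2 * (2 ^ k / 2) - \<bar>u\<bar> * (?t * 2 ^ k) + ?t * (?t * 2 ^ k) / 2"
        by (simp add: power2_diff power2_eq_square algebra_simps)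
      also have "?t * 2 ^ k = 1"
        by (simp add: power_one_over)
      finally show ?thesis by simp
    qed
    then have "(\<integral>\<^sup>+x. ennreal \<bar>g (Suc k) x - g k x\<bar> \<partial>unit_leb) \<le>
      (\<integral>\<^sup>+x. ennreal (?t / 2) + ennreal ((g (Suc k) x - g k x)\<^sup>2) * ennreal (2 ^ k / 2) \<partial>unit_leb)"
      by (intro nn_integral_mono) (auto simp flip: ennreal_mult ennreal_plus intro!: ennreal_leI)
    also have "\<dots> = ennreal (?t / 2) + ennreal ((norm (X (s (Suc k)) - X (s k)))\<^sup>2) * ennreal (2 ^ k / 2)"
      by (subst nn_integral_add) (auto simp: nn_integral_multc diff unit_leb_emeasure)
    also have "\<dots> \<le> ennreal (?t / 2) + ennreal (?t\<^sup>2) * ennreal (2 ^ k / 2)"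
      using s(2)[of k] by (intro add_left_mono mult_right_mono ennreal_leI power_mono) auto
    also have "\<dots> = ennreal (?t / 2 + ?t * (?t * 2 ^ k) / 2)"
      by (simp add: power2_eq_square mult.assoc flip: ennreal_mult ennreal_plus)
    also have "?t * 2 ^ k = 1"
      by (simp add: power_one_over)
    finally show ?thesis by simp
  qed
  have "(\<integral>\<^sup>+x. (\<Sum>k. ennreal \<bar>g (Suc k) x - g k x\<bar>) \<partial>unit_leb) = (\<Sum>k. \<integral>\<^sup>+x. ennreal \<bar>g (Suc k) x - g k x\<bar> \<partial>unit_leb)"
    by (rule nn_integral_suminf) measurable
  also have "\<dots> \<le> (\<Sum>k. ennreal ((1 / 2) ^ k))"
    by (intro suminf_le incr) auto
  also have "\<dots> = ennreal (\<Sum>k. (1 / 2) ^ k)"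
    by (intro suminf_ennreal2) auto
  finally have "(\<integral>\<^sup>+x. (\<Sum>k. ennreal \<bar>g (Suc k) x - g k x\<bar>) \<partial>unit_leb) \<noteq> \<infinity>"
    by (auto simp: top_unique)
  then have "AE x in unit_leb. (\<Sum>k. ennreal \<bar>g (Suc k) x - g k x\<bar>) \<noteq> \<infinity>"
    by (intro nn_integral_PInf_AE) measurable
  then have conv: "AE x in unit_leb. (\<lambda>k. g k x) \<longlonglongrightarrow> lim (\<lambda>k. g k x)"
  proof eventually_elim
    case (elim x)
    then have "summable (\<lambda>k. \<bar>g (Suc k) x - g k x\<bar>)"
      by (intro summable_suminf_not_top) auto
    then have "summable (\<lambda>k. g (Suc k) x - g k x)"
      by (rule summable_rabs_cancel)
    then have "convergent (\<lambda>n. \<Sum>k<n. g (Suc k) x - g k x)"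
      by (simp add: summable_iff_convergent)
    then have "convergent (\<lambda>n. (\<Sum>k<n. g (Suc k) x - g k x) + g 0 x)"
      by (intro convergent_add convergent_const)
    moreover have "(\<Sum>k<n. g (Suc k) x - g k x) + g 0 x = g n x" for n
      using sum_lessThan_telescope[of "\<lambda>k. g k x" n] by simp
    ultimately have "convergent (\<lambda>n. g n x)"
      by simp
    then show ?case
      by (simp add: convergent_LIMSEQ_iff)
  qed
  define h where "h x = lim (\<lambda>k. g k x)" for x
  have hm [measurable]: "h \<in> borel_measurable unit_leb"
    unfolding h_def[abs_def] by (rule borel_measurable_lim_metric) measurable
  \<comment> \<open>One estimate with two uses: some finite bound makes the limit square integrable,
    a small one gives convergence.\<close>
  have fatou: "(\<integral>\<^sup>+x. ennreal ((h x - g j x)\<^sup>2) \<partial>unit_leb) \<le> ennreal (c\<^sup>2)"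
    if c: "\<And>k. j \<le> k \<Longrightarrow> norm (X (s k) - X (s j)) \<le> c" for j c
  proof -
    have "AE x in unit_leb. ennreal ((h x - g j x)\<^sup>2) = liminf (\<lambda>k. ennreal ((g k x - g j x)\<^sup>2))"
      using conv
    proof eventually_elim
      case (elim x)
      have "(\<lambda>k. ennreal ((g k x - g j x)\<^sup>2)) \<longlonglongrightarrow> ennreal ((h x - g j x)\<^sup>2)"
        using elim unfolding h_def by (intro tendsto_intros)
      from lim_imp_Liminf[OF trivial_limit_sequentially this] show ?case
        by (rule sym)
    qed
    then have "(\<integral>\<^sup>+x. ennreal ((h x - g j x)\<^sup>2) \<partial>unit_leb) = (\<integral>\<^sup>+x. liminf (\<lambda>k. ennreal ((g k x - g j x)\<^sup>2)) \<partial>unit_leb)"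
      by (rule nn_integral_cong_AE)
    also have "\<dots> \<le> liminf (\<lambda>k. \<integral>\<^sup>+x. ennreal ((g k x - g j x)\<^sup>2) \<partial>unit_leb)"
      by (rule nn_integral_liminf) measurable
    also have "\<dots> \<le> liminf (\<lambda>k. ennreal (c\<^sup>2))"
      unfolding diff using c
      by (intro Liminf_mono) (auto simp: eventually_sequentially intro!: exI[of _ j] ennreal_leI power_mono)
    also have "\<dots> = ennreal (c\<^sup>2)"
      by (simp add: Liminf_const)
    finally show ?thesis .
  qed
  have Cs: "Cauchy (X \<circ> s)"
    using assms s(1) by (rule Cauchy_subseq_Cauchy)
  have sqd: "sq_integrable (\<lambda>x. h x - g j x)" if "\<And>k. j \<le> k \<Longrightarrow> norm (X (s k) - X (s j)) \<le> c" for j c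
  proof -
    have "integrable unit_leb (\<lambda>x. (h x - g j x)\<^sup>2)"
      using le_less_trans[OF fatou[OF that] ennreal_less_top] by (intro integrableI_bounded) auto
    then show ?thesis
      by (simp add: sq_integrable_def)
  qed
  obtain j1 where "\<And>k. j1 \<le> k \<Longrightarrow> norm (X (s k) - X (s j1)) \<le> 1"
    using CauchyD[OF Cs, of 1] by (auto intro: less_imp_le)
  from sq_integrable_add[OF sqd[OF this] g(1)[of j1]] have h: "sq_integrable h"
    by simp
  have "(X \<circ> s) \<longlonglongrightarrow> abs_lsq h"
  proof (rule LIMSEQ_I)
    fix e :: real assume e: "0 < e"
    obtain M where M: "\<And>j k. M \<le> j \<Longrightarrow> M \<le> k \<Longrightarrow> norm (X (s k) - X (s j)) < e / 2"
      using CauchyD[OF Cs, of "e / 2"] e by auto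
    have "norm ((X \<circ> s) j - abs_lsq h) < e" if j: "M \<le> j" for j
    proof -
      have *: "norm (X (s k) - X (s j)) \<le> e / 2" if "j \<le> k" for k
        using M[of j k] j that by simp
      have "ennreal ((norm (abs_lsq h - abs_lsq (g j)))\<^sup>2) = (\<integral>\<^sup>+x. ennreal ((h x - g j x)\<^sup>2) \<partial>unit_leb)"
        unfolding norm_abs_lsq_diff[OF h g(1)]
        using sq_integrable_diff[OF h g(1), of j] by (subst nn_integral_eq_integral) (auto simp: sq_integrable_def)
      also have "\<dots> \<le> ennreal ((e / 2)\<^sup>2)"
        using * by (rule fatou)
      finally have "(norm (abs_lsq h - abs_lsq (g j)))\<^sup>2 \<le> (e / 2)\<^sup>2"
        by (simp add: ennreal_le_iff)
      then have "norm (abs_lsq h - X (s j)) \<le> e / 2"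
        using e by (simp add: g(2) power2_le_iff_abs_le)
      then show ?thesis
        using e by (simp add: norm_minus_commute)
    qed
    then show "\<exists>M. \<forall>j\<ge>M. norm ((X \<circ> s) j - abs_lsq h) < e"
      by blast
  qed
  then show ?thesis
    using Cauchy_converges_subseq[OF assms s(1)] by blast
qed

section \<open>Dyadic intervals\<close>

definition cell_left :: "bool list \<Rightarrow> real"
  where "cell_left xs = (\<Sum>i<length xs. of_bool (xs ! i) / 2 ^ Suc i)"

definition cell :: "bool list \<Rightarrow> real set"
  where "cell xs = {cell_left xs ..< cell_left xs + 1 / 2 ^ length xs}"

lemma cell_left_snoc: "cell_left (xs @ [b]) = cell_left xs + of_bool b / 2 ^ Suc (length xs)"
  by (simp add: cell_left_def nth_append)

lemma cell_left_bounds: "0 \<le> cell_left xs \<and> cell_left xs + 1 / 2 ^ length xs \<le> 1"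
proof (induction xs rule: rev_induct)
  case (snoc b xs)
  then show ?case
    by (cases b) (auto simp: cell_left_snoc field_simps)
qed (simp add: cell_left_def)

lemma cell_unit: "cell xs \<subseteq> {0..<1}"
  using cell_left_bounds[of xs] by (auto simp: cell_def)

lemma cell_left_in: "cell_left xs \<in> cell xs"
  by (simp add: cell_def)

lemma cell_Inf: "Inf (cell xs) = cell_left xs"
  unfolding cell_def by (rule cInf_atLeastLessThan) simp

lemma cell_Sup: "Sup (cell xs) = cell_left xs + 1 / 2 ^ length xs"
  unfolding cell_def by (rule cSup_atLeastLessThan) simp

lemma half_cell: "left_half (cell xs) = cell (xs @ [False])" "right_half (cell xs) = cell (xs @ [True])"
  by (auto simp: left_half_def right_half_def cell_Inf cell_Sup cell_def cell_left_snoc field_simps)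

lemma cell_split:
  "cell xs = cell (xs @ [False]) \<union> cell (xs @ [True])" "cell (xs @ [False]) \<inter> cell (xs @ [True]) = {}"
proof -
  define d where "d = 1 / (2 :: real) ^ Suc (length xs)"
  have "0 < d" "1 / 2 ^ length xs = 2 * d"
    by (simp_all add: d_def)
  then have "cell xs = {cell_left xs ..< cell_left xs + 2 * d}"
    "cell (xs @ [False]) = {cell_left xs ..< cell_left xs + d}"
    "cell (xs @ [True]) = {cell_left xs + d ..< cell_left xs + 2 * d}"
    by (simp_all add: cell_def cell_left_snoc flip: d_def) (simp add: d_def add.commute)+
  with \<open>0 < d\<close> show "cell xs = cell (xs @ [False]) \<union> cell (xs @ [True])"
    "cell (xs @ [False]) \<inter> cell (xs @ [True]) = {}"
    by auto
qed

lemma cell_append: "cell (xs @ ys) \<subseteq> cell xs"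
proof (induction ys rule: rev_induct)
  case (snoc b ys)
  have "cell (xs @ ys @ [b]) \<subseteq> cell (xs @ ys)"
    using cell_split(1)[of "xs @ ys"] by (cases b) auto
  with snoc show ?case by blast
qed simp

lemma cell_take: "cell xs \<subseteq> cell (take k xs)"
  using cell_append[of "take k xs" "drop k xs"] by simp

lemma cell_same_length:
  assumes "length xs = length ys" "x \<in> cell xs" "x \<in> cell ys"
  shows "xs = ys"
  using assms
proof (induction xs arbitrary: ys rule: rev_induct)
  case (snoc b xs)
  then obtain zs c where ys: "ys = zs @ [c]"
    by (cases ys rule: rev_cases) auto
  have "x \<in> cell xs" "x \<in> cell zs"
    using snoc.prems cell_append unfolding ys by blast+
  then have "xs = zs"
    using snoc ys by simp
  moreover have "b = c"
    using snoc.prems \<open>xs = zs\<close> cell_split(2)[of xs] unfolding ys by (cases b; cases c) auto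
  ultimately show ?case
    by (simp add: ys)
qed simp

lemma cell_cover:
  assumes "x \<in> {0..<1}"
  shows "\<exists>xs. length xs = n \<and> x \<in> cell xs"
proof (induction n)
  case 0
  then show ?case
    using assms by (simp add: cell_def cell_left_def)
next
  case (Suc n)
  then obtain xs where "length xs = n" "x \<in> cell xs"
    by blast
  moreover then have "x \<in> cell (xs @ [False]) \<or> x \<in> cell (xs @ [True])"
    using cell_split(1) by blast
  ultimately show ?case
    by (metis length_append_singleton)
qed

lemma cell_mem_prefix:
  assumes "x \<in> cell xs" "x \<in> cell ys" "length xs \<le> length ys"
  shows "xs = take (length xs) ys"
  using assms cell_take[of ys "length xs"] by (intro cell_same_length[of _ _ x]) auto

lemma inj_cell: "inj cell"
proof (rule injI)
  fix xs ys assume eq: "cell xs = cell ys"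
  have "cell_left xs = cell_left ys"
    using eq by (metis cell_Inf)
  then have "(2::real) ^ length xs = 2 ^ length ys"
    using arg_cong[OF eq, of Sup] by (simp add: cell_Sup)
  then have "length xs = length ys"
    by simp
  then show "xs = ys"
    using cell_left_in[of xs] eq by (intro cell_same_length[of _ _ "cell_left xs"]) auto
qed

lemma cell_left_int: "\<exists>j. cell_left xs = real j / 2 ^ length xs \<and> j < 2 ^ length xs"
proof (induction xs rule: rev_induct)
  case (snoc b xs)
  then obtain j where "cell_left xs = real j / 2 ^ length xs" "j < 2 ^ length xs"
    by blast
  then show ?case
    by (intro exI[of _ "2 * j + of_bool b"]) (cases b; auto simp: cell_left_snoc field_simps)
qed (simp add: cell_left_def)

lemma dyadic_level_eq: "dyadic_level m = cell ` {xs. length xs = m}"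
proof (intro equalityI subsetI)
  fix I assume "I \<in> cell ` {xs. length xs = m}"
  then obtain xs where xs: "I = cell xs" "length xs = m"
    by blast
  obtain j where "cell_left xs = real j / 2 ^ m" "j < 2 ^ m"
    using cell_left_int[of xs] xs by auto
  then show "I \<in> dyadic_level m"
    unfolding dyadic_level_def
    by (intro CollectI exI[of _ "Suc j"]) (auto simp: xs cell_def add_divide_distrib)
next
  fix I assume "I \<in> dyadic_level m"
  then obtain k where k: "I = {(real k - 1) / 2 ^ m ..< real k / 2 ^ m}" "1 \<le> k" "k \<le> 2 ^ m"
    by (auto simp: dyadic_level_def)
  define x where "x = (real k - 1) / 2 ^ m"
  have "real k \<le> 2 ^ m"
    using k(3) by (metis of_nat_le_iff of_nat_numeral of_nat_power)
  then have "real k - 1 < 2 ^ m" "0 \<le> real k - 1"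
    using k(2) by linarith+
  then have "x \<in> {0..<1}"
    by (simp add: x_def)
  then obtain xs where xs: "length xs = m" "x \<in> cell xs"
    using cell_cover by blast
  obtain j where j: "cell_left xs = real j / 2 ^ m"
    using cell_left_int[of xs] xs by auto
  have "real j \<le> real k - 1" "real k - 1 < real j + 1"
    using xs(2) by (auto simp: cell_def j x_def xs(1) divide_le_cancel divide_less_cancel simp flip: add_divide_distrib)
  then have "k = Suc j"
    by linarith
  then have "cell xs = I"
    by (simp add: cell_def j xs(1) k(1) add.commute flip: add_divide_distrib)
  then show "I \<in> cell ` {xs. length xs = m}"
    using xs(1) by blast
qed

lemma dyadic_eq: "dyadic = range cell"
  by (auto simp: dyadic_def dyadic_level_eq)

lemma dyadic_upto_eq: "dyadic_upto n = cell ` {xs. length xs \<le> n}"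
  by (auto simp: dyadic_upto_def dyadic_level_eq)

lemma haar_cell: "haar (cell xs) x = indicator (cell (xs @ [False])) x - indicator (cell (xs @ [True])) x"
  by (simp add: haar_def half_cell)

lemma haar_cell_square: "(haar (cell xs) x)\<^sup>2 = indicator (cell xs) x"
  unfolding haar_cell using cell_split[of xs] by (auto simp: indicator_def)

lemma haar_cell_zero: "x \<notin> cell xs \<Longrightarrow> haar (cell xs) x = 0"
  using haar_cell_square[of xs x] by simp

lemma measurable_cell [measurable]: "cell xs \<in> sets unit_leb"
  using cell_unit[of xs] by (auto simp: sets_restrict_space_iff cell_def)

lemma emeasure_cell: "emeasure unit_leb (cell xs) = ennreal (1 / 2 ^ length xs)"
  using cell_unit[of xs] by (simp add: emeasure_restrict_space) (simp add: cell_def)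

lemma measure_cell: "measure unit_leb (cell xs) = 1 / 2 ^ length xs"
  by (simp add: measure_def emeasure_cell)

lemma integral_indicator_cell: "(LINT x|unit_leb. indicator (cell xs) x) = (1 / 2 ^ length xs :: real)"
  using cell_unit[of xs] by (simp add: measure_cell space_restrict_space Int_absorb2)

lemma integrable_indicator_cell: "integrable unit_leb (indicator (cell xs) :: real \<Rightarrow> real)"
  by (intro integrable_real_indicator) (auto simp: emeasure_cell)

section \<open>Haar coefficients\<close>

abbreviation haar_vec :: "bool list \<Rightarrow> lsq"
  where "haar_vec xs \<equiv> haar_lsq (cell xs)"

text \<open>The Haar function of an ancestor is constant on the cell of a descendant, with the sign
  given by the first bit of the path between them, and the descendant has mean 0. Incomparable nodes
  have disjoint cells.\<close>

lemma inner_haar_vec: "haar_vec xs \<bullet> haar_vec ys = (if xs = ys then 1 / 2 ^ length xs else 0)"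
proof -
  have inner: "haar_vec xs \<bullet> haar_vec ys = (LINT x|unit_leb. haar (cell xs) x * haar (cell ys) x)" for xs ys
    by transfer simp
  have mean: "(LINT x|unit_leb. haar (cell ys) x) = 0" for ys
    unfolding haar_cell
    by (subst Bochner_Integration.integral_diff[OF integrable_indicator_cell integrable_indicator_cell])
       (simp only: integral_indicator_cell length_append_singleton diff_self)
  have below: "haar_vec xs \<bullet> haar_vec (xs @ b # zs) = 0" for xs b zs
  proof -
    have eq: "haar (cell xs) x * haar (cell (xs @ b # zs)) x = (if b then -1 else 1) * haar (cell (xs @ b # zs)) x" for x
    proof (cases "x \<in> cell (xs @ b # zs)")
      case True
      then have "x \<in> cell (xs @ [b])"
        using cell_append[of "xs @ [b]" zs] by auto
      then show ?thesis
        using cell_split(2)[of xs] by (cases b) (auto simp: haar_cell[of xs] indicator_def)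
    qed (simp add: haar_cell_zero)
    show ?thesis
      unfolding inner eq by (cases b) (simp_all add: mean)
  qed
  consider "xs = ys" | b zs where "ys = xs @ b # zs" | b zs where "xs = ys @ b # zs" | "parallel xs ys"
    by (metis append_Nil2 list.exhaust parallelI prefix_def)
  then show ?thesis
  proof cases
    case 1
    have "haar_vec xs \<bullet> haar_vec xs = (LINT x|unit_leb. indicator (cell xs) x)"
      unfolding inner by (simp flip: power2_eq_square haar_cell_square)
    then show ?thesis
      using 1 integral_indicator_cell[of xs] by simp
  next
    case 2
    then show ?thesis
      using below by simp
  next
    case 3
    then show ?thesis
      using below by (simp add: inner_commute)
  next
    case 4
    have eq: "haar (cell xs) x * haar (cell ys) x = 0" for x
    proof (rule ccontr)
      assume "haar (cell xs) x * haar (cell ys) x \<noteq> 0"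
      then have "x \<in> cell xs" "x \<in> cell ys"
        using haar_cell_zero by fastforce+
      then have "prefix xs ys \<or> prefix ys xs"
        using cell_mem_prefix by (metis nat_le_linear take_is_prefix)
      with 4 show False
        by (auto simp: parallel_def)
    qed
    show ?thesis
      unfolding inner eq using 4 by auto
  qed
qed

lemma haar_expansion_iff:
  "haar_expansion a f \<longleftrightarrow> ((\<lambda>xs. a (cell xs) *\<^sub>R haar_vec xs) has_sum f) UNIV"
  unfolding haar_expansion_def dyadic_eq has_sum_reindex[OF inj_cell] by (simp add: comp_def)

text \<open>The power of 2 is the reciprocal of the squared norm of the Haar function. In contrast
  to the choice in \<open>haar_coeffs\<close>, linearity is immediate.\<close>

definition coef :: "lsq \<Rightarrow> bool list \<Rightarrow> real"
  where "coef f xs = 2 ^ length xs * (f \<bullet> haar_vec xs)"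

lemma coef_add: "coef (f + g) = coef f + coef g"
  by (simp add: coef_def fun_eq_iff inner_add_left distrib_left)

lemma coef_scaleR: "coef (c *\<^sub>R f) = c *\<^sub>R coef f"
  by (simp add: coef_def fun_eq_iff scaleR_fun_def)

lemma coef_haar_sum:
  assumes "((\<lambda>xs. A xs *\<^sub>R haar_vec xs) has_sum f) UNIV"
  shows "coef f = A"
proof
  fix ys
  have "((\<lambda>xs. (A xs *\<^sub>R haar_vec xs) \<bullet> haar_vec ys) has_sum f \<bullet> haar_vec ys) UNIV"
    by (rule has_sum_bounded_linear[OF bounded_linear_inner_left assms])
  moreover have "((\<lambda>xs. (A xs *\<^sub>R haar_vec xs) \<bullet> haar_vec ys) has_sum A ys / 2 ^ length ys) UNIV"
    by (rule has_sum_finite_neutralI[of "{ys}"]) (auto simp: inner_haar_vec)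
  ultimately have "f \<bullet> haar_vec ys = A ys / 2 ^ length ys"
    by (rule has_sum_unique)
  then show "coef f ys = A ys"
    by (simp add: coef_def)
qed

lemma haar_expansion_coef: "haar_expansion a f \<Longrightarrow> coef f = (\<lambda>xs. a (cell xs))"
  unfolding haar_expansion_iff by (rule coef_haar_sum)

lemma haar_coeffs_cell:
  assumes "haar_expansion a f"
  shows "(\<lambda>xs. haar_coeffs f (cell xs)) = coef f"
  using haar_expansion_coef[of "haar_coeffs f" f] someI[of "\<lambda>a. haar_expansion a f", OF assms]
  by (simp add: haar_coeffs_def)

section \<open>The square function norm\<close>

lemma ennsqrt_ennreal: "0 \<le> t \<Longrightarrow> ennsqrt (ennreal t) = ennreal (sqrt t)"
  by (simp add: ennsqrt_def)

lemma ennsqrt_mono: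
  assumes "s \<le> t"
  shows "ennsqrt s \<le> ennsqrt t"
  using assms unfolding ennsqrt_def
  by (auto simp: top_unique less_top intro!: ennreal_leI enn2real_mono)

lemma ennsqrt_measurable [measurable]: "ennsqrt \<in> borel_measurable borel"
  unfolding ennsqrt_def[abs_def] by measurable

definition level_sum :: "(bool list \<Rightarrow> real) \<Rightarrow> nat \<Rightarrow> real \<Rightarrow> ennreal"
  where "level_sum A n x = (\<Sum>xs\<in>{xs. length xs \<le> n}. ennreal ((A xs)\<^sup>2 * indicator (cell xs) x))"

text \<open>The cells of depth at most \<open>length ys\<close> that contain \<open>x\<close> belong
  to the prefixes of \<open>ys\<close>; so the truncated square function at a point is a norm along
  a branch.\<close>

lemma level_sum_cell:
  assumes x: "x \<in> cell ys"
  shows "level_sum A (length ys) x = ennreal ((branch A ys)\<^sup>2)"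
proof -
  have set: "{xs. length xs \<le> length ys \<and> x \<in> cell xs} = (\<lambda>k. take k ys) ` {..length ys}"
  proof (intro equalityI subsetI)
    fix xs assume "xs \<in> {xs. length xs \<le> length ys \<and> x \<in> cell xs}"
    then have "length xs \<le> length ys" "xs = take (length xs) ys"
      using x cell_mem_prefix by auto
    then show "xs \<in> (\<lambda>k. take k ys) ` {..length ys}"
      by blast
  qed (use x cell_take in auto)
  have "level_sum A (length ys) x = (\<Sum>xs\<in>{xs. length xs \<le> length ys \<and> x \<in> cell xs}. ennreal ((A xs)\<^sup>2))"
    unfolding level_sum_def using finite_bool_lists
    by (intro sum.mono_neutral_cong_right) auto
  also have "\<dots> = ennreal (\<Sum>xs\<in>(\<lambda>k. take k ys) ` {..length ys}. (A xs)\<^sup>2)"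
    unfolding set by (rule sum_ennreal) simp
  also have "(\<Sum>xs\<in>(\<lambda>k. take k ys) ` {..length ys}. (A xs)\<^sup>2) = (branch A ys)\<^sup>2"
    unfolding branch_square
    by (subst sum.reindex) (auto simp: inj_on_def dest: arg_cong[where f = length])
  finally show ?thesis .
qed

text \<open>The sets of nodes of bounded depth are cofinal among the finite sets, so the unordered
  sum is a supremum over depths.\<close>

lemma square_fun_eq: "square_fun a x = ennsqrt (SUP n. level_sum (\<lambda>xs. a (cell xs)) n x)"
proof -
  let ?f = "\<lambda>xs. ennreal ((a (cell xs))\<^sup>2 * indicator (cell xs) x)"
  have "(\<Sum>\<^sub>\<infinity>I\<in>dyadic. ennreal ((a I)\<^sup>2 * (haar I x)\<^sup>2)) = (\<Sum>\<^sub>\<infinity>xs. ?f xs)"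
    unfolding dyadic_eq by (subst infsum_reindex[OF inj_cell]) (simp add: comp_def haar_cell_square)
  also have "\<dots> = (SUP F\<in>{F. finite F}. sum ?f F)"
    by (subst nonneg_infsum_complete) auto
  also have "\<dots> = (SUP n. level_sum (\<lambda>xs. a (cell xs)) n x)"
  proof (rule antisym)
    show "(SUP n. level_sum (\<lambda>xs. a (cell xs)) n x) \<le> (SUP F\<in>{F. finite F}. sum ?f F)"
    proof (rule SUP_mono)
      show "\<exists>F\<in>{F. finite F}. level_sum (\<lambda>xs. a (cell xs)) n x \<le> sum ?f F" for n
        by (rule bexI[of _ "{xs. length xs \<le> n}"]) (simp_all add: level_sum_def finite_bool_lists)
    qed
    show "(SUP F\<in>{F. finite F}. sum ?f F) \<le> (SUP n. level_sum (\<lambda>xs. a (cell xs)) n x)"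
    proof (rule SUP_mono)
      fix F :: "bool list set" assume "F \<in> {F. finite F}"
      then have F: "finite F"
        by simp
      have "F \<subseteq> {xs. length xs \<le> Max (insert 0 (length ` F))}"
        using F by auto
      then have "sum ?f F \<le> level_sum (\<lambda>xs. a (cell xs)) (Max (insert 0 (length ` F))) x"
        unfolding level_sum_def using finite_bool_lists by (intro sum_mono2) auto
      then show "\<exists>n\<in>UNIV. sum ?f F \<le> level_sum (\<lambda>xs. a (cell xs)) n x"
        by blast
    qed
  qed
  finally show ?thesis
    by (simp add: square_fun_def)
qed

lemma square_fun_measurable [measurable]: "square_fun a \<in> borel_measurable unit_leb"
  unfolding square_fun_eq[abs_def] level_sum_def by measurable

lemma square_norm_le:
  assumes "\<And>xs. branch (\<lambda>xs. a (cell xs)) xs \<le> c"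
  shows "square_norm a \<le> ennreal c"
proof -
  let ?A = "\<lambda>xs. a (cell xs)"
  have c: "0 \<le> c"
    using assms[of "[]"] branch_nonneg order_trans by blast
  have "square_fun a x \<le> ennreal c" if "x \<in> {0..<1}" for x
  proof -
    have "level_sum ?A n x \<le> ennreal (c\<^sup>2)" for n
    proof -
      obtain ys where "length ys = n" "x \<in> cell ys"
        using \<open>x \<in> {0..<1}\<close> cell_cover by blast
      then show ?thesis
        using level_sum_cell[of x ys ?A] assms by (auto intro!: ennreal_leI power_mono)
    qed
    then have "(SUP n. level_sum ?A n x) \<le> ennreal (c\<^sup>2)"
      by (rule SUP_least)
    then have "square_fun a x \<le> ennsqrt (ennreal (c\<^sup>2))"
      unfolding square_fun_eq by (rule ennsqrt_mono)
    then show ?thesis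
      using c by (simp add: ennsqrt_ennreal)
  qed
  then show ?thesis
    unfolding square_norm_def by (intro esssup_I) (auto simp: space_restrict_space)
qed

text \<open>A cell has positive measure, so it contains a point where the almost everywhere bound
  holds, and there the square function dominates the branch norm. Hence the essential supremum
  misses no branch.\<close>

lemma square_norm_ge:
  assumes "square_norm a \<le> ennreal c" "0 \<le> c"
  shows "branch (\<lambda>xs. a (cell xs)) ys \<le> c"
proof -
  let ?A = "\<lambda>xs. a (cell xs)"
  have ae: "AE x in unit_leb. square_fun a x \<le> ennreal c"
    using esssup_AE[where M = unit_leb and f = "square_fun a"] assms(1) unfolding square_norm_def
    by (auto elim: eventually_mono)
  have "\<exists>x\<in>cell ys. square_fun a x \<le> ennreal c"
  proof (rule ccontr)
    assume "\<not> ?thesis"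
    then have "AE x in unit_leb. x \<notin> cell ys"
      using ae by (auto elim: eventually_mono)
    then have "emeasure unit_leb (cell ys) = 0"
      by (subst (asm) AE_iff_measurable[where N = "cell ys"]) (use cell_unit[of ys] in \<open>auto simp: space_restrict_space\<close>)
    then show False
      by (simp add: emeasure_cell)
  qed
  then obtain x where x: "x \<in> cell ys" "square_fun a x \<le> ennreal c"
    by blast
  have "ennreal (branch ?A ys) = ennsqrt (level_sum ?A (length ys) x)"
    using x(1) by (simp add: level_sum_cell ennsqrt_ennreal)
  also have "\<dots> \<le> square_fun a x"
    unfolding square_fun_eq by (intro ennsqrt_mono SUP_upper) simp
  also have "\<dots> \<le> ennreal c"
    by (rule x(2))
  finally show ?thesis
    using assms(2) by simp
qed

lemma square_norm_finite_iff: "square_norm a < top \<longleftrightarrow> (\<lambda>xs. a (cell xs)) \<in> vecs tree_inf"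
proof
  assume "square_norm a < top"
  then have "square_norm a \<le> ennreal (enn2real (square_norm a))"
    by (simp add: less_top)
  from square_norm_ge[OF this] show "(\<lambda>xs. a (cell xs)) \<in> vecs tree_inf"
    by (intro tree_infI) auto
next
  assume "(\<lambda>xs. a (cell xs)) \<in> vecs tree_inf"
  from le_less_trans[OF square_norm_le[of a, OF branch_le_tree_norm[OF this]] ennreal_less_top]
  show "square_norm a < top" .
qed

lemma square_norm_eq:
  assumes A: "(\<lambda>xs. a (cell xs)) \<in> vecs tree_inf"
  shows "enn2real (square_norm a) = tree_norm (\<lambda>xs. a (cell xs))"
proof (rule antisym)
  have "square_norm a \<le> ennreal (tree_norm (\<lambda>xs. a (cell xs)))"
    by (rule square_norm_le[OF branch_le_tree_norm[OF A]])
  then show "enn2real (square_norm a) \<le> tree_norm (\<lambda>xs. a (cell xs))"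
    using tree_norm_nonneg[OF A] by (rule enn2real_leI[rotated])
  have "square_norm a < top"
    using A by (simp add: square_norm_finite_iff)
  then have "square_norm a \<le> ennreal (enn2real (square_norm a))"
    by (simp add: less_top)
  from square_norm_ge[OF this] show "tree_norm (\<lambda>xs. a (cell xs)) \<le> enn2real (square_norm a)"
    by (intro tree_infI) auto
qed

lemma SL_norm_eq:
  assumes "haar_expansion a f" "coef f \<in> vecs tree_inf"
  shows "SL_norm f = tree_norm (coef f)"
  using assms square_norm_eq[of "haar_coeffs f"] by (simp add: SL_norm_def haar_coeffs_cell[OF assms(1)])

lemma in_SL_inf: "f \<in> vecs SL_inf \<longleftrightarrow> ((\<lambda>xs. coef f xs *\<^sub>R haar_vec xs) has_sum f) UNIV \<and> coef f \<in> vecs tree_inf"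
proof
  assume "f \<in> vecs SL_inf"
  then obtain a where a: "haar_expansion a f" "square_norm a < top"
    by (auto simp: SL_inf_def)
  have "coef f = (\<lambda>xs. a (cell xs))"
    using a(1) by (rule haar_expansion_coef)
  with a show "((\<lambda>xs. coef f xs *\<^sub>R haar_vec xs) has_sum f) UNIV \<and> coef f \<in> vecs tree_inf"
    by (simp add: haar_expansion_iff square_norm_finite_iff)
next
  assume *: "((\<lambda>xs. coef f xs *\<^sub>R haar_vec xs) has_sum f) UNIV \<and> coef f \<in> vecs tree_inf"
  define a where "a I = coef f (inv cell I)" for I
  have "(\<lambda>xs. a (cell xs)) = coef f"
    by (simp add: a_def inv_f_f[OF inj_cell])
  with * have "haar_expansion a f" "square_norm a < top"
    by (auto simp: haar_expansion_iff square_norm_finite_iff fun_eq_iff dest: fun_cong)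
  then show "f \<in> vecs SL_inf"
    by (auto simp: SL_inf_def)
qed

lemma SL_inf_norm: "f \<in> vecs SL_inf \<Longrightarrow> vnorm SL_inf f = tree_norm (coef f)"
  using in_SL_inf[of f] SL_norm_eq[of _ f] by (auto simp: SL_inf_def)

section \<open>Existence of Haar expansions\<close>

lemma norm_haar_sum:
  assumes "finite F"
  shows "(norm (\<Sum>xs\<in>F. A xs *\<^sub>R haar_vec xs))\<^sup>2 = (\<Sum>xs\<in>F. (A xs)\<^sup>2 / 2 ^ length xs)"
proof -
  have "(norm (\<Sum>xs\<in>F. A xs *\<^sub>R haar_vec xs))\<^sup>2 =
      (\<Sum>xs\<in>F. \<Sum>ys\<in>F. if ys = xs then (A xs)\<^sup>2 / 2 ^ length xs else 0)"
    unfolding power2_norm_eq_inner inner_sum_left inner_sum_right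
    by (intro sum.cong refl) (auto simp: inner_haar_vec power2_eq_square)
  also have "\<dots> = (\<Sum>xs\<in>F. (A xs)\<^sup>2 / 2 ^ length xs)"
    using assms by simp
  finally show ?thesis .
qed

text \<open>The pointwise bound on the square function is integrated over the unit interval, which
  has measure 1.\<close>

lemma sum_haar_weights_le:
  assumes A: "\<And>xs. branch A xs \<le> c" and F: "finite F"
  shows "(\<Sum>xs\<in>F. (A xs)\<^sup>2 / 2 ^ length xs) \<le> c\<^sup>2"
proof -
  let ?n = "Max (insert 0 (length ` F))"
  have sub: "F \<subseteq> {xs. length xs \<le> ?n}"
    using F by auto
  have c: "0 \<le> c"
    using A[of "[]"] branch_nonneg order_trans by blast
  have "ennreal (\<Sum>xs\<in>F. (A xs)\<^sup>2 / 2 ^ length xs) = (\<Sum>xs\<in>F. ennreal ((A xs)\<^sup>2) * emeasure unit_leb (cell xs))"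
    by (simp add: emeasure_cell flip: sum_ennreal ennreal_mult)
  also have "\<dots> = (\<integral>\<^sup>+x. (\<Sum>xs\<in>F. ennreal ((A xs)\<^sup>2) * indicator (cell xs) x) \<partial>unit_leb)"
    by (simp add: nn_integral_sum nn_integral_cmult_indicator)
  also have "\<dots> \<le> (\<integral>\<^sup>+x. ennreal (c\<^sup>2) \<partial>unit_leb)"
  proof (rule nn_integral_mono)
    fix x assume "x \<in> space unit_leb"
    then obtain ys where ys: "length ys = ?n" "x \<in> cell ys"
      using cell_cover[of x ?n] by (auto simp: space_restrict_space)
    have "(\<Sum>xs\<in>F. ennreal ((A xs)\<^sup>2) * indicator (cell xs) x) \<le> level_sum A (length ys) x"
    proof -
      have "ennreal ((A xs)\<^sup>2) * indicator (cell xs) x = ennreal ((A xs)\<^sup>2 * indicator (cell xs) x)" for xs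
        by (simp add: indicator_def)
      then show ?thesis
        unfolding level_sum_def ys(1) using finite_bool_lists sub by (simp only:) (intro sum_mono2, auto)
    qed
    also have "\<dots> \<le> ennreal (c\<^sup>2)"
      unfolding level_sum_cell[OF ys(2)] using A by (intro ennreal_leI power_mono) auto
    finally show "(\<Sum>xs\<in>F. ennreal ((A xs)\<^sup>2) * indicator (cell xs) x) \<le> ennreal (c\<^sup>2)" .
  qed
  also have "\<dots> = ennreal (c\<^sup>2)"
    by (simp add: unit_leb_emeasure space_restrict_space)
  finally show ?thesis
    by (simp add: ennreal_le_iff)
qed

text \<open>By orthogonality, differences of finite partial sums are governed by a convergent series
  of weights, so the net of these sums is Cauchy. Completeness is applied to the sums up to depth
  \<open>n\<close>; their limit then serves the whole net.\<close>

lemma haar_sum_exists: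
  assumes A: "A \<in> vecs tree_inf"
  shows "\<exists>f. ((\<lambda>xs. A xs *\<^sub>R haar_vec xs) has_sum f) UNIV"
proof -
  let ?q = "\<lambda>xs. (A xs)\<^sup>2 / 2 ^ length xs" and ?S = "\<lambda>F. \<Sum>xs\<in>F. A xs *\<^sub>R haar_vec xs"
  let ?D = "\<lambda>n. {xs :: bool list. length xs \<le> n}"
  have "?q summable_on UNIV"
    using sum_haar_weights_le[OF branch_le_tree_norm[OF A]]
    by (intro nonneg_bdd_above_summable_on) (auto simp: bdd_above_def)
  then obtain Q where Q: "(?q has_sum Q) UNIV"
    by (auto simp: summable_on_def)
  have tail: "\<exists>n. \<forall>F G. finite F \<longrightarrow> finite G \<longrightarrow> ?D n \<subseteq> F \<longrightarrow> ?D n \<subseteq> G \<longrightarrow> norm (?S F - ?S G) < e"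
    if e: "0 < e" for e
  proof -
    have "eventually (\<lambda>F. dist (sum ?q F) Q < (e / 2)\<^sup>2) (finite_subsets_at_top UNIV)"
      using Q e unfolding has_sum_def by (intro tendstoD) auto
    then obtain F0 where F0: "finite F0" "\<And>F. finite F \<Longrightarrow> F0 \<subseteq> F \<Longrightarrow> dist (sum ?q F) Q < (e / 2)\<^sup>2"
      unfolding eventually_finite_subsets_at_top by auto
    define n where "n = Max (insert 0 (length ` F0))"
    have D: "F0 \<subseteq> ?D n"
      using F0(1) by (auto simp: n_def)
    \<comment> \<open>The squared norm of this difference is the weight of \<open>F - ?D n\<close>,
      which is below \<open>(e / 2)\<^sup>2\<close> because \<open>?D n\<close> contains
      \<open>F0\<close> and thus exhausts \<open>Q\<close> up to that amount.\<close>
    have le: "norm (?S F - ?S (?D n)) < e / 2" if F: "finite F" "?D n \<subseteq> F" for F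
    proof -
      have "sum ?q F \<le> Q"
        using has_sum_mono_neutral[OF has_sum_finite[OF F(1), of ?q] Q] by auto
      then have "sum ?q (F - ?D n) < (e / 2)\<^sup>2"
        using F0(2)[OF finite_bool_lists D] F by (auto simp: sum_diff dist_real_def)
      moreover have "?S F - ?S (?D n) = ?S (F - ?D n)"
        using F by (simp add: sum_diff)
      ultimately have "(norm (?S F - ?S (?D n)))\<^sup>2 < (e / 2)\<^sup>2"
        using F(1) by (simp add: norm_haar_sum)
      then show ?thesis
        by (rule power2_less_imp_less) (use e in simp)
    qed
    have lt: "norm (?S F - ?S G) < e" if "finite F" "finite G" "?D n \<subseteq> F" "?D n \<subseteq> G" for F G
    proof -
      have "?S F - ?S G = (?S F - ?S (?D n)) - (?S G - ?S (?D n))"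
        by (simp only: diff_diff_eq2 diff_add_cancel)
      also have "norm \<dots> \<le> norm (?S F - ?S (?D n)) + norm (?S G - ?S (?D n))"
        by (rule norm_triangle_ineq4)
      finally show ?thesis
        using le[OF that(1,3)] le[OF that(2,4)] by linarith
    qed
    show ?thesis
      by (intro exI[of _ n] allI impI lt)
  qed
  have mono: "?D n \<subseteq> ?D m" if "n \<le> m" for n m
    using that by auto
  have "Cauchy (\<lambda>n. ?S (?D n))"
  proof (rule CauchyI)
    fix e :: real assume "0 < e"
    from tail[OF this] obtain n where n: "\<forall>F G. finite F \<longrightarrow> finite G \<longrightarrow> ?D n \<subseteq> F \<longrightarrow> ?D n \<subseteq> G \<longrightarrow> norm (?S F - ?S G) < e" ..
    show "\<exists>M. \<forall>m\<ge>M. \<forall>n\<ge>M. norm (?S (?D m) - ?S (?D n)) < e"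
      by (intro exI[of _ n] allI impI n[rule_format] finite_bool_lists mono)
  qed
  then obtain f where f: "(\<lambda>n. ?S (?D n)) \<longlonglongrightarrow> f"
    using lsq_Cauchy_convergent by blast
  have "(?S \<longlongrightarrow> f) (finite_subsets_at_top UNIV)"
  proof (rule tendstoI)
    fix e :: real assume "0 < e"
    then have e: "0 < e / 2" by simp
    from tail[OF e] obtain n where n: "\<forall>F G. finite F \<longrightarrow> finite G \<longrightarrow> ?D n \<subseteq> F \<longrightarrow> ?D n \<subseteq> G \<longrightarrow>
      norm (?S F - ?S G) < e / 2" ..
    from LIMSEQ_D[OF f e] obtain k where k: "\<forall>m\<ge>k. norm (?S (?D m) - f) < e / 2" ..
    have "dist (?S F) f < e" if F: "finite F" "?D n \<subseteq> F" for F
    proof -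
      let ?m = "max n k"
      have "norm (?S F - ?S (?D ?m)) < e / 2"
        by (intro n[rule_format] F finite_bool_lists mono) simp
      moreover have "norm (?S (?D ?m) - f) < e / 2"
        by (intro k[rule_format]) simp
      moreover have "dist (?S F) f \<le> dist (?S F) (?S (?D ?m)) + dist (?S (?D ?m)) f"
        by (rule dist_triangle)
      ultimately show ?thesis
        unfolding dist_norm by linarith
    qed
    then show "eventually (\<lambda>F. dist (?S F) f < e) (finite_subsets_at_top UNIV)"
      unfolding eventually_finite_subsets_at_top
      using finite_bool_lists by (intro exI[of _ "?D n"]) auto
  qed
  then show ?thesis
    by (auto simp: has_sum_def)
qed

section \<open>The Haar spaces as tree spaces\<close>

lemma normed_pullback:
  assumes Y: "normed_nspace Y" and sub: "subspace (vecs X)"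
    and U: "\<And>x. x \<in> vecs X \<Longrightarrow> U x \<in> vecs Y" "\<And>x y. U (x + y) = U x + U y" "\<And>c x. U (c *\<^sub>R x) = c *\<^sub>R U x"
    and norm: "\<And>x. x \<in> vecs X \<Longrightarrow> vnorm X x = vnorm Y (U x)"
  shows "normed_nspace X"
proof -
  interpret normed_nspace Y by fact
  show ?thesis
    using sub U norm nonneg scale triangle
    by unfold_locales (auto simp: subspace_add subspace_scale)
qed

lemma subspace_SL_inf: "subspace (vecs SL_inf)"
proof -
  interpret normed_nspace tree_inf
    by (rule normed_tree_inf)
  have "coef 0 = 0"
    by (simp add: coef_def fun_eq_iff)
  then have "0 \<in> vecs SL_inf"
    by (simp add: in_SL_inf)
  moreover have "f + g \<in> vecs SL_inf" if "f \<in> vecs SL_inf" "g \<in> vecs SL_inf" for f g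
    using that has_sum_add[OF conjunct1[OF that(1)[unfolded in_SL_inf]] conjunct1[OF that(2)[unfolded in_SL_inf]]]
    by (simp add: in_SL_inf coef_add scaleR_add_left)
  moreover have "c *\<^sub>R f \<in> vecs SL_inf" if "f \<in> vecs SL_inf" for c f
    using that has_sum_bounded_linear[OF bounded_linear_scaleR_right[of c] conjunct1[OF that[unfolded in_SL_inf]]]
      scaled[of "coef f" c]
    by (simp add: in_SL_inf coef_scaleR) (simp add: scaleR_fun_def)
  ultimately show ?thesis
    by (auto simp: subspace_def)
qed

lemma normed_SL_inf: "normed_nspace SL_inf"
  using normed_tree_inf subspace_SL_inf
  by (rule normed_pullback[where U = coef]) (auto simp: in_SL_inf coef_add coef_scaleR SL_inf_norm)

text \<open>\<open>coef\<close> and summation of the Haar series are mutually inverse and preserve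
  the norm; the series exists because the supremum over branches controls the norm in L2.\<close>

lemma isomorphic_SL_inf: "isomorphic SL_inf tree_inf"
proof -
  define V where "V A = (THE f. ((\<lambda>xs. A xs *\<^sub>R haar_vec xs) has_sum f) UNIV)" for A
  have V_eq: "V A = f" if "((\<lambda>xs. A xs *\<^sub>R haar_vec xs) has_sum f) UNIV" for A f
    unfolding V_def using that has_sum_unique by (intro the_equality) blast+
  have V: "((\<lambda>xs. A xs *\<^sub>R haar_vec xs) has_sum V A) UNIV" if "A \<in> vecs tree_inf" for A
    using haar_sum_exists[OF that] V_eq by auto
  have cV: "coef (V A) = A" if "A \<in> vecs tree_inf" for A
    using V[OF that] by (rule coef_haar_sum)
  have VS: "V A \<in> vecs SL_inf" if "A \<in> vecs tree_inf" for A
    using that V by (simp add: in_SL_inf cV)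
  have Vc: "V (coef f) = f" if "f \<in> vecs SL_inf" for f
    using that by (intro V_eq) (simp add: in_SL_inf)
  have "bop 1 SL_inf tree_inf coef"
    by (rule bopI) (auto simp: in_SL_inf coef_add coef_scaleR SL_inf_norm)
  moreover have "bop 1 tree_inf SL_inf V"
  proof (rule bopI)
    show "V (A + B) = V A + V B" if "A \<in> vecs tree_inf" "B \<in> vecs tree_inf" for A B
      using Vc[of "V A + V B"] VS that subspace_add[OF subspace_SL_inf] by (simp add: coef_add cV)
    show "V (c *\<^sub>R A) = c *\<^sub>R V A" if "A \<in> vecs tree_inf" for c A
      using Vc[of "c *\<^sub>R V A"] VS that subspace_scale[OF subspace_SL_inf] by (simp add: coef_scaleR cV)
  qed (auto simp: VS cV SL_inf_norm)
  ultimately show ?thesis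
    unfolding isomorphic_def using cV Vc by (blast intro: bop_operator)
qed

definition haar_poly :: "nat \<Rightarrow> (bool list \<Rightarrow> real) \<Rightarrow> lsq"
  where "haar_poly n A = (\<Sum>xs\<in>{xs. length xs \<le> n}. A xs *\<^sub>R haar_vec xs)"

lemma haar_poly_sum:
  assumes "A \<in> vecs (tree n)"
  shows "((\<lambda>xs. A xs *\<^sub>R haar_vec xs) has_sum haar_poly n A) UNIV"
  unfolding haar_poly_def using assms finite_bool_lists
  by (intro has_sum_finite_neutralI) (auto simp: in_tree)

lemma SL_fin_eq_haar_poly: "vecs (SL_fin n) = haar_poly n ` vecs (tree n)"
proof (intro equalityI subsetI)
  fix f assume "f \<in> vecs (SL_fin n)"
  then have "f \<in> span (haar_vec ` {xs. length xs \<le> n})"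
    by (simp add: SL_fin_def dyadic_upto_eq image_image)
  then have "\<exists>A\<in>vecs (tree n). f = haar_poly n A"
  proof (induction rule: span_induct_alt)
    case base
    show ?case
      by (intro bexI[of _ "\<lambda>_. 0"]) (auto simp: in_tree haar_poly_def)
  next
    case (step c g h)
    then obtain A ys where A: "A \<in> vecs (tree n)" "h = haar_poly n A" and ys: "length ys \<le> n" "g = haar_vec ys"
      by auto
    let ?B = "\<lambda>xs. (if xs = ys then c else 0) + A xs"
    have "haar_poly n ?B = (\<Sum>xs\<in>{xs. length xs \<le> n}. if xs = ys then c *\<^sub>R haar_vec ys else 0) + haar_poly n A"
      unfolding haar_poly_def sum.distrib[symmetric] by (intro sum.cong) (auto simp: scaleR_add_left)
    also have "\<dots> = c *\<^sub>R g + h"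
      using A(2) ys finite_bool_lists by (subst sum.delta) auto
    finally show ?case
      using A(1) ys(1) by (intro bexI[of _ ?B]) (auto simp: in_tree)
  qed
  then show "f \<in> haar_poly n ` vecs (tree n)"
    by blast
next
  have "haar_poly n A \<in> span (haar_lsq ` dyadic_upto n)" for A
    unfolding haar_poly_def dyadic_upto_eq by (intro span_sum span_scale span_base) auto
  then show "f \<in> vecs (SL_fin n)" if "f \<in> haar_poly n ` vecs (tree n)" for f
    using that by (auto simp: SL_fin_def)
qed

lemma coef_haar_poly: "A \<in> vecs (tree n) \<Longrightarrow> coef (haar_poly n A) = A"
  using haar_poly_sum by (rule coef_haar_sum)

lemma SL_fin_coef:
  assumes "f \<in> vecs (SL_fin n)"
  shows "coef f \<in> vecs (tree n)" "haar_poly n (coef f) = f" "vnorm (SL_fin n) f = tree_norm (coef f)"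
proof -
  obtain A where A: "A \<in> vecs (tree n)" "f = haar_poly n A"
    using assms by (auto simp: SL_fin_eq_haar_poly)
  then show 1: "coef f \<in> vecs (tree n)" "haar_poly n (coef f) = f"
    by (simp_all add: coef_haar_poly)
  have "((\<lambda>xs. coef f xs *\<^sub>R haar_vec xs) has_sum f) UNIV"
    using haar_poly_sum[OF 1(1)] 1(2) by simp
  then have "f \<in> vecs SL_inf"
    using 1(1) tree_subset by (auto simp: in_SL_inf)
  from SL_inf_norm[OF this] show "vnorm (SL_fin n) f = tree_norm (coef f)"
    by (simp add: SL_inf_def SL_fin_def)
qed

lemma normed_SL_fin: "normed_nspace (SL_fin n)"
proof (rule normed_pullback[where U = coef and Y = "tree n", OF normed_tree])
  show "subspace (vecs (SL_fin n))"
    by (simp add: SL_fin_def subspace_span)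
qed (auto simp: SL_fin_coef coef_add coef_scaleR)

lemma bop_SL_fin:
  "bop 1 (SL_fin n) (tree n) coef" "bop 1 (tree n) (SL_fin n) (haar_poly n)"
proof -
  show "bop 1 (SL_fin n) (tree n) coef"
    by (rule bopI) (auto simp: SL_fin_coef coef_add coef_scaleR)
  have mem: "haar_poly n A \<in> vecs (SL_fin n)" if "A \<in> vecs (tree n)" for A
    using that by (simp add: SL_fin_eq_haar_poly)
  show "bop 1 (tree n) (SL_fin n) (haar_poly n)"
  proof (rule bopI)
    fix A assume A: "A \<in> vecs (tree n)"
    show "haar_poly n A \<in> vecs (SL_fin n)" "vnorm (SL_fin n) (haar_poly n A) \<le> 1 * vnorm (tree n) A"
      using mem[OF A] by (simp_all add: SL_fin_coef coef_haar_poly A)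
  qed (simp_all add: haar_poly_def scaleR_fun_def scaleR_add_left sum.distrib scaleR_sum_right)
qed

lemma SL_sum_tree_sum:
  assumes r: "1 \<le> r"
  shows "bop 1 (SL_sum r) (direct_sum r tree) (\<lambda>F n. coef (F n))"
    "bop 1 (direct_sum r tree) (SL_sum r) (\<lambda>F n. haar_poly n (F n))"
    "isomorphic (SL_sum r) (direct_sum r tree)"
  using isomorphic_direct_sum[OF r normed_SL_fin normed_tree bop_SL_fin SL_fin_coef(2) coef_haar_poly]
  by auto

section \<open>Operator norms and transfer to the Haar spaces\<close>

lemma op_norm_le:
  assumes "normed_nspace X" "bop K X Y T" "0 \<le> K"
  shows "op_norm X Y T \<le> K"
proof -
  interpret normed_nspace X by fact
  have "vnorm Y (T x) \<le> K" if "x \<in> vecs X" "vnorm X x \<le> 1" for x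
    using bopD(4)[OF assms(2) that(1)] mult_left_mono[OF that(2) assms(3)] by linarith
  moreover have "0 \<in> {x \<in> vecs X. vnorm X x \<le> 1}"
    by simp
  then have "{x \<in> vecs X. vnorm X x \<le> 1} \<noteq> {}"
    by blast
  ultimately show ?thesis
    unfolding op_norm_def by (intro cSUP_least) auto
qed

text \<open>The supremum is compared with the value at 0, a point of the unit ball. Nonnegativity
  allows the two norm estimates to be multiplied.\<close>

lemma op_norm_nonneg:
  assumes X: "normed_nspace X" and Y: "normed_nspace Y" and T: "bop K X Y T" and K: "0 \<le> K"
  shows "0 \<le> op_norm X Y T"
proof -
  interpret X: normed_nspace X by fact
  interpret Y: normed_nspace Y by fact
  have "vnorm Y (T x) \<le> K" if "x \<in> vecs X" "vnorm X x \<le> 1" for x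
    using bopD(4)[OF T that(1)] mult_left_mono[OF that(2) K] by linarith
  then have "vnorm Y (T 0) \<le> op_norm X Y T"
    unfolding op_norm_def by (intro cSUP_upper bdd_aboveI[of _ K]) auto
  moreover have "0 \<le> vnorm Y (T 0)"
    using bopD(1)[OF T X.zero] by (rule Y.nonneg)
  ultimately show ?thesis
    by linarith
qed

text \<open>Conjugation with the isometry onto the sum of trees; both directions have bound 1, so
  the constants 1 and 2 survive.\<close>

theorem SL_sum_factorization:
  assumes r: "1 \<le> r" and T: "operator (SL_sum r) (SL_sum r) T"
  shows "\<exists>R S. bop 1 (SL_sum r) (SL_sum r) R \<and> bop 2 (SL_sum r) (SL_sum r) S \<and>
    (\<exists>H\<in>{T, \<lambda>x. x - T x}. \<forall>x\<in>vecs (SL_sum r). S (H (R x)) = x)"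
proof -
  let ?E = "SL_sum r" and ?X = "direct_sum r tree"
  define U :: "(nat \<Rightarrow> lsq) \<Rightarrow> nat \<Rightarrow> bool list \<Rightarrow> real" where "U F n = coef (F n)" for F n
  define V :: "(nat \<Rightarrow> bool list \<Rightarrow> real) \<Rightarrow> nat \<Rightarrow> lsq" where "V F n = haar_poly n (F n)" for F n
  have U: "bop 1 ?E ?X U" and V: "bop 1 ?X ?E V"
    using SL_sum_tree_sum(1,2)[OF r] unfolding U_def[abs_def] V_def[abs_def] by auto
  have VU: "V (U F) = F" if "F \<in> vecs ?E" for F
    using that by (auto simp: U_def V_def SL_fin_coef in_direct_sum)
  have UV: "U (V F) = F" if "F \<in> vecs ?X" for F
    using that by (auto simp: U_def V_def coef_haar_poly in_direct_sum)
  have E: "normed_nspace ?E"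
    using r normed_SL_fin by (rule normed_direct_sum)
  have X: "normed_nspace ?X"
    using r normed_tree by (rule normed_direct_sum)
  have T': "operator ?X ?X (\<lambda>x. U (T (V x)))"
    by (intro operator_comp[OF operator_comp[OF bop_operator[OF V] T E] bop_operator[OF U] E])
  from tree_sum_factorization[OF r T'] obtain R S H where R: "bop 1 ?X ?X R" and S: "bop 2 ?X ?X S"
    and H: "H \<in> {\<lambda>x. U (T (V x)), \<lambda>x. x - U (T (V x))}" and SHR: "\<And>x. x \<in> vecs ?X \<Longrightarrow> S (H (R x)) = x"
    by blast
  have R': "bop 1 ?E ?E (\<lambda>x. V (R (U x)))"
    using bop_comp[OF bop_comp[OF U R] V] by simp
  have S': "bop 2 ?E ?E (\<lambda>x. V (S (U x)))"
    using bop_comp[OF bop_comp[OF U S] V] by simp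
  \<comment> \<open>The alternative found for the conjugate of \<open>T\<close> is the conjugate of
    the same alternative for \<open>T\<close>, by linearity of \<open>U\<close> and
    \<open>U (V x) = x\<close>.\<close>
  have "\<exists>G\<in>{T, \<lambda>x. x - T x}. \<forall>x\<in>vecs ?X. U (G (V x)) = H x"
    using H
  proof (elim insertE emptyE)
    assume "H = (\<lambda>x. U (T (V x)))"
    then show ?thesis
      by (intro bexI[of _ T]) simp_all
  next
    assume 2: "H = (\<lambda>x. x - U (T (V x)))"
    have "U (V x - T (V x)) = H x" if x: "x \<in> vecs ?X" for x
      using operator_diff_arg[OF bop_operator[OF U] E, of "V x" "T (V x)"] bopD(1)[OF V x]
        operatorD(1)[OF T] UV[OF x] by (simp add: 2)
    then show ?thesis
      by (intro bexI[of _ "\<lambda>x. x - T x"]) simp_all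
  qed
  then obtain G where G: "G \<in> {T, \<lambda>x. x - T x}" "\<forall>x\<in>vecs ?X. U (G (V x)) = H x" ..
  have "V (S (U (G (V (R (U x)))))) = x" if x: "x \<in> vecs ?E" for x
    using bopD(1)[OF U x] bopD(1)[OF R] SHR VU[OF x] by (simp add: bspec[OF G(2)])
  then show ?thesis
    using R' S' G(1)
    by (intro exI[of _ "\<lambda>x. V (R (U x))"] exI[of _ "\<lambda>x. V (S (U x))"] conjI bexI[of _ G] ballI)
qed

theorem theorem2p3:
  shows "(\<forall>r::ennreal. 1 \<le> r \<longrightarrow>
            (\<forall>T. operator (SL_sum r) (SL_sum r) T \<longrightarrow>
              (\<forall>\<eta>::real. \<eta> > 0 \<longrightarrow>
                (\<exists>R S. operator (SL_sum r) (SL_sum r) R \<and> operator (SL_sum r) (SL_sum r) S \<and>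
                  (\<exists>H\<in>{T, \<lambda>x. x - T x}. \<forall>x\<in>vecs (SL_sum r). S (H (R x)) = x) \<and>
                  op_norm (SL_sum r) (SL_sum r) R * op_norm (SL_sum r) (SL_sum r) S \<le> 2 + \<eta>)))) \<and>
         (\<forall>r::ennreal. 1 \<le> r \<longrightarrow> primary (SL_sum r)) \<and>
         primary SL_inf"
proof (intro conjI allI impI)
  fix r :: ennreal and T and \<eta> :: real
  assume r: "1 \<le> r" and T: "operator (SL_sum r) (SL_sum r) T" and \<eta>: "\<eta> > 0"
  let ?E = "SL_sum r"
  have E: "normed_nspace ?E"
    using r normed_SL_fin by (rule normed_direct_sum)
  obtain R S where R: "bop 1 ?E ?E R" and S: "bop 2 ?E ?E S"
    and H: "\<exists>H\<in>{T, \<lambda>x. x - T x}. \<forall>x\<in>vecs ?E. S (H (R x)) = x"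
    using SL_sum_factorization[OF r T] by (elim exE conjE)
  have "op_norm ?E ?E R * op_norm ?E ?E S \<le> 1 * 2"
    using op_norm_le[OF E R] op_norm_le[OF E S] op_norm_nonneg[OF E E S]
    by (intro mult_mono) auto
  then have "op_norm ?E ?E R * op_norm ?E ?E S \<le> 2 + \<eta>"
    using \<eta> by simp
  then show "\<exists>R S. operator ?E ?E R \<and> operator ?E ?E S \<and>
      (\<exists>H\<in>{T, \<lambda>x. x - T x}. \<forall>x\<in>vecs ?E. S (H (R x)) = x) \<and>
      op_norm ?E ?E R * op_norm ?E ?E S \<le> 2 + \<eta>"
    using bop_operator[OF R] bop_operator[OF S] H by (intro exI[of _ R] exI[of _ S] conjI)
next
  have factor: "\<exists>R S. operator (direct_sum r tree) (direct_sum r tree) R \<and> operator (direct_sum r tree) (direct_sum r tree) S \<and>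
      (\<exists>H\<in>{T, \<lambda>x. x - T x}. \<forall>x\<in>vecs (direct_sum r tree). S (H (R x)) = x)"
    if r: "1 \<le> r" and T: "operator (direct_sum r tree) (direct_sum r tree) T" for r T
  proof -
    obtain R S where "bop 1 (direct_sum r tree) (direct_sum r tree) R" "bop 2 (direct_sum r tree) (direct_sum r tree) S"
      "\<exists>H\<in>{T, \<lambda>x. x - T x}. \<forall>x\<in>vecs (direct_sum r tree). S (H (R x)) = x"
      using tree_sum_factorization[OF r T] by (elim exE conjE)
    then show ?thesis
      by (intro exI[of _ R] exI[of _ S] conjI bop_operator)
  qed
  show "primary (SL_sum r)" if r: "1 \<le> r" for r
    by (rule primaryI[OF r normed_direct_sum[OF r normed_tree] normed_direct_sum[OF r normed_SL_fin]
          SL_sum_tree_sum(3)[OF r] factor[OF r] cembeds_tree_sums[OF r]])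
  have r: "1 \<le> (top :: ennreal)"
    by simp
  have "isomorphic SL_inf (direct_sum top tree)"
    using isomorphic_SL_inf isomorphic_tree_inf normed_tree_inf by (rule isomorphic_trans)
  \<comment> \<open>\<open>SL_inf\<close> takes the role of \<open>E\<close>, with the tree sum for
    r = \<infinity> as \<open>X\<close>: operators are factored on the sum and only the projections
    are transported.\<close>
  then show "primary SL_inf"
    by (rule primaryI[OF r normed_direct_sum[OF r normed_tree] normed_SL_inf
          _ factor[OF r] cembeds_tree_sums[OF r]])
qed

end
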